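(* Let $p > 1$. There exists $\varepsilon_1 > 0$ such that the following holds. Let $u_0 \in W^{1,1}(\mathbb R) \cap W^{1,p}(\mathbb R)$ and $u_1 \in L^1(\mathbb R) \cap L^p(\mathbb R)$. If $$\| u_0 \|_{W^{1,1} \cap W^{1,p}} + \| u_1 \|_{L^1 \cap L^p} \leq \varepsilon_1$$ and $$u_0(x) \leq 0, \qquad u_1(x) + \frac12 u_0(x) \leq 0$$ for (almost) every $x \in \mathbb R$, then there exists a mild solution $$u \in C([0,\infty); W^{1,1}(\mathbb R) \cap W^{1,p}(\mathbb R)) \cap C^1((0,\infty); L^1(\mathbb R) \cap L^p(\mathbb R)),$$ taking only non-positive values, to the Cauchy problem $$\partial_t^2 u + \partial_t u - \partial_x^2 u = |u|^p, \qquad u(0) = u_0, \qquad \partial_t u(0) = u_1 \qquad (t>0,\ x \in \mathbb R).$$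
   Context: All functions are real-valued. $W^{1,q}(\mathbb R) = \{ g \in L^q(\mathbb R) : g' \in L^q(\mathbb R)\}$ is the usual Sobolev space, and an intersection $A \cap B$ of normed spaces carries the usual norm, e.g. $\|g\|_{A\cap B} = \|g\|_A + \|g\|_B$. Linear propagator: for $t \geq 0$, $$S(t) g(x) = \frac12 \int_{-t}^{t} e^{-t/2} I_0\Big(\frac{\sqrt{t^2-y^2}}{2}\Big) g(x-y)\, dy,$$ where, for integers $\ell \ge 0$, $I_\ell(z) = \sum_{k=0}^\infty \frac{1}{k!(k+\ell)!} \left(\frac z2\right)^{2k+\ell}$ is the modified Bessel function of the first kind of order $\ell$. Its time derivative is $$\partial_t S(t) g(x) = e^{-t/2}\,\frac{g(x+t)+g(x-t)}{2} + \int_{-t}^{t} \frac{e^{-t/2}}{4}\Big( \frac{t}{\omega} I_1\big(\tfrac{\omega}{2}\big) - I_0\big(\tfrac{\omega}{2}\big)\Big) g(x-y)\, dy, \qquad \omega = \sqrt{t^2-y^2}.$$ Mild solution: a mild solution on $[0,\infty)$ is a function $u \in C([0,\infty); L^1(\mathbb R) \cap L^p(\mathbb R))$ satisfying, for all $t \ge 0$, $$u(t,x) = S(t)(u_0+u_1)(x) + \partial_t S(t) u_0(x) + \int_0^t S(t-\tau) |u(\tau)|^p(x)\, d\tau.$$ *)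

theory Defs
  imports "HOL-Analysis.Analysis"
begin

text \<open>
  Elements of the Lebesgue and Sobolev spaces are represented by Borel functions on the line
  (every Lebesgue class has a Borel representative); equality in these spaces is equality almost
  everywhere, so pointwise statements about their elements are meant almost everywhere.
\<close>

definition L_space :: "real \<Rightarrow> (real \<Rightarrow> real) set" where
  "L_space q = {g \<in> borel_measurable lborel. integrable lborel (\<lambda>x. \<bar>g x\<bar> powr q)}"

definition L_norm :: "real \<Rightarrow> (real \<Rightarrow> real) \<Rightarrow> real" where
  "L_norm q g = (LINT x|lborel. \<bar>g x\<bar> powr q) powr (1 / q)"

definition test_function :: "(real \<Rightarrow> real) \<Rightarrow> bool" where
  "test_function \<phi> \<longleftrightarrow>
     (\<forall>k. \<forall>x. (deriv ^^ k) \<phi> differentiable (at x)) \<and> (\<exists>R. \<forall>x. \<bar>x\<bar> > R \<longrightarrow> \<phi> x = 0)"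

definition locally_integrable :: "(real \<Rightarrow> real) \<Rightarrow> bool" where
  "locally_integrable g \<longleftrightarrow> (\<forall>a b. set_integrable lborel {a..b} g)"

definition has_weak_deriv :: "(real \<Rightarrow> real) \<Rightarrow> (real \<Rightarrow> real) \<Rightarrow> bool" where
  "has_weak_deriv g h \<longleftrightarrow> locally_integrable g \<and> locally_integrable h \<and>
     (\<forall>\<phi>. test_function \<phi> \<longrightarrow>
        (LINT x|lborel. g x * deriv \<phi> x) = - (LINT x|lborel. h x * \<phi> x))"

text \<open>
  Weak derivatives are unique only almost everywhere, so \<open>weak_deriv\<close> picks a representative.
\<close>

definition weak_deriv :: "(real \<Rightarrow> real) \<Rightarrow> real \<Rightarrow> real" where
  "weak_deriv g = (SOME h. has_weak_deriv g h)"

definition W1_space :: "real \<Rightarrow> (real \<Rightarrow> real) set" where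
  "W1_space q = {g \<in> L_space q. \<exists>h \<in> L_space q. has_weak_deriv g h}"

definition W1_norm :: "real \<Rightarrow> (real \<Rightarrow> real) \<Rightarrow> real" where
  "W1_norm q g = L_norm q g + L_norm q (weak_deriv g)"

definition L1Lp_space :: "real \<Rightarrow> (real \<Rightarrow> real) set" where
  "L1Lp_space p = L_space 1 \<inter> L_space p"

definition L1Lp_norm :: "real \<Rightarrow> (real \<Rightarrow> real) \<Rightarrow> real" where
  "L1Lp_norm p g = L_norm 1 g + L_norm p g"

definition W11W1p_space :: "real \<Rightarrow> (real \<Rightarrow> real) set" where
  "W11W1p_space p = W1_space 1 \<inter> W1_space p"

definition W11W1p_norm :: "real \<Rightarrow> (real \<Rightarrow> real) \<Rightarrow> real" where
  "W11W1p_norm p g = W1_norm 1 g + W1_norm p g"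

text \<open>
  \<open>C0_into T X N\<close> and \<open>C1_into T X N\<close> are the spaces \<open>C(T; X)\<close> and \<open>C\<^sup>1(T; X)\<close>
  for the function space \<open>X\<close> with (semi)norm \<open>N\<close>; the first argument of \<open>u\<close> is time.
\<close>

definition C0_into ::
  "real set \<Rightarrow> (real \<Rightarrow> real) set \<Rightarrow> ((real \<Rightarrow> real) \<Rightarrow> real) \<Rightarrow> (real \<Rightarrow> real \<Rightarrow> real) set" where
  "C0_into T X N = {u. (\<forall>t\<in>T. u t \<in> X) \<and>
     (\<forall>s\<in>T. ((\<lambda>t. N (\<lambda>x. u t x - u s x)) \<longlongrightarrow> 0) (at s within T))}"

definition C1_into ::
  "real set \<Rightarrow> (real \<Rightarrow> real) set \<Rightarrow> ((real \<Rightarrow> real) \<Rightarrow> real) \<Rightarrow> (real \<Rightarrow> real \<Rightarrow> real) set" where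
  "C1_into T X N = {u. (\<forall>t\<in>T. u t \<in> X) \<and>
     (\<exists>v \<in> C0_into T X N. \<forall>s\<in>T.
        ((\<lambda>t. N (\<lambda>x. (u t x - u s x) / (t - s) - v s x)) \<longlongrightarrow> 0) (at s within T))}"

definition bessel_I :: "nat \<Rightarrow> real \<Rightarrow> real" where
  "bessel_I l z = (\<Sum>k. 1 / (fact k * fact (k + l)) * (z / 2) ^ (2 * k + l))"

definition propagator :: "real \<Rightarrow> (real \<Rightarrow> real) \<Rightarrow> real \<Rightarrow> real" where
  "propagator t g x = 1 / 2 *
     (LBINT y:{-t..t}. exp (- t / 2) * bessel_I 0 (sqrt (t\<^sup>2 - y\<^sup>2) / 2) * g (x - y))"

text \<open>
  The time derivative of \<open>propagator\<close>, in closed form. The integrand has a removable singularity at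
  \<open>\<bar>y\<bar> = t\<close>, where it takes a value that is immaterial for the integral.
\<close>

definition dt_propagator :: "real \<Rightarrow> (real \<Rightarrow> real) \<Rightarrow> real \<Rightarrow> real" where
  "dt_propagator t g x =
     exp (- t / 2) * ((g (x + t) + g (x - t)) / 2) +
     (LBINT y:{-t..t}.
        (let \<omega> = sqrt (t\<^sup>2 - y\<^sup>2) in
          exp (- t / 2) / 4 * (t / \<omega> * bessel_I 1 (\<omega> / 2) - bessel_I 0 (\<omega> / 2)) * g (x - y)))"

text \<open>
  Mild solutions on \<open>[0,\<infinity>)\<close> of \<open>u\<^sub>t\<^sub>t + u\<^sub>t - u\<^sub>x\<^sub>x = \<bar>u\<bar>\<^sup>p\<close>, \<open>u(0) = u0\<close>, \<open>u\<^sub>t(0) = u1\<close>.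
  The integral equation is an identity in \<open>L\<^sup>1 \<inter> L\<^sup>p\<close> for each time. The Duhamel integral is taken
  pointwise in \<open>x\<close>: as \<open>\<bar>u(\<tau>)\<bar>\<^sup>p\<close> is continuous in \<open>\<tau>\<close> with values in \<open>L\<^sup>1\<close>, its integrand is
  continuous in \<open>\<tau>\<close> for each \<open>x\<close> and does not depend on the representatives of \<open>u(\<tau>)\<close>.
\<close>

definition mild_solution ::
  "real \<Rightarrow> (real \<Rightarrow> real) \<Rightarrow> (real \<Rightarrow> real) \<Rightarrow> (real \<Rightarrow> real \<Rightarrow> real) \<Rightarrow> bool" where
  "mild_solution p u0 u1 u \<longleftrightarrow>
     u \<in> C0_into {0..} (L1Lp_space p) (L1Lp_norm p) \<and>
     (\<forall>t\<ge>0. AE x in lborel.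
        u t x = propagator t (\<lambda>z. u0 z + u1 z) x + dt_propagator t u0 x +
                (LBINT \<tau>:{0..t}. propagator (t - \<tau>) (\<lambda>z. \<bar>u \<tau> z\<bar> powr p) x))"

end

theory Submission
  imports Defs
begin

text \<open>
  Put \<open>w = - e\<^bsup>t/2\<^esup> u\<close>. The equation becomes \<open>w\<^sub>t\<^sub>t - w\<^sub>x\<^sub>x = w/4 - e\<^bsup>t/2\<^esup> (e\<^bsup>-t/2\<^esup> w)\<^sup>p\<close>, with initial
  data \<open>\<phi> = - u0 \<ge> 0\<close> and \<open>\<psi> = - (u1 + u0/2) \<ge> 0\<close>. As long as \<open>0 \<le> e\<^bsup>-t/2\<^esup> w \<le> m\<close> with \<open>p m\<^bsup>p-1\<^esup> = 1/4\<close>, the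
  right-hand side is nonnegative, nondecreasing in \<open>w\<close> and at most \<open>w/4\<close>. Since the d'Alembert kernel is
  nonnegative, the Picard iteration from \<open>0\<close> increases and stays below the solution of the linear equation
  \<open>w\<^sub>t\<^sub>t - w\<^sub>x\<^sub>x = w/4\<close>, which the Bessel representation bounds by \<open>m e\<^bsup>t/2\<^esup>\<close> for small data. So monotone convergence
  gives a global solution for every \<open>p > 1\<close>, and all of this happens with nonnegative functions, where
  Tonelli's theorem needs no integrability. The resolvent identity between the d'Alembert kernel and
  the Bessel kernel turns the d'Alembert form into the mild formulation, and the regularity is read off
  the d'Alembert form, whose derivatives are translates of the data and of the source.
\<close>

section \<open>Convergence in \<open>L\<^sup>q\<close>\<close>

text \<open>The mild formulation alone is not monotone: for \<open>u \<le> 0\<close> the Duhamel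
  term has the sign opposite to that of the data, so its Picard map is antitone. Moving the mass
  term \<open>w/4\<close> to the right-hand side repairs this, because \<open>w/4\<close> dominates
  the absorption as long as the derivative of \<open>s powr p\<close> is at most 1/4; this is the
  condition \<open>p * m powr (p - 1) \<le> 1/4\<close> and the origin of the smallness constant.
  The price is that the iteration lives with the d'Alembert kernel, while the claim is about Bessel
  kernels. No decay in time is used: the Bessel kernels grow at most like
  \<open>exp (t / 2)\<close>, which is the weight between \<open>u\<close> and \<open>w\<close>, so
  smallness of the data gives a bound by \<open>m\<close> for all times. That bound has to be
  pointwise, and the pointwise size of \<open>\<phi>\<close> is controlled by the \<open>L^1\<close>
  norm of its derivative.\<close>

definition Lpow :: "real \<Rightarrow> (real \<Rightarrow> real) \<Rightarrow> ennreal" where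
  "Lpow q f = (\<integral>\<^sup>+x. ennreal (\<bar>f x\<bar> powr q) \<partial>lborel)"

lemma powr_abs_add_le:
  fixes a b q :: real
  assumes "q \<ge> 0"
  shows "\<bar>a + b\<bar> powr q \<le> 2 powr q * (\<bar>a\<bar> powr q + \<bar>b\<bar> powr q)"
proof -
  have "\<bar>a + b\<bar> powr q \<le> (2 * max \<bar>a\<bar> \<bar>b\<bar>) powr q"
    using assms by (intro powr_mono2) auto
  also have "\<dots> = 2 powr q * (max \<bar>a\<bar> \<bar>b\<bar>) powr q"
    by (simp add: powr_mult)
  also have "(max \<bar>a\<bar> \<bar>b\<bar>) powr q \<le> \<bar>a\<bar> powr q + \<bar>b\<bar> powr q"
    by (simp add: max_def)
  finally show ?thesis by simp
qed

lemma Lpow_cong_AE: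
  assumes "AE x in lborel. f x = g x"
  shows "Lpow q f = Lpow q g"
  unfolding Lpow_def using assms by (intro nn_integral_cong_AE) auto

lemma Lpow_mono_AE:
  assumes "AE x in lborel. \<bar>f x\<bar> \<le> \<bar>g x\<bar>" "q \<ge> 0"
  shows "Lpow q f \<le> Lpow q g"
  unfolding Lpow_def using assms by (intro nn_integral_mono_AE) (auto intro!: powr_mono2 ennreal_leI)

text \<open>A quasi-triangle inequality stands in for Minkowski's. The factor is harmless, since
  only finiteness and convergence to 0 are ever derived from it.\<close>

lemma Lpow_add_le:
  assumes [measurable]: "f \<in> borel_measurable borel" "g \<in> borel_measurable borel" and q: "q \<ge> 0"
  shows "Lpow q (\<lambda>x. f x + g x) \<le> ennreal (2 powr q) * (Lpow q f + Lpow q g)"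
proof -
  have "Lpow q (\<lambda>x. f x + g x) \<le> (\<integral>\<^sup>+x. ennreal (2 powr q) * (ennreal (\<bar>f x\<bar> powr q) + ennreal (\<bar>g x\<bar> powr q)) \<partial>lborel)"
    unfolding Lpow_def
    by (intro nn_integral_mono) (use powr_abs_add_le[OF q] in \<open>auto simp flip: ennreal_plus ennreal_mult intro!: ennreal_leI\<close>)
  also have "\<dots> = ennreal (2 powr q) * (Lpow q f + Lpow q g)"
    unfolding Lpow_def by (simp add: nn_integral_cmult nn_integral_add)
  finally show ?thesis .
qed

lemma Lpow_cmult:
  assumes [measurable]: "f \<in> borel_measurable borel"
  shows "Lpow q (\<lambda>x. c * f x) = ennreal (\<bar>c\<bar> powr q) * Lpow q f"
  unfolding Lpow_def by (simp add: abs_mult powr_mult ennreal_mult nn_integral_cmult)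

lemma Lpow_uminus: "Lpow q (\<lambda>x. - f x) = Lpow q f"
  unfolding Lpow_def by simp

lemma Lpow_minus_commute: "Lpow q (\<lambda>x. f x - g x) = Lpow q (\<lambda>x. g x - f x)"
  unfolding Lpow_def by (simp add: abs_minus_commute)

lemma Lpow_translate:
  assumes [measurable]: "f \<in> borel_measurable borel"
  shows "Lpow q (\<lambda>x. f (x + c)) = Lpow q f"
  unfolding Lpow_def
  using nn_integral_real_affine[of "\<lambda>x. ennreal (\<bar>f x\<bar> powr q)" 1 c] by (simp add: add.commute)

lemma L_space_iff: "g \<in> L_space q \<longleftrightarrow> g \<in> borel_measurable borel \<and> Lpow q g < \<infinity>"
  unfolding L_space_def Lpow_def integrable_iff_bounded by auto

lemma L_norm_eq: "g \<in> borel_measurable borel \<Longrightarrow> L_norm q g = enn2real (Lpow q g) powr (1 / q)"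
  unfolding L_norm_def Lpow_def by (subst integral_eq_nn_integral) auto

text \<open>All limits are taken for \<open>Lpow\<close>, whose values in \<open>ennreal\<close>
  need no integrability side conditions; this lemma transfers them to the norms of the
  statement.\<close>

lemma L_norm_tendsto_0:
  assumes "\<And>t. f t \<in> borel_measurable borel" "q > 0" "((\<lambda>t. Lpow q (f t)) \<longlongrightarrow> 0) F"
  shows "((\<lambda>t. L_norm q (f t)) \<longlongrightarrow> 0) F"
proof -
  have "((\<lambda>t. enn2real (Lpow q (f t))) \<longlongrightarrow> 0) F"
    using tendsto_enn2real[of "\<lambda>t. Lpow q (f t)" 0 F] assms(3) by simp
  then have "((\<lambda>t. enn2real (Lpow q (f t)) powr (1 / q)) \<longlongrightarrow> 0) F"
    using assms(2) by (intro tendsto_zero_powrI[where b="1/q"]) auto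
  with L_norm_eq[OF assms(1)] show ?thesis by simp
qed

lemma tendsto_ennreal_0_squeeze:
  fixes f g :: "_ \<Rightarrow> ennreal"
  assumes "(g \<longlongrightarrow> 0) F" "eventually (\<lambda>t. f t \<le> g t) F"
  shows "(f \<longlongrightarrow> 0) F"
  by (rule tendsto_sandwich[of "\<lambda>_. 0" f F g]) (use assms in auto)

lemma Lpow_add_tendsto_0:
  assumes "\<And>t. f t \<in> borel_measurable borel" "\<And>t. g t \<in> borel_measurable borel" "q \<ge> 0"
    and "((\<lambda>t. Lpow q (f t)) \<longlongrightarrow> 0) F" "((\<lambda>t. Lpow q (g t)) \<longlongrightarrow> 0) F"
  shows "((\<lambda>t. Lpow q (\<lambda>x. f t x + g t x)) \<longlongrightarrow> 0) F"
proof (rule tendsto_ennreal_0_squeeze)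
  have "((\<lambda>t. ennreal (2 powr q) * (Lpow q (f t) + Lpow q (g t))) \<longlongrightarrow> ennreal (2 powr q) * (0 + 0)) F"
    using assms by (intro ennreal_tendsto_cmult tendsto_add) auto
  then show "((\<lambda>t. ennreal (2 powr q) * (Lpow q (f t) + Lpow q (g t))) \<longlongrightarrow> 0) F" by simp
  show "eventually (\<lambda>t. Lpow q (\<lambda>x. f t x + g t x) \<le> ennreal (2 powr q) * (Lpow q (f t) + Lpow q (g t))) F"
    using Lpow_add_le assms by auto
qed

lemma Lpow_bounded_cmult_tendsto_0:
  assumes "\<And>t. f t \<in> borel_measurable borel" "q \<ge> 0"
    and "((\<lambda>t. Lpow q (f t)) \<longlongrightarrow> 0) F" "(c \<longlongrightarrow> (d::real)) F"
  shows "((\<lambda>t. Lpow q (\<lambda>x. c t * f t x)) \<longlongrightarrow> 0) F"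
proof (rule tendsto_ennreal_0_squeeze)
  have "((\<lambda>t. ennreal ((\<bar>d\<bar> + 1) powr q) * Lpow q (f t)) \<longlongrightarrow> ennreal ((\<bar>d\<bar> + 1) powr q) * 0) F"
    using assms by (intro ennreal_tendsto_cmult) auto
  then show "((\<lambda>t. ennreal ((\<bar>d\<bar> + 1) powr q) * Lpow q (f t)) \<longlongrightarrow> 0) F" by simp
  have "eventually (\<lambda>t. \<bar>c t\<bar> < \<bar>d\<bar> + 1) F"
    using tendsto_rabs[OF assms(4)] by (rule order_tendstoD) simp
  then show "eventually (\<lambda>t. Lpow q (\<lambda>x. c t * f t x) \<le> ennreal ((\<bar>d\<bar> + 1) powr q) * Lpow q (f t)) F"
    by eventually_elim
      (use assms in \<open>auto simp: Lpow_cmult intro!: mult_right_mono ennreal_leI powr_mono2\<close>)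
qed

lemma Lpow_cmult_null_tendsto_0:
  assumes [measurable]: "f \<in> borel_measurable borel" and "q > 0" "Lpow q f < \<infinity>" "(c \<longlongrightarrow> (0::real)) F"
  shows "((\<lambda>t. Lpow q (\<lambda>x. c t * f x)) \<longlongrightarrow> 0) F"
proof -
  have "((\<lambda>t. \<bar>c t\<bar> powr q) \<longlongrightarrow> 0) F"
    using assms(2,4) by (intro tendsto_zero_powrI[where b=q]) (auto simp: tendsto_rabs_zero_iff)
  then have "((\<lambda>t. ennreal (\<bar>c t\<bar> powr q) * Lpow q f) \<longlongrightarrow> ennreal 0 * Lpow q f) F"
    using assms(3) by (intro tendsto_mult_ennreal tendsto_ennrealI) auto
  then show ?thesis by (simp add: Lpow_cmult)
qed

lemma Lpow_1: "Lpow 1 f = (\<integral>\<^sup>+x. ennreal \<bar>f x\<bar> \<partial>lborel)"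
  unfolding Lpow_def by (intro nn_integral_cong) simp

lemma Lpow_1_less_top_iff:
  "f \<in> borel_measurable borel \<Longrightarrow> Lpow 1 f < \<infinity> \<longleftrightarrow> integrable lborel f"
  unfolding Lpow_1 integrable_iff_bounded by auto

text \<open>For an open set \<open>U\<close> the indicator is lower semicontinuous, which gives dominated convergence
  for the negative part of the difference; the positive part has the same integral.\<close>

lemma translation_continuous_open:
  fixes U :: "real set"
  assumes U: "open U" and fin: "emeasure lborel U < \<infinity>"
  shows "((\<lambda>h. Lpow 1 (\<lambda>x. indicator U (x + h) - indicator U x)) \<longlongrightarrow> 0) (at 0)"
proof -
  have [measurable]: "U \<in> sets borel" using U by simp
  define ii :: "real \<Rightarrow> real" where "ii = indicator U"
  have [measurable]: "ii \<in> borel_measurable borel" unfolding ii_def by simp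
  have int: "integrable lborel ii" unfolding ii_def using fin by simp
  have intt: "integrable lborel (\<lambda>x. ii (x + h))" for h
    using lborel_integrable_real_affine[OF int, of 1 h] by (simp add: add.commute)
  have eqint: "(LINT x|lborel. ii (x + h)) = (LINT x|lborel. ii x)" for h
    using lborel_integral_real_affine[of 1 ii h] by (simp add: add.commute)
  have ptw: "((\<lambda>h. max 0 (ii x - ii (x + h))) \<longlongrightarrow> 0) (at 0)" for x
  proof (cases "x \<in> U")
    case True
    have "((\<lambda>h. x + h) \<longlongrightarrow> x + 0) (at 0)" by (intro tendsto_intros)
    then have "eventually (\<lambda>h. x + h \<in> U) (at 0)"
      using U True by (intro topological_tendstoD[where l="x + 0"]) auto
    then have "eventually (\<lambda>h. max 0 (ii x - ii (x + h)) = 0) (at 0)"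
      by eventually_elim (use True in \<open>auto simp: ii_def\<close>)
    then show ?thesis by (rule tendsto_eventually)
  next
    case False
    then have "max 0 (ii x - ii (x + h)) = 0" for h by (auto simp: ii_def indicator_def)
    then show ?thesis by simp
  qed
  have "((\<lambda>h. LINT x|lborel. max 0 (ii x - ii (x + h))) \<longlongrightarrow> 0) (at 0)"
    unfolding tendsto_at_iff_sequentially comp_def
  proof (intro allI impI)
    fix X :: "nat \<Rightarrow> real" assume X: "\<forall>i. X i \<in> UNIV - {0}" "X \<longlonglongrightarrow> 0"
    have "(\<lambda>i. LINT x|lborel. max 0 (ii x - ii (x + X i))) \<longlonglongrightarrow> (LINT x|(lborel::real measure). (0::real))"
    proof (rule integral_dominated_convergence[where w=ii and f="\<lambda>_. 0" and s="\<lambda>i x. max 0 (ii x - ii (x + X i))"])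
      show "AE x in lborel. (\<lambda>i. max 0 (ii x - ii (x + X i))) \<longlonglongrightarrow> 0"
        using ptw X unfolding tendsto_at_iff_sequentially comp_def by auto
      show "AE x in lborel. norm (max 0 (ii x - ii (x + X i))) \<le> ii x" for i
        by (auto simp: ii_def indicator_def)
    qed (use int in auto)
    then show "(\<lambda>i. LINT x|lborel. max 0 (ii x - ii (x + X i))) \<longlonglongrightarrow> 0" by simp
  qed
  then have lim: "((\<lambda>h. ennreal (2 * (LINT x|lborel. max 0 (ii x - ii (x + h))))) \<longlongrightarrow> ennreal (2 * 0)) (at 0)"
    by (intro tendsto_intros) auto
  have "Lpow 1 (\<lambda>x. ii (x + h) - ii x) = ennreal (2 * (LINT x|lborel. max 0 (ii x - ii (x + h))))" for h
  proof -
    have ip: "integrable lborel (\<lambda>x. max 0 (ii x - ii (x + h)))"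
      using int intt by (intro integrable_max) auto
    have "Lpow 1 (\<lambda>x. ii (x + h) - ii x) = ennreal (LINT x|lborel. \<bar>ii (x + h) - ii x\<bar>)"
      unfolding Lpow_1 using int intt by (intro nn_integral_eq_integral) auto
    also have "(LINT x|lborel. \<bar>ii (x + h) - ii x\<bar>) = (LINT x|lborel. 2 * max 0 (ii x - ii (x + h)) + (ii (x + h) - ii x))"
      by (intro Bochner_Integration.integral_cong) (auto simp: max_def)
    also have "\<dots> = 2 * (LINT x|lborel. max 0 (ii x - ii (x + h)))"
      using ip int intt[of h] eqint[of h] by simp
    finally show ?thesis .
  qed
  with lim show ?thesis unfolding ii_def by simp
qed

text \<open>The three-epsilon argument: translations preserve \<open>Lpow 1\<close>, so continuity
  of translations passes to functions that are approximable in \<open>L^1\<close>.\<close>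

lemma translation_continuous_approx:
  assumes [measurable]: "f \<in> borel_measurable borel"
    and approx: "\<And>e::ennreal. e > 0 \<Longrightarrow> \<exists>g\<in>borel_measurable borel. Lpow 1 (\<lambda>x. f x - g x) < e \<and>
          ((\<lambda>h. Lpow 1 (\<lambda>x. g (x + h) - g x)) \<longlongrightarrow> 0) (at (0::real))"
  shows "((\<lambda>h. Lpow 1 (\<lambda>x. f (x + h) - f x)) \<longlongrightarrow> 0) (at 0)"
proof (rule order_tendstoI)
  fix e :: ennreal assume "e < 0"
  then show "eventually (\<lambda>h. e < Lpow 1 (\<lambda>x. f (x + h) - f x)) (at 0)"
    by (metis not_less_zero)
next
  fix e :: ennreal assume "0 < e"
  \<comment> \<open>The minimum with 1 keeps the tolerance finite when \<open>e\<close> is infinite,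
    and three quarters of it stay strictly below \<open>e\<close>.\<close>
  define d where "d = min 1 e / 4"
  have e: "d + d + d < e" "d > 0"
  proof -
    obtain r where r: "min 1 e = ennreal r" "r \<ge> 0"
      by (cases "min 1 e") (auto simp: min_def split: if_splits)
    then have "r > 0" using \<open>0 < e\<close> by (auto simp: min_def split: if_splits)
    have d: "d = ennreal (r / 4)"
      unfolding d_def r using r by (simp add: divide_ennreal[symmetric])
    then have "d + d + d = ennreal (3 * r / 4)" using r by (simp flip: ennreal_plus)
    also have "\<dots> < min 1 e" unfolding r using \<open>r > 0\<close> by (intro ennreal_lessI) auto
    finally show "d + d + d < e" by simp
    show "d > 0" using d \<open>r > 0\<close> by simp
  qed
  obtain g where [measurable]: "g \<in> borel_measurable borel" and fg: "Lpow 1 (\<lambda>x. f x - g x) < d"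
    and g: "((\<lambda>h. Lpow 1 (\<lambda>x. g (x + h) - g x)) \<longlongrightarrow> 0) (at (0::real))"
    using approx[OF \<open>d > 0\<close>] by blast
  have tr: "Lpow 1 (\<lambda>x. a x + b x) \<le> Lpow 1 a + Lpow 1 b"
    if [measurable]: "a \<in> borel_measurable borel" "b \<in> borel_measurable borel" for a b
    unfolding Lpow_1
    by (subst nn_integral_add[symmetric]) (auto intro!: nn_integral_mono ennreal_leI simp flip: ennreal_plus)
  have "eventually (\<lambda>h. Lpow 1 (\<lambda>x. g (x + h) - g x) < d) (at 0)"
    using order_tendstoD(2)[OF g \<open>d > 0\<close>] .
  then show "eventually (\<lambda>h. Lpow 1 (\<lambda>x. f (x + h) - f x) < e) (at 0)"
  proof eventually_elim
    case (elim h)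
    have "Lpow 1 (\<lambda>x. f (x + h) - f x) = Lpow 1 (\<lambda>x. ((f (x + h) - g (x + h)) + (g (x + h) - g x)) + (g x - f x))"
      by simp
    also have "\<dots> \<le> (Lpow 1 (\<lambda>x. f (x + h) - g (x + h)) + Lpow 1 (\<lambda>x. g (x + h) - g x)) + Lpow 1 (\<lambda>x. g x - f x)"
      by (intro order_trans[OF tr] add_mono tr order_refl) auto
    also have "\<dots> = (Lpow 1 (\<lambda>x. f x - g x) + Lpow 1 (\<lambda>x. g (x + h) - g x)) + Lpow 1 (\<lambda>x. f x - g x)"
      using Lpow_translate[of "\<lambda>x. f x - g x" 1 h] Lpow_minus_commute[of 1 f g] by simp
    also have "\<dots> \<le> d + d + d"
      using fg elim by (intro add_mono) auto
    finally show ?case using e by auto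
  qed
qed

text \<open>Outer regularity approximates a measurable set from outside by open sets, for which the
  claim is known; sums and dominated limits extend it to all integrable functions.\<close>

lemma translation_continuous_L1:
  fixes f :: "real \<Rightarrow> real"
  assumes "integrable lborel f"
  shows "((\<lambda>h. Lpow 1 (\<lambda>x. f (x + h) - f x)) \<longlongrightarrow> 0) (at 0)"
  using assms
proof (induction rule: integrable_induct)
  case (base A c)
  have [measurable]: "A \<in> sets borel" using base by simp
  have ind: "((\<lambda>h. Lpow 1 (\<lambda>x. indicator A (x + h) - indicator A x)) \<longlongrightarrow> 0) (at 0)"
  proof (rule translation_continuous_approx)
    fix e :: ennreal assume "e > 0"
    then obtain z where z: "0 < z" "z < e" using dense by blast
    obtain r where r: "r > 0" "ennreal r < e"
      using z by (cases z) auto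
    obtain U where U: "open U" "A \<subseteq> U" "emeasure lborel (U - A) < ennreal r"
      using outer_regular_lborel[of A r] base \<open>r > 0\<close> by auto
    have [measurable]: "U \<in> sets borel" using U by simp
    have "emeasure lborel U = emeasure lborel A + emeasure lborel (U - A)"
      using U(2) by (subst plus_emeasure) (auto intro!: arg_cong[where f="emeasure lborel"])
    also have "\<dots> < \<infinity>" using base(2) less_trans[OF U(3) ennreal_less_top] by auto
    finally have "emeasure lborel U < \<infinity>" .
    moreover have "Lpow 1 (\<lambda>x. indicator A x - indicator U x) = emeasure lborel (U - A)"
    proof -
      have "Lpow 1 (\<lambda>x. indicator A x - indicator U x) = (\<integral>\<^sup>+x. indicator (U - A) x \<partial>lborel)"
        unfolding Lpow_1 using U(2) by (intro nn_integral_cong) (auto simp: indicator_def)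
      then show ?thesis by simp
    qed
    ultimately show "\<exists>g\<in>borel_measurable borel. Lpow 1 (\<lambda>x. indicator A x - g x) < e \<and>
          ((\<lambda>h. Lpow 1 (\<lambda>x. g (x + h) - g x)) \<longlongrightarrow> 0) (at (0::real))"
      using translation_continuous_open[OF U(1)] U(3) r(2) by (intro bexI[of _ "indicator U"]) auto
  qed auto
  have "((\<lambda>h. Lpow 1 (\<lambda>x. c * (indicator A (x + h) - indicator A x))) \<longlongrightarrow> 0) (at 0)"
    by (rule Lpow_bounded_cmult_tendsto_0[OF _ _ ind tendsto_const]) auto
  then show ?case by (simp add: algebra_simps)
next
  case (add f g)
  then have [measurable]: "f \<in> borel_measurable borel" "g \<in> borel_measurable borel" by auto
  have "((\<lambda>h. Lpow 1 (\<lambda>x. (f (x + h) - f x) + (g (x + h) - g x))) \<longlongrightarrow> 0) (at 0)"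
    by (rule Lpow_add_tendsto_0) (use add in auto)
  then show ?case by (simp add: algebra_simps)
next
  case (lim f s)
  have [measurable]: "f \<in> borel_measurable borel" "\<And>i. s i \<in> borel_measurable borel"
    using lim by auto
  have "(\<lambda>i. \<integral>\<^sup>+x. ennreal (norm (f x - s i x)) \<partial>lborel) \<longlonglongrightarrow> 0"
  proof (rule nn_integral_dominated_convergence_norm[where w="\<lambda>x. 2 * norm (f x)"])
    show "AE x in lborel. norm (s i x) \<le> 2 * norm (f x)" for i
      using lim(3) by auto
    show "AE x in lborel. (\<lambda>i. s i x) \<longlonglongrightarrow> f x" using lim(2) by auto
    have "(\<integral>\<^sup>+ x. ennreal (2 * norm (f x)) \<partial>lborel) = 2 * (\<integral>\<^sup>+ x. ennreal (norm (f x)) \<partial>lborel)"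
      by (subst nn_integral_cmult[symmetric]) (auto simp: ennreal_mult)
    then show "(\<integral>\<^sup>+ x. ennreal (2 * norm (f x)) \<partial>lborel) < \<infinity>"
      using lim(4) by (auto simp: integrable_iff_bounded ennreal_mult_less_top)
  qed auto
  then have conv: "(\<lambda>i. Lpow 1 (\<lambda>x. f x - s i x)) \<longlonglongrightarrow> 0"
    by (simp add: Lpow_1)
  show ?case
  proof (rule translation_continuous_approx)
    fix e :: ennreal assume "e > 0"
    then obtain i where "Lpow 1 (\<lambda>x. f x - s i x) < e"
      using order_tendstoD(2)[OF conv] eventually_happens'[OF sequentially_bot] by blast
    then show "\<exists>g\<in>borel_measurable borel. Lpow 1 (\<lambda>x. f x - g x) < e \<and>
          ((\<lambda>h. Lpow 1 (\<lambda>x. g (x + h) - g x)) \<longlongrightarrow> 0) (at (0::real))"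
      using lim by (intro bexI[of _ "s i"]) auto
  qed auto
qed

lemma powr_superadditive:
  fixes x y q :: real
  assumes "x \<ge> 0" "y \<ge> 0" "q \<ge> 1"
  shows "x powr q + y powr q \<le> (x + y) powr q"
proof (cases "x = 0 \<or> y = 0")
  case True
  then show ?thesis by auto
next
  case False
  have eq: "z powr q = z * z powr (q - 1)" if "z > 0" for z :: real
    using that by (simp add: powr_diff)
  have "x * x powr (q - 1) \<le> x * (x + y) powr (q - 1)" "y * y powr (q - 1) \<le> y * (x + y) powr (q - 1)"
    using assms by (auto intro!: mult_left_mono powr_mono2)
  then have "x * x powr (q - 1) + y * y powr (q - 1) \<le> (x + y) * (x + y) powr (q - 1)"
    by (simp add: algebra_simps)
  then show ?thesis using False assms eq[of x] eq[of y] eq[of "x + y"] by auto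
qed

text \<open>This reduces continuity of translations in \<open>L\<^sup>q\<close> to the case \<open>q = 1\<close>.\<close>

lemma powr_abs_diff_le_signed_powr:
  fixes a b q :: real
  assumes q: "q \<ge> 1"
  shows "\<bar>a - b\<bar> powr q \<le> 2 powr q * \<bar>sgn a * \<bar>a\<bar> powr q - sgn b * \<bar>b\<bar> powr q\<bar>"
proof -
  have ge: "\<bar>a - b\<bar> powr q \<le> 2 powr q * \<bar>\<bar>a\<bar> powr q - \<bar>b\<bar> powr q\<bar>" if "a \<ge> b" "b \<ge> 0" for a b :: real
  proof -
    have "(a - b) powr q + b powr q \<le> a powr q"
      using powr_superadditive[of "a - b" b q] that q by simp
    then have "\<bar>a - b\<bar> powr q \<le> 1 * \<bar>\<bar>a\<bar> powr q - \<bar>b\<bar> powr q\<bar>" using that by simp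
    also have "\<dots> \<le> 2 powr q * \<bar>\<bar>a\<bar> powr q - \<bar>b\<bar> powr q\<bar>"
      using q by (intro mult_right_mono ge_one_powr_ge_zero) auto
    finally show ?thesis .
  qed
  have same: "\<bar>a - b\<bar> powr q \<le> 2 powr q * \<bar>\<bar>a\<bar> powr q - \<bar>b\<bar> powr q\<bar>" if "a \<ge> 0" "b \<ge> 0" for a b :: real
    using ge[of a b] ge[of b a] that by (cases "a \<ge> b") (auto simp: abs_minus_commute)
  have opp: "\<bar>a - b\<bar> powr q \<le> 2 powr q * (\<bar>a\<bar> powr q + \<bar>b\<bar> powr q)"
    using powr_abs_add_le[of q a "- b"] q by simp
  consider "a = 0 \<or> b = 0" | "a > 0" "b > 0" | "a < 0" "b < 0" | "a > 0" "b < 0" | "a < 0" "b > 0" by linarith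
  then show ?thesis
  proof cases
    case 1
    then show ?thesis using opp by (auto simp: abs_mult sgn_if)
  next
    case 2
    then show ?thesis using same[of a b] by simp
  next
    case 3
    then show ?thesis using same[of "- a" "- b"] by (simp add: abs_minus_commute)
  next
    case 4
    then show ?thesis using opp by simp
  next
    case 5
    have "\<bar>- ((- a) powr q) - b powr q\<bar> = (- a) powr q + b powr q"
      using powr_ge_zero[of "- a" q] powr_ge_zero[of b q] by linarith
    then show ?thesis using opp 5 by simp
  qed
qed

lemma translation_continuous:
  assumes [measurable]: "f \<in> borel_measurable borel" and fin: "Lpow q f < \<infinity>" and q: "q \<ge> 1"
  shows "((\<lambda>h. Lpow q (\<lambda>x. f (x + h) - f x)) \<longlongrightarrow> 0) (at 0)"
proof (rule tendsto_ennreal_0_squeeze)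
  define F where "F x = sgn (f x) * \<bar>f x\<bar> powr q" for x
  have [measurable]: "F \<in> borel_measurable borel" unfolding F_def by measurable
  have "Lpow 1 F \<le> Lpow q f"
    unfolding Lpow_1 Lpow_def F_def by (intro nn_integral_mono ennreal_leI) (auto simp: abs_mult sgn_if)
  then have "integrable lborel F" using fin Lpow_1_less_top_iff[of F] by auto
  then have "((\<lambda>h. Lpow 1 (\<lambda>x. F (x + h) - F x)) \<longlongrightarrow> 0) (at 0)" by (rule translation_continuous_L1)
  then have "((\<lambda>h. ennreal (2 powr q) * Lpow 1 (\<lambda>x. F (x + h) - F x)) \<longlongrightarrow> ennreal (2 powr q) * 0) (at 0)"
    by (intro ennreal_tendsto_cmult) auto
  then show "((\<lambda>h. ennreal (2 powr q) * Lpow 1 (\<lambda>x. F (x + h) - F x)) \<longlongrightarrow> 0) (at 0)" by simp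
  show "eventually (\<lambda>h. Lpow q (\<lambda>x. f (x + h) - f x) \<le> ennreal (2 powr q) * Lpow 1 (\<lambda>x. F (x + h) - F x)) (at 0)"
  proof (intro always_eventually allI)
    fix h
    have "Lpow q (\<lambda>x. f (x + h) - f x) \<le> (\<integral>\<^sup>+x. ennreal (2 powr q) * ennreal \<bar>F (x + h) - F x\<bar> \<partial>lborel)"
      unfolding Lpow_def F_def
      by (intro nn_integral_mono) (auto intro!: ennreal_leI powr_abs_diff_le_signed_powr[OF q] simp flip: ennreal_mult)
    also have "\<dots> = ennreal (2 powr q) * Lpow 1 (\<lambda>x. F (x + h) - F x)"
      unfolding Lpow_1 by (rule nn_integral_cmult) auto
    finally show "Lpow q (\<lambda>x. f (x + h) - f x) \<le> ennreal (2 powr q) * Lpow 1 (\<lambda>x. F (x + h) - F x)" .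
  qed
qed

text \<open>Profile and shift move at the same time, as along a characteristic. The change of
  profile is measured after undoing the shift \<open>c t\<close>; the change of shift acts on the
  fixed profile \<open>g s\<close>, where continuity of translations applies.\<close>

lemma Lpow_moving_translation_tendsto_0:
  fixes c :: "real \<Rightarrow> real" and g :: "real \<Rightarrow> real \<Rightarrow> real"
  assumes meas [measurable]: "\<And>t. g t \<in> borel_measurable borel" and q: "q \<ge> 1"
    and fin: "Lpow q (g s) < \<infinity>"
    and g: "((\<lambda>t. Lpow q (\<lambda>x. g t x - g s x)) \<longlongrightarrow> 0) (at s within T)"
    and c: "(c \<longlongrightarrow> c s) (at s within T)"
  shows "((\<lambda>t. Lpow q (\<lambda>x. g t (x + c t) - g s (x + c s))) \<longlongrightarrow> 0) (at s within T)"
proof -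
  \<comment> \<open>The limit is written as the value at \<open>h = 0\<close>, so that the
    composition may pass through times with \<open>c t = c s\<close>.\<close>
  have lim0: "((\<lambda>h. Lpow q (\<lambda>x. g s (x + h) - g s x)) \<longlongrightarrow> Lpow q (\<lambda>x. g s (x + 0) - g s x)) (at 0)"
    using translation_continuous[OF meas fin q] by (simp add: Lpow_def)
  have "((\<lambda>t. c t - c s) \<longlongrightarrow> c s - c s) (at s within T)" using c by (intro tendsto_intros)
  then have "((\<lambda>t. c t - c s) \<longlongrightarrow> 0) (at s within T)" by simp
  then have "((\<lambda>t. Lpow q (\<lambda>x. g s (x + (c t - c s)) - g s x)) \<longlongrightarrow> Lpow q (\<lambda>x. g s (x + 0) - g s x)) (at s within T)"
    using lim0 by (intro isCont_tendsto_compose[where g="\<lambda>h. Lpow q (\<lambda>x. g s (x + h) - g s x)"]) (auto simp: isCont_def)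
  moreover have "Lpow q (\<lambda>x. g s (x + (c t - c s)) - g s x) = Lpow q (\<lambda>x. g s (x + c t) - g s (x + c s))" for t
    using Lpow_translate[of "\<lambda>x. g s (x + (c t - c s)) - g s x" q "c s"] by (simp add: algebra_simps)
  ultimately have 1: "((\<lambda>t. Lpow q (\<lambda>x. g s (x + c t) - g s (x + c s))) \<longlongrightarrow> 0) (at s within T)"
    by (simp add: Lpow_def)
  have 2: "((\<lambda>t. Lpow q (\<lambda>x. g t (x + c t) - g s (x + c t))) \<longlongrightarrow> 0) (at s within T)"
    using g Lpow_translate[of "\<lambda>x. g _ x - g s x" q "c _"] by simp
  have "((\<lambda>t. Lpow q (\<lambda>x. (g t (x + c t) - g s (x + c t)) + (g s (x + c t) - g s (x + c s)))) \<longlongrightarrow> 0) (at s within T)"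
    using q by (intro Lpow_add_tendsto_0 1 2) auto
  then show ?thesis by simp
qed

section \<open>Jensen's inequality and difference quotients in \<open>L^q\<close>\<close>

lemma powr_above_tangent:
  fixes a k q :: real
  assumes "a \<ge> 0" "k > 0" "q \<ge> 1"
  shows "k powr q + q * k powr (q - 1) * (a - k) \<le> a powr q"
proof (cases "a = 0")
  case True
  have "k powr q = k * k powr (q - 1)" using assms by (simp add: powr_diff)
  then have "k powr q + q * k powr (q - 1) * (0 - k) = (1 - q) * k powr q" by (simp add: algebra_simps)
  also have "\<dots> \<le> 0" using assms by (intro mult_nonpos_nonneg) auto
  finally show ?thesis using True by simp
next
  case False
  have "convex_on {0<..} (\<lambda>x. x powr q)" using assms by (intro powr_convex)
  then have "a powr q - k powr q \<ge> (q * k powr (q - 1)) * (a - k)"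
  proof (rule convex_on_imp_above_tangent)
    show "((\<lambda>x. x powr q) has_real_derivative q * k powr (q - 1)) (at k within {0<..})"
      using assms by (auto intro!: derivative_eq_intros)
  qed (use assms False in \<open>auto simp: interior_open\<close>)
  then show ?thesis by simp
qed

text \<open>Jensen's inequality, by integrating the tangent of \<open>z powr q\<close> at the
  absolute value of the average. The right-hand side may be infinite, so no integrability of the
  power is assumed.\<close>

lemma powr_average_le:
  fixes g :: "real \<Rightarrow> real"
  assumes cd: "c < d" and q: "q \<ge> 1" and g: "set_integrable lborel {c..d} g"
  shows "ennreal (\<bar>(LBINT x:{c..d}. g x) / (d - c)\<bar> powr q) \<le>
    ennreal (1 / (d - c)) * (\<integral>\<^sup>+x. ennreal (indicator {c..d} x * \<bar>g x\<bar> powr q) \<partial>lborel)"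
proof -
  define k where "k = \<bar>(LBINT x:{c..d}. g x) / (d - c)\<bar>"
  define h where "h x = indicator {c..d} x * \<bar>g x\<bar>" for x
  have ih: "integrable lborel h"
    using set_integrable_abs[OF g] unfolding h_def set_integrable_def by simp
  then have [measurable]: "h \<in> borel_measurable borel" by auto
  have hp: "h x powr q = indicator {c..d} x * \<bar>g x\<bar> powr q" for x
    by (auto simp: h_def indicator_def)
  \<comment> \<open>The tangent needs a positive base point, and the integration below needs an
    integrable power; in the two exceptional cases the inequality is trivial.\<close>
  show ?thesis
  proof (cases "k = 0 \<or> (\<integral>\<^sup>+x. ennreal (h x powr q) \<partial>lborel) = \<infinity>")
    case True
    then show ?thesis unfolding k_def[symmetric] hp using cd by (auto simp: ennreal_mult_top)
  next
    case False
    then have kpos: "k > 0" unfolding k_def by auto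
    have ihq: "integrable lborel (\<lambda>x. h x powr q)"
      using False by (auto simp: integrable_iff_bounded less_top)
    have ii: "integrable lborel (indicator {c..d} :: real \<Rightarrow> real)" using cd by (intro integrable_real_indicator) auto
    have kint: "k * (d - c) \<le> (LINT x|lborel. h x)"
    proof -
      have "k * (d - c) = \<bar>LBINT x:{c..d}. g x\<bar>" unfolding k_def using cd by simp
      also have "\<dots> \<le> (LINT x|lborel. h x)"
        unfolding set_lebesgue_integral_def
        by (rule order_trans[OF integral_abs_bound]) (simp add: h_def abs_mult)
      finally show ?thesis .
    qed
    \<comment> \<open>The added term is nonnegative because \<open>kint\<close> says that
      \<open>h\<close> has mean at least \<open>k\<close>. With it, the expression is the integral
      of the tangent line at \<open>k\<close>, evaluated along \<open>h\<close>.\<close>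
    have "k powr q * (d - c) \<le> k powr q * (d - c) + q * k powr (q - 1) * ((LINT x|lborel. h x) - k * (d - c))"
      using kint q by simp
    also have "\<dots> = (LINT x|lborel. (k powr q - q * k powr (q - 1) * k) * indicator {c..d} x + q * k powr (q - 1) * h x)"
      using ih ii cd by (simp add: algebra_simps)
    also have "\<dots> \<le> (LINT x|lborel. h x powr q)"
    proof (rule integral_mono)
      fix x
      show "(k powr q - q * k powr (q - 1) * k) * indicator {c..d} x + q * k powr (q - 1) * h x \<le> h x powr q"
        using powr_above_tangent[of "\<bar>g x\<bar>" k q] kpos q by (auto simp: h_def indicator_def algebra_simps)
    qed (use ih ii ihq in auto)
    finally have "k powr q \<le> (LINT x|lborel. h x powr q) / (d - c)" using cd by (simp add: field_simps)
    then have "ennreal (k powr q) \<le> ennreal ((1 / (d - c)) * (LINT x|lborel. h x powr q))"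
      by (intro ennreal_leI) simp
    also have "\<dots> = ennreal (1 / (d - c)) * (\<integral>\<^sup>+x. ennreal (h x powr q) \<partial>lborel)"
      using cd ihq by (subst nn_integral_eq_integral, auto simp del: times_divide_eq_left simp flip: ennreal_mult)
    finally show ?thesis unfolding k_def hp .
  qed
qed

text \<open>The difference quotient minus the derivative is an average of \<open>f' \<tau> - f' s\<close> over \<open>\<tau>\<close>,
  so Jensen's inequality and Tonelli bound its \<open>L\<^sup>q\<close> size.\<close>

lemma Lpow_difference_quotient_tendsto_0:
  fixes f f' :: "real \<Rightarrow> real \<Rightarrow> real"
  assumes q: "q \<ge> 1" and s: "s \<ge> 0"
    and meas [measurable]: "case_prod f' \<in> borel_measurable (lborel \<Otimes>\<^sub>M lborel)"
    and ftc: "\<And>a b. 0 \<le> a \<Longrightarrow> a \<le> b \<Longrightarrow> AE x in lborel.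
      set_integrable lborel {a..b} (\<lambda>\<tau>. f' \<tau> x) \<and> f b x - f a x = (LBINT \<tau>:{a..b}. f' \<tau> x)"
    and cont: "((\<lambda>t. Lpow q (\<lambda>x. f' t x - f' s x)) \<longlongrightarrow> 0) (at s within {0..})"
  shows "((\<lambda>t. Lpow q (\<lambda>x. (f t x - f s x) / (t - s) - f' s x)) \<longlongrightarrow> 0) (at s within {0..})"
proof (rule order_tendstoI)
  fix e :: ennreal assume "e < 0"
  then show "eventually (\<lambda>t. e < Lpow q (\<lambda>x. (f t x - f s x) / (t - s) - f' s x)) (at s within {0..})"
    by (metis not_less_zero)
next
  fix e :: ennreal assume "0 < e"
  \<comment> \<open>Averaging preserves only non-strict bounds, hence the intermediate
    tolerance.\<close>
  then obtain e' where e': "0 < e'" "e' < e" using dense by blast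
  have [measurable]: "f' t \<in> borel_measurable lborel" for t
    using measurable_compose[OF measurable_Pair1' meas, of t] by simp
  \<comment> \<open>The interval will be \<open>{s..t}\<close> or \<open>{t..s}\<close>, so that
    quotients from both sides are covered.\<close>
  have avg: "Lpow q (\<lambda>x. (f b x - f a x) / (b - a) - f' s x) \<le> e'"
    if ab: "0 \<le> a" "a < b" and small: "\<And>t. t \<in> {a..b} \<Longrightarrow> Lpow q (\<lambda>x. f' t x - f' s x) \<le> e'" for a b
  proof -
    have "Lpow q (\<lambda>x. (f b x - f a x) / (b - a) - f' s x) \<le>
      (\<integral>\<^sup>+x. ennreal (1 / (b - a)) * (\<integral>\<^sup>+\<tau>. ennreal (indicator {a..b} \<tau> * \<bar>f' \<tau> x - f' s x\<bar> powr q) \<partial>lborel) \<partial>lborel)"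
      unfolding Lpow_def
    proof (rule nn_integral_mono_AE)
      show "AE x in lborel. ennreal (\<bar>(f b x - f a x) / (b - a) - f' s x\<bar> powr q) \<le>
        ennreal (1 / (b - a)) * (\<integral>\<^sup>+\<tau>. ennreal (indicator {a..b} \<tau> * \<bar>f' \<tau> x - f' s x\<bar> powr q) \<partial>lborel)"
        using ftc[OF ab(1) less_imp_le[OF ab(2)]]
      proof eventually_elim
        case (elim x)
        then have int: "set_integrable lborel {a..b} (\<lambda>\<tau>. f' \<tau> x)"
          and eq: "f b x - f a x = (LBINT \<tau>:{a..b}. f' \<tau> x)" using ab by auto
        have ci: "set_integrable lborel {a..b} (\<lambda>\<tau>. f' s x)"
          unfolding set_integrable_def using ab by (auto intro!: integrable_real_indicator)
        have "(LBINT \<tau>:{a..b}. f' \<tau> x - f' s x) = (LBINT \<tau>:{a..b}. f' \<tau> x) - (LBINT \<tau>:{a..b}. f' s x)"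
          using int ci by simp
        also have "(LBINT \<tau>:{a..b}. f' s x) = (b - a) * f' s x"
          unfolding set_lebesgue_integral_def using ab by simp
        finally have "(f b x - f a x) / (b - a) - f' s x = (LBINT \<tau>:{a..b}. f' \<tau> x - f' s x) / (b - a)"
          using ab eq by (simp add: field_simps)
        then show ?case
          using powr_average_le[of a b q "\<lambda>\<tau>. f' \<tau> x - f' s x"] ab q int ci by simp
      qed
    qed
    also have "\<dots> = ennreal (1 / (b - a)) * (\<integral>\<^sup>+x. (\<integral>\<^sup>+\<tau>. ennreal (indicator {a..b} \<tau> * \<bar>f' \<tau> x - f' s x\<bar> powr q) \<partial>lborel) \<partial>lborel)"
      by (rule nn_integral_cmult) measurable
    also have "(\<integral>\<^sup>+x. (\<integral>\<^sup>+\<tau>. ennreal (indicator {a..b} \<tau> * \<bar>f' \<tau> x - f' s x\<bar> powr q) \<partial>lborel) \<partial>lborel)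
      = (\<integral>\<^sup>+\<tau>. (\<integral>\<^sup>+x. ennreal (indicator {a..b} \<tau> * \<bar>f' \<tau> x - f' s x\<bar> powr q) \<partial>lborel) \<partial>lborel)"
      by (rule lborel_pair.Fubini') measurable
    also have "\<dots> \<le> (\<integral>\<^sup>+\<tau>. e' * indicator {a..b} \<tau> \<partial>lborel)"
      using small by (intro nn_integral_mono) (auto simp: indicator_def Lpow_def)
    also have "\<dots> = e' * ennreal (b - a)" using ab by (simp add: nn_integral_cmult)
    also have "ennreal (1 / (b - a)) * (e' * ennreal (b - a)) = ennreal (1 / (b - a) * (b - a)) * e'"
      using ab by (subst ennreal_mult) (auto simp: mult_ac)
    also have "\<dots> = e'" using ab by simp
    finally show ?thesis by (simp add: mult_left_mono)
  qed
  have "eventually (\<lambda>t. Lpow q (\<lambda>x. f' t x - f' s x) < e') (at s within {0..})"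
    using order_tendstoD(2)[OF cont e'(1)] .
  then obtain d where d: "d > 0" "\<And>t. t \<ge> 0 \<Longrightarrow> t \<noteq> s \<Longrightarrow> dist t s < d \<Longrightarrow> Lpow q (\<lambda>x. f' t x - f' s x) < e'"
    unfolding eventually_at by auto
  have small: "Lpow q (\<lambda>x. f' t x - f' s x) \<le> e'" if "t \<ge> 0" "dist t s < d" for t
    using d(2)[of t] that by (cases "t = s") (auto simp: Lpow_def less_imp_le)
  show "eventually (\<lambda>t. Lpow q (\<lambda>x. (f t x - f s x) / (t - s) - f' s x) < e) (at s within {0..})"
    unfolding eventually_at
  proof (intro exI[of _ d] conjI ballI impI)
    fix t assume t: "t \<in> {0..}" "t \<noteq> s \<and> dist t s < d"
    have "Lpow q (\<lambda>x. (f t x - f s x) / (t - s) - f' s x) \<le> e'"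
    proof (cases "s < t")
      case True
      then show ?thesis using t s small by (intro avg) (auto simp: dist_real_def)
    next
      case False
      have "(f t x - f s x) / (t - s) = (f s x - f t x) / (s - t)" for x
        by (metis minus_diff_eq minus_divide_divide)
      then show ?thesis using t s small False by (simp, intro avg) (auto simp: dist_real_def)
    qed
    then show "Lpow q (\<lambda>x. (f t x - f s x) / (t - s) - f' s x) < e" using e' by simp
  qed (use d in auto)
qed

section \<open>Weak derivatives on the line\<close>

text \<open>The polynomial, the power and the exponential together form a family closed under
  differentiation, so one first-derivative computation yields smoothness. As \<open>c\<close> tends
  to 0, the bumps with \<open>P = 1\<close> and \<open>n = 0\<close> tend to the indicator of the
  open interval.\<close>

definition bump :: "real poly \<Rightarrow> nat \<Rightarrow> real \<Rightarrow> real \<Rightarrow> real \<Rightarrow> real \<Rightarrow> real" where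
  "bump P n c a b x = (if a < x \<and> x < b
     then poly P x / ((x - a) * (b - x)) ^ n * exp (- c / ((x - a) * (b - x))) else 0)"

text \<open>\<open>Q\<close> is \<open>(x - a) * (b - x)\<close>; the polynomial is the numerator
  given by the product and quotient rules over the common denominator
  \<open>Q ^ (n + 2)\<close>.\<close>

definition bump_deriv_poly :: "real poly \<Rightarrow> nat \<Rightarrow> real \<Rightarrow> real \<Rightarrow> real \<Rightarrow> real poly" where
  "bump_deriv_poly P n c a b = (let Q = [:- a * b, a + b, - 1:] in
     pderiv P * Q\<^sup>2 - smult (real n) (P * pderiv Q * Q) + smult c (P * pderiv Q))"

lemma power_div_fact_le_exp:
  fixes z :: real
  assumes "z \<ge> 0"
  shows "z ^ k / fact k \<le> exp z"
proof -
  have "(\<Sum>n\<in>{k}. inverse (fact n) * z ^ n) \<le> (\<Sum>n. inverse (fact n) * z ^ n)"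
    using assms by (intro sum_le_suminf summable_exp) auto
  then show ?thesis by (simp add: exp_def divide_inverse mult.commute scaleR_conv_of_real)
qed

text \<open>The exponential beats every power of the distance to the endpoints. Two powers are left
  over, which is what makes the bump differentiable there with derivative 0.\<close>

lemma bump_quadratic_bound:
  assumes c: "c > 0"
  obtains M where "\<And>x. \<bar>bump P n c a b x\<bar> \<le> M * ((x - a) * (b - x))\<^sup>2"
    and "M \<ge> 0"
proof -
  have "bounded (poly P ` {a..b})"
    by (intro compact_imp_bounded compact_continuous_image continuous_intros) auto
  then obtain B where B: "\<And>x. x \<in> {a..b} \<Longrightarrow> \<bar>poly P x\<bar> \<le> B" unfolding bounded_iff by fastforce
  \<comment> \<open>From one term of the exponential series,
    \<open>(c / r) ^ (n + 2) / fact (n + 2) \<le> exp (c / r)\<close>.\<close>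
  define K where "K = fact (n + 2) / c ^ (n + 2)"
  have K: "K > 0" unfolding K_def using c by simp
  have "\<bar>bump P n c a b x\<bar> \<le> (\<bar>B\<bar> * K) * ((x - a) * (b - x))\<^sup>2" for x
  proof (cases "a < x \<and> x < b")
    case True
    define r where "r = (x - a) * (b - x)"
    have r: "r > 0" unfolding r_def using True by simp
    define F :: real where "F = fact (n + 2)"
    have F: "F > 0" unfolding F_def by simp
    have "(c / r) ^ (n + 2) / F \<le> exp (c / r)"
      unfolding F_def using r c by (intro power_div_fact_le_exp) simp
    then have "c ^ (n + 2) \<le> F * r ^ (n + 2) * exp (c / r)"
      using r F by (simp add: power_divide divide_le_eq mult_ac del: power_Suc power_Suc2 add_2_eq_Suc')
    moreover have "c ^ (n + 2) > 0" using c by simp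
    ultimately have "exp (- c / r) \<le> K * r ^ (n + 2)"
      unfolding K_def F_def[symmetric]
      by (simp add: exp_minus field_simps del: power_Suc power_Suc2 add_2_eq_Suc')
    then have "exp (- c / r) / r ^ n \<le> K * r\<^sup>2"
      using r by (simp add: field_simps power2_eq_square)
    moreover have "\<bar>poly P x\<bar> \<le> \<bar>B\<bar>" using B[of x] True by auto
    ultimately have "\<bar>poly P x\<bar> * (exp (- c / r) / r ^ n) \<le> \<bar>B\<bar> * (K * r\<^sup>2)"
      using r by (intro mult_mono) auto
    then show ?thesis using True r by (simp add: bump_def r_def[symmetric] abs_mult)
  next
    case False
    then show ?thesis using K by (auto simp: bump_def)
  qed
  then show ?thesis using K that[of "\<bar>B\<bar> * K"] by auto
qed

text \<open>The factor \<open>h\<close> absorbs the squared distance to the other endpoint of a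
  bump.\<close>

lemma has_real_derivative_0_of_quadratic_bound:
  fixes f :: "real \<Rightarrow> real"
  assumes "\<And>y. \<bar>f y\<bar> \<le> M * (y - x)\<^sup>2 * h y" and "isCont h x"
  shows "(f has_real_derivative 0) (at x)"
proof -
  have fx: "f x = 0" using assms(1)[of x] by simp
  have lim: "((\<lambda>y. \<bar>M\<bar> * \<bar>y - x\<bar> * \<bar>h y\<bar>) \<longlongrightarrow> \<bar>M\<bar> * \<bar>x - x\<bar> * \<bar>h x\<bar>) (at x)"
    using assms(2) by (intro tendsto_intros) (auto simp: isCont_def)
  have "((\<lambda>y. (f y - f x) / (y - x)) \<longlongrightarrow> 0) (at x)"
  proof (rule Lim_null_comparison)
    show "((\<lambda>y. \<bar>M\<bar> * \<bar>y - x\<bar> * \<bar>h y\<bar>) \<longlongrightarrow> 0) (at x)" using lim by simp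
    show "\<forall>\<^sub>F y in at x. norm ((f y - f x) / (y - x)) \<le> \<bar>M\<bar> * \<bar>y - x\<bar> * \<bar>h y\<bar>"
      unfolding eventually_at
    proof (intro exI[of _ 1] conjI ballI impI)
      fix y assume y: "y \<noteq> x \<and> dist y x < 1"
      have "\<bar>f y\<bar> \<le> \<bar>M * (y - x)\<^sup>2 * h y\<bar>" using assms(1)[of y] by linarith
      also have "\<dots> = \<bar>M\<bar> * \<bar>y - x\<bar> * \<bar>h y\<bar> * \<bar>y - x\<bar>" by (simp add: abs_mult power2_eq_square)
      finally show "norm ((f y - f x) / (y - x)) \<le> \<bar>M\<bar> * \<bar>y - x\<bar> * \<bar>h y\<bar>"
        using y fx by (simp add: field_simps)
    qed auto
  qed
  then show ?thesis by (simp add: has_field_derivative_iff)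
qed

lemma has_derivative_div_power_exp:
  fixes p R :: "real \<Rightarrow> real"
  assumes p: "(p has_real_derivative p') (at x)" and R: "(R has_real_derivative d) (at x)"
    and r: "R x = r" "r > 0"
  shows "((\<lambda>x. p x / R x ^ n * exp (- c / R x)) has_real_derivative
    (p' * r\<^sup>2 - n * p x * d * r + c * p x * d) / r ^ (n + 2) * exp (- c / r)) (at x)"
proof (rule DERIV_cong)
  have rn: "R x ^ n \<noteq> 0" "R x \<noteq> 0" using r by auto
  have e: "((\<lambda>x. exp (- c / R x)) has_real_derivative exp (- c / R x) * (c * d / (R x * R x))) (at x)"
    by (rule derivative_eq_intros R rn refl | simp)+
  have q: "((\<lambda>x. p x / R x ^ n) has_real_derivative
      (p' * R x ^ n - p x * (real n * (d * R x ^ (n - Suc 0)))) / (R x ^ n * R x ^ n)) (at x)"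
    by (intro DERIV_divide p DERIV_power R rn)
  show "((\<lambda>x. p x / R x ^ n * exp (- c / R x)) has_real_derivative
      (p' * R x ^ n - p x * (real n * (d * R x ^ (n - Suc 0)))) / (R x ^ n * R x ^ n) * exp (- c / R x)
      + exp (- c / R x) * (c * d / (R x * R x)) * (p x / R x ^ n)) (at x)"
    by (intro DERIV_mult q e)
  have n1: "real n * (d * r ^ (n - Suc 0)) = real n * d * r ^ n / r" using r by (cases n) auto
  define z where "z = r ^ n"
  have z: "z > 0" unfolding z_def using r by simp
  define w where "w = exp (- c / r)"
  show "(p' * R x ^ n - p x * (real n * (d * R x ^ (n - Suc 0)))) / (R x ^ n * R x ^ n) * exp (- c / R x)
      + exp (- c / R x) * (c * d / (R x * R x)) * (p x / R x ^ n)
      = (p' * r\<^sup>2 - n * p x * d * r + c * p x * d) / r ^ (n + 2) * exp (- c / r)"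
    unfolding r(1) n1 power_add z_def[symmetric] w_def[symmetric]
    using r(2) z by (simp add: field_simps power2_eq_square)
qed

lemma bump_has_derivative:
  assumes c: "c > 0"
  shows "(bump P n c a b has_real_derivative bump (bump_deriv_poly P n c a b) (n + 2) c a b x) (at x)"
proof -
  consider "a < x" "x < b" | "x < a \<or> x > b" | "x = a \<or> x = b" by linarith
  then show ?thesis
  proof cases
    case 1
    define r where "r = (x - a) * (b - x)"
    have r: "r > 0" unfolding r_def using 1 by simp
    have Q: "poly [:- a * b, a + b, - 1:] x = r" unfolding r_def by (simp add: algebra_simps)
    have Q': "poly (pderiv [:- a * b, a + b, - 1:]) x = a + b - 2 * x" by (simp add: pderiv_pCons)
    have dr: "((\<lambda>x. (x - a) * (b - x)) has_real_derivative (a + b - 2 * x)) (at x)"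
      by (auto intro!: derivative_eq_intros)
    have d: "((\<lambda>x. poly P x / ((x - a) * (b - x)) ^ n * exp (- c / ((x - a) * (b - x)))) has_real_derivative
       poly (bump_deriv_poly P n c a b) x / r ^ (n + 2) * exp (- c / r)) (at x)"
    proof (rule DERIV_cong)
      show "((\<lambda>x. poly P x / ((x - a) * (b - x)) ^ n * exp (- c / ((x - a) * (b - x)))) has_real_derivative
         (poly (pderiv P) x * r\<^sup>2 - n * poly P x * (a + b - 2 * x) * r + c * poly P x * (a + b - 2 * x)) / r ^ (n + 2) * exp (- c / r)) (at x)"
        by (rule has_derivative_div_power_exp[OF poly_DERIV dr]) (use r in \<open>auto simp: r_def\<close>)
      show "(poly (pderiv P) x * r\<^sup>2 - n * poly P x * (a + b - 2 * x) * r + c * poly P x * (a + b - 2 * x)) / r ^ (n + 2) * exp (- c / r)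
        = poly (bump_deriv_poly P n c a b) x / r ^ (n + 2) * exp (- c / r)"
        unfolding bump_deriv_poly_def Let_def
        by (simp only: poly_add poly_diff poly_mult poly_smult poly_power Q Q') (simp add: mult_ac)
    qed
    have eq: "bump (bump_deriv_poly P n c a b) (n + 2) c a b x
        = poly (bump_deriv_poly P n c a b) x / r ^ (n + 2) * exp (- c / r)"
      using 1 by (simp add: bump_def r_def)
    show ?thesis unfolding eq
      by (rule has_field_derivative_transform_within_open[OF d, of "{a<..<b}"])
         (use 1 in \<open>auto simp: bump_def\<close>)
  next
    case 2
    have "bump (bump_deriv_poly P n c a b) (n + 2) c a b x = 0" using 2 by (auto simp: bump_def)
    moreover have "(bump P n c a b has_real_derivative 0) (at x)"
      by (rule has_field_derivative_transform_within_open[OF DERIV_const[of 0], of "{..<a} \<union> {b<..}"])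
         (use 2 in \<open>auto simp: bump_def\<close>)
    ultimately show ?thesis by simp
  next
    case 3
    obtain M where M: "\<And>x. \<bar>bump P n c a b x\<bar> \<le> M * ((x - a) * (b - x))\<^sup>2"
      using bump_quadratic_bound[OF c] by metis
    have M': "\<bar>bump P n c a b y\<bar> \<le> M * (y - a)\<^sup>2 * (b - y)\<^sup>2" for y
      using M[of y] by (simp add: power_mult_distrib)
    have M'': "\<bar>bump P n c a b y\<bar> \<le> M * (y - b)\<^sup>2 * (y - a)\<^sup>2" for y
      using M'[of y] by (simp add: power2_commute[of b y] mult_ac)
    have "(bump P n c a b has_real_derivative 0) (at a)"
      by (rule has_real_derivative_0_of_quadratic_bound[OF M']) (intro continuous_intros)
    moreover have "(bump P n c a b has_real_derivative 0) (at b)"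
      by (rule has_real_derivative_0_of_quadratic_bound[OF M'']) (intro continuous_intros)
    moreover have "bump (bump_deriv_poly P n c a b) (n + 2) c a b x = 0" using 3 by (auto simp: bump_def)
    ultimately show ?thesis using 3 by auto
  qed
qed

text \<open>Two bumps are differentiated together because the test functions built later have a
  derivative that is one bump minus a multiple of another; \<open>K = 0\<close> gives a single
  bump.\<close>

lemma deriv_bump_linear_combination:
  assumes "c > 0" "c' > 0"
  shows "\<exists>P n P' n'. (deriv ^^ k) (\<lambda>x. bump P0 m c a b x - K * bump P0' m' c' a' b' x) =
    (\<lambda>x. bump P n c a b x - K * bump P' n' c' a' b' x)"
proof (induction k)
  case 0
  then show ?case by auto
next
  case (Suc k)
  then obtain P n P' n' where *: "(deriv ^^ k) (\<lambda>x. bump P0 m c a b x - K * bump P0' m' c' a' b' x) =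
    (\<lambda>x. bump P n c a b x - K * bump P' n' c' a' b' x)" by blast
  have "deriv (\<lambda>x. bump P n c a b x - K * bump P' n' c' a' b' x) =
    (\<lambda>x. bump (bump_deriv_poly P n c a b) (n + 2) c a b x - K * bump (bump_deriv_poly P' n' c' a' b') (n' + 2) c' a' b' x)"
    using assms by (intro ext DERIV_imp_deriv derivative_intros DERIV_cmult bump_has_derivative)
  then show ?case using * by auto
qed

lemma bump_linear_combination_smooth:
  assumes "c > 0" "c' > 0"
  shows "(deriv ^^ k) (\<lambda>x. bump P m c a b x - K * bump P' m' c' a' b' x) differentiable (at x)"
proof -
  obtain P1 n P1' n' where *: "(deriv ^^ k) (\<lambda>x. bump P m c a b x - K * bump P' m' c' a' b' x) =
    (\<lambda>x. bump P1 n c a b x - K * bump P1' n' c' a' b' x)"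
    using deriv_bump_linear_combination[OF assms] by blast
  have "((\<lambda>x. bump P1 n c a b x - K * bump P1' n' c' a' b' x) has_real_derivative
     bump (bump_deriv_poly P1 n c a b) (n + 2) c a b x - K * bump (bump_deriv_poly P1' n' c' a' b') (n' + 2) c' a' b' x) (at x)"
    using assms by (intro derivative_intros DERIV_cmult bump_has_derivative)
  then show ?thesis unfolding * using real_differentiable_def by blast
qed

lemma test_function_bump:
  assumes "c > 0"
  shows "test_function (bump P m c a b)"
  unfolding test_function_def
proof (intro conjI allI)
  show "(deriv ^^ k) (bump P m c a b) differentiable at x" for k x
    using bump_linear_combination_smooth[OF assms assms, of k P m a b 0 P m a b x] by simp
  show "\<exists>R. \<forall>x. R < \<bar>x\<bar> \<longrightarrow> bump P m c a b x = 0"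
    by (rule exI[of _ "\<bar>a\<bar> + \<bar>b\<bar>"]) (auto simp: bump_def)
qed

lemma bump_continuous: "c > 0 \<Longrightarrow> continuous_on A (bump P m c a b)"
  by (meson DERIV_isCont bump_has_derivative continuous_at_imp_continuous_on)

section \<open>Integrals against test functions\<close>

lemma test_function_has_derivative:
  assumes "test_function \<phi>"
  shows "(\<phi> has_real_derivative deriv \<phi> x) (at x)"
  using assms unfolding test_function_def
  by (metis DERIV_deriv_iff_real_differentiable funpow_0)

lemma test_function_deriv:
  assumes "test_function \<phi>"
  shows "test_function (deriv \<phi>)"
  unfolding test_function_def
proof (intro conjI allI)
  show "(deriv ^^ k) (deriv \<phi>) differentiable at x" for k x
  proof -
    have "(deriv ^^ (Suc k)) \<phi> differentiable at x" using assms unfolding test_function_def by blast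
    then show ?thesis by (simp only: funpow_Suc_right comp_apply)
  qed
  obtain R where R: "\<And>x. \<bar>x\<bar> > R \<Longrightarrow> \<phi> x = 0" using assms unfolding test_function_def by auto
  have "deriv \<phi> x = 0" if "\<bar>x\<bar> > R" for x
  proof (rule DERIV_imp_deriv)
    have "open {x. \<bar>x\<bar> > R}" by (intro open_Collect_less continuous_intros)
    then show "(\<phi> has_real_derivative 0) (at x)"
      by (rule has_field_derivative_transform_within_open[OF DERIV_const[of 0]]) (use that R in auto)
  qed
  then show "\<exists>R. \<forall>x. R < \<bar>x\<bar> \<longrightarrow> deriv \<phi> x = 0" by auto
qed

lemma test_function_continuous: "test_function \<phi> \<Longrightarrow> continuous_on A \<phi>"
  by (meson DERIV_isCont test_function_has_derivative continuous_at_imp_continuous_on)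

lemma test_function_measurable [measurable_dest]: "test_function \<phi> \<Longrightarrow> \<phi> \<in> borel_measurable borel"
  by (intro borel_measurable_continuous_onI test_function_continuous)

lemma test_function_bounded:
  assumes "test_function \<phi>"
  obtains B R where "\<And>x. \<bar>\<phi> x\<bar> \<le> B * indicator {-R..R} x" "R \<ge> 0" "B \<ge> 0"
proof -
  obtain R where R: "\<And>x. \<bar>x\<bar> > R \<Longrightarrow> \<phi> x = 0" using assms unfolding test_function_def by auto
  have "bounded (\<phi> ` {-\<bar>R\<bar>..\<bar>R\<bar>})"
    by (intro compact_imp_bounded compact_continuous_image test_function_continuous[OF assms]) auto
  then obtain B where B: "\<And>x. x \<in> {-\<bar>R\<bar>..\<bar>R\<bar>} \<Longrightarrow> \<bar>\<phi> x\<bar> \<le> B" unfolding bounded_iff by fastforce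
  have "\<bar>\<phi> x\<bar> \<le> \<bar>B\<bar> * indicator {-\<bar>R\<bar>..\<bar>R\<bar>} x" for x
    using R[of x] B[of x] by (cases "x \<in> {-\<bar>R\<bar>..\<bar>R\<bar>}") (auto intro: order_trans)
  then show ?thesis using that[of "\<bar>B\<bar>" "\<bar>R\<bar>"] by auto
qed

lemma integrable_mult_compact_support:
  fixes f \<phi> :: "real \<Rightarrow> real"
  assumes f: "locally_integrable f" and [measurable]: "\<phi> \<in> borel_measurable borel"
    and b: "\<And>x. \<bar>\<phi> x\<bar> \<le> B * indicator {L..R} x"
  shows "integrable lborel (\<lambda>x. f x * \<phi> x)"
proof -
  have i: "integrable lborel (\<lambda>x. indicator {L..R} x * f x)"
    using f unfolding locally_integrable_def set_integrable_def by auto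
  then have [measurable]: "(\<lambda>x. indicator {L..R} x * f x) \<in> borel_measurable borel" by auto
  have "integrable lborel (\<lambda>x. (indicator {L..R} x * f x) * \<phi> x)"
  proof (rule Bochner_Integration.integrable_bound[OF integrable_mult_left[OF integrable_abs[OF i], of B]])
    show "AE x in lborel. norm (indicator {L..R} x * f x * \<phi> x) \<le> norm (\<bar>indicator {L..R} x * f x\<bar> * B)"
    proof (intro AE_I2)
      fix x
      have "\<bar>\<phi> x\<bar> \<le> \<bar>B\<bar>" using b[of x] by (cases "x \<in> {L..R}") auto
      then show "norm (indicator {L..R} x * f x * \<phi> x) \<le> norm (\<bar>indicator {L..R} x * f x\<bar> * B)"
        by (simp add: abs_mult mult_left_mono)
    qed
  qed measurable
  also have "(\<lambda>x. (indicator {L..R} x * f x) * \<phi> x) = (\<lambda>x. f x * \<phi> x)"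
  proof
    fix x show "(indicator {L..R} x * f x) * \<phi> x = f x * \<phi> x"
      using b[of x] by (cases "x \<in> {L..R}") auto
  qed
  finally show ?thesis .
qed

lemma integrable_mult_test_function:
  assumes "locally_integrable f" "test_function \<phi>"
  shows "integrable lborel (\<lambda>x. f x * \<phi> x)"
proof -
  obtain B R where "\<And>x. \<bar>\<phi> x\<bar> \<le> B * indicator {-R..R} x" using test_function_bounded[OF assms(2)] by metis
  then show ?thesis
    using integrable_mult_compact_support[OF assms(1) test_function_measurable[OF assms(2)]] by blast
qed

text \<open>The vanishing total integral makes the primitive return to 0 to the right of the
  support.\<close>

lemma compactly_supported_primitive:
  fixes g :: "real \<Rightarrow> real"
  assumes cont: "continuous_on UNIV g" and supp: "\<And>x. x \<le> A \<or> x \<ge> B \<Longrightarrow> g x = 0" and AB: "A \<le> B"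
    and int0: "(LINT x|lborel. g x) = 0"
  obtains \<phi> where "\<And>x. (\<phi> has_real_derivative g x) (at x)" "\<And>x. x \<le> A \<or> x \<ge> B \<Longrightarrow> \<phi> x = 0"
proof -
  \<comment> \<open>Starting at \<open>A - 1\<close>, where \<open>g\<close> already vanishes, keeps
    every \<open>x \<ge> A\<close> in the interior of the interval on which the integral is
    differentiated.\<close>
  define \<phi> where "\<phi> x = integral {A - 1..x} g" for x
  have cont': "continuous_on S g" for S using cont continuous_on_subset by blast
  have low: "\<phi> x = 0" if "x \<le> A" for x
  proof -
    have "integral {A - 1..x} g = integral {A - 1..x} (\<lambda>_. 0)"
      using that supp by (intro integral_cong) auto
    then show ?thesis unfolding \<phi>_def by simp
  qed
  have up: "\<phi> x = 0" if "x \<ge> B" for x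
  proof -
    have "\<phi> x = (LBINT y:{A - 1..x}. g y)"
      unfolding \<phi>_def
      by (rule set_borel_integral_eq_integral(2)[symmetric])
         (use borel_integrable_compact[OF compact_Icc cont'] in \<open>simp add: set_integrable_def\<close>)
    also have "\<dots> = (LINT y|lborel. g y)"
      unfolding set_lebesgue_integral_def
    proof (intro Bochner_Integration.integral_cong refl)
      fix y show "indicator {A - 1..x} y *\<^sub>R g y = g y"
        using supp[of y] that by (cases "y \<in> {A - 1..x}") auto
    qed
    finally show ?thesis using int0 by simp
  qed
  have "(\<phi> has_real_derivative g x) (at x)" for x
  proof (cases "x < A")
    case True
    then have "(\<phi> has_real_derivative 0) (at x)"
      by (intro has_field_derivative_transform_within_open[OF DERIV_const[of 0], of "{..<A}"]) (auto simp: low)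
    then show ?thesis using supp True by auto
  next
    case False
    have "(\<phi> has_real_derivative g x) (at x within {A - 1..x + 1})"
      unfolding \<phi>_def using False by (intro integral_has_real_derivative cont') auto
    moreover have "x \<in> interior {A - 1..x + 1}" using False by simp
    ultimately show ?thesis using at_within_interior by metis
  qed
  then show ?thesis using low up that by blast
qed

section \<open>The fundamental lemma of the calculus of variations\<close>

lemma bump_bounded_indicator:
  assumes "c > 0"
  shows "\<bar>bump 1 0 c a b x\<bar> \<le> 1 * indicator {a..b} x" "bump 1 0 c a b x \<ge> 0"
  using assms by (auto simp: bump_def)

lemma bump_tendsto_indicator:
  "(\<lambda>j. bump 1 0 (1 / real (Suc j)) a b x) \<longlonglongrightarrow> indicator {a<..<b} x"
proof (cases "a < x \<and> x < b")
  case True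
  have "(\<lambda>j. exp (- (1 / real (Suc j)) / ((x - a) * (b - x)))) \<longlonglongrightarrow> exp (- 0 / ((x - a) * (b - x)))"
    using True by (intro tendsto_intros LIMSEQ_Suc[OF lim_1_over_n]) auto
  then show ?thesis using True by (simp add: bump_def)
next
  case False
  then have "bump 1 0 c a b x = 0" "indicator {a<..<b} x = (0::real)" for c by (auto simp: bump_def)
  then show ?thesis by simp
qed

text \<open>A Lebesgue differentiation argument in \<open>L^1\<close>: the averages of
  \<open>F (x + \<tau>)\<close> over \<open>\<tau>\<close> in \<open>{0..t}\<close> converge to
  \<open>F\<close> as \<open>t\<close> tends to 0, and all of them are 0.\<close>

lemma AE_eq_0_if_interval_integrals_0:
  fixes f :: "real \<Rightarrow> real"
  assumes f: "locally_integrable f" and int0: "\<And>a b. a \<le> b \<Longrightarrow> (LBINT x:{a..b}. f x) = 0"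
  shows "AE x in lborel. f x = 0"
proof -
  have *: "AE x in lborel. indicator {-real N..real N} x * f x = 0" for N :: nat
  proof -
    \<comment> \<open>The cut-off makes \<open>f\<close> integrable, and interval integrals of
      \<open>F\<close> are still interval integrals of \<open>f\<close>, hence 0.\<close>
    define F where "F x = indicator {-real N..real N} x * f x" for x
    have iF: "integrable lborel F"
      using f unfolding locally_integrable_def set_integrable_def F_def by auto
    then have [measurable]: "F \<in> borel_measurable borel" by auto
    have ftc: "set_integrable lborel {a..b} (\<lambda>\<tau>. F (x + \<tau>)) \<and> 0 - 0 = (LBINT \<tau>:{a..b}. F (x + \<tau>))"
      if ab: "a \<le> b" for a b x
    proof
      have it: "integrable lborel (\<lambda>\<tau>. F (x + \<tau>))"
        using lborel_integrable_real_affine[OF iF, of 1 x] by simp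
      then show "set_integrable lborel {a..b} (\<lambda>\<tau>. F (x + \<tau>))"
        unfolding set_integrable_def by (intro integrable_mult_indicator) auto
      have "(LBINT \<tau>:{a..b}. F (x + \<tau>)) = (LINT \<tau>|lborel. indicator {x + a..x + b} (x + 1 * \<tau>) * F (x + 1 * \<tau>))"
        unfolding set_lebesgue_integral_def by (intro Bochner_Integration.integral_cong) (auto simp: indicator_def)
      also have "\<dots> = (LINT y|lborel. indicator {x + a..x + b} y * F y)"
        using lborel_integral_real_affine[of 1 "\<lambda>y. indicator {x + a..x + b} y * F y" x] by simp
      also have "\<dots> = (LBINT y:{max (x + a) (-real N)..min (x + b) (real N)}. f y)"
        unfolding set_lebesgue_integral_def F_def
        by (intro Bochner_Integration.integral_cong) (auto simp: indicator_def)
      also have "\<dots> = 0"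
      proof (cases "max (x + a) (-real N) \<le> min (x + b) (real N)")
        case False
        then have "{max (x + a) (-real N)..min (x + b) (real N)} = {}" by auto
        then show ?thesis by (simp add: set_lebesgue_integral_def)
      qed (rule int0)
      finally show "0 - 0 = (LBINT \<tau>:{a..b}. F (x + \<tau>))" by simp
    qed
    have fin: "Lpow 1 F < \<infinity>" using iF Lpow_1_less_top_iff[of F] by auto
    have "((\<lambda>t. Lpow 1 (\<lambda>x. F (x + t) - F x)) \<longlongrightarrow> 0) (at 0 within {0..})"
      by (rule tendsto_within_subset[OF translation_continuous[OF _ fin]]) auto
    \<comment> \<open>The difference quotient lemma is applied to \<open>f = 0\<close> with
      \<open>f' \<tau> x = F (x + \<tau>)\<close>; its conclusion then no longer depends on
      \<open>t\<close>.\<close>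
    then have "((\<lambda>t. Lpow 1 (\<lambda>x. (0 - 0) / (t - 0) - F (x + 0))) \<longlongrightarrow> 0) (at 0 within {0..})"
      using ftc by (intro Lpow_difference_quotient_tendsto_0[where f="\<lambda>_ _. 0" and f'="\<lambda>\<tau> x. F (x + \<tau>)"]) auto
    then have "((\<lambda>t::real. Lpow 1 F) \<longlongrightarrow> 0) (at_right 0)"
      by (simp add: Lpow_uminus at_within_Ici_at_right)
    then have "Lpow 1 F = 0" using tendsto_unique[OF trivial_limit_at_right_real tendsto_const] by blast
    then have "AE x in lborel. ennreal \<bar>F x\<bar> = 0"
      unfolding Lpow_1 by (subst (asm) nn_integral_0_iff_AE) auto
    then show ?thesis unfolding F_def[symmetric] by eventually_elim simp
  qed
  have "AE x in lborel. \<forall>N::nat. indicator {-real N..real N} x * f x = 0"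
    using * by (subst AE_all_countable) auto
  then show ?thesis
  proof eventually_elim
    case (elim x)
    obtain N :: nat where "\<bar>x\<bar> \<le> real N" using real_arch_simple by blast
    then show ?case using elim[rule_format, of N] by (auto simp: indicator_def abs_le_iff split: if_splits)
  qed
qed

text \<open>As the parameter of the bumps tends to 0, they converge boundedly to the indicator of
  \<open>{a<..<b}\<close>, so dominated convergence yields the interval integrals.\<close>

lemma AE_eq_0_if_bump_integrals_0:
  fixes f :: "real \<Rightarrow> real"
  assumes f: "locally_integrable f" and int0: "\<And>a b c. c > 0 \<Longrightarrow> (LINT x|lborel. f x * bump 1 0 c a b x) = 0"
  shows "AE x in lborel. f x = 0"
proof (rule AE_eq_0_if_interval_integrals_0[OF f])
  fix a b :: real assume "a \<le> b"
  have i: "integrable lborel (\<lambda>x. indicator {a..b} x * f x)"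
    using f unfolding locally_integrable_def set_integrable_def by auto
  then have m: "(\<lambda>x. indicator {a..b} x * f x) \<in> borel_measurable borel" by auto
  have "(\<lambda>j. LINT x|lborel. f x * bump 1 0 (1 / real (Suc j)) a b x) \<longlonglongrightarrow> (LINT x|lborel. f x * indicator {a<..<b} x)"
  proof (rule integral_dominated_convergence[where w="\<lambda>x. \<bar>indicator {a..b} x * f x\<bar>"])
    have "(\<lambda>x. indicator {a<..<b} x * (indicator {a..b} x * f x)) \<in> borel_measurable lborel"
      using m by measurable
    also have "(\<lambda>x. indicator {a<..<b} x * (indicator {a..b} x * f x)) = (\<lambda>x. f x * indicator {a<..<b} x)"
      by (auto simp: indicator_def)
    finally show "(\<lambda>x. f x * indicator {a<..<b} x) \<in> borel_measurable lborel" .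
    show "integrable lborel (\<lambda>x. \<bar>indicator {a..b} x * f x\<bar>)" using i by (rule integrable_abs)
    show "AE x in lborel. (\<lambda>j. f x * bump 1 0 (1 / real (Suc j)) a b x) \<longlonglongrightarrow> f x * indicator {a<..<b} x"
      by (intro AE_I2 tendsto_mult tendsto_const bump_tendsto_indicator)
    fix j
    have "integrable lborel (\<lambda>x. f x * bump 1 0 (1 / real (Suc j)) a b x)"
      by (intro integrable_mult_test_function f test_function_bump) simp
    then show "(\<lambda>x. f x * bump 1 0 (1 / real (Suc j)) a b x) \<in> borel_measurable lborel" by auto
    show "AE x in lborel. norm (f x * bump 1 0 (1 / real (Suc j)) a b x) \<le> \<bar>indicator {a..b} x * f x\<bar>"
    proof (intro AE_I2)
      fix x
      have "\<bar>f x\<bar> * \<bar>bump 1 0 (1 / real (Suc j)) a b x\<bar> \<le> \<bar>f x\<bar> * (1 * indicator {a..b} x)"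
        by (intro mult_left_mono bump_bounded_indicator) auto
      then show "norm (f x * bump 1 0 (1 / real (Suc j)) a b x) \<le> \<bar>indicator {a..b} x * f x\<bar>"
        by (simp add: abs_mult mult.commute)
    qed
  qed
  then have "(\<lambda>j. 0) \<longlonglongrightarrow> (LINT x|lborel. f x * indicator {a<..<b} x)"
    using int0 by simp
  then have z: "(LINT x|lborel. f x * indicator {a<..<b} x) = 0" using LIMSEQ_unique tendsto_const by metis
  have "(LBINT x:{a..b}. f x) = (LINT x|lborel. f x * indicator {a<..<b} x)"
    unfolding set_lebesgue_integral_def
  proof (rule integral_cong_AE)
    show "AE x in lborel. indicator {a..b} x *\<^sub>R f x = f x * indicator {a<..<b} x"
      using AE_lborel_singleton[of a] AE_lborel_singleton[of b]
      by eventually_elim (auto simp: indicator_def)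
    have "(\<lambda>x. indicator {a<..<b} x * (indicator {a..b} x * f x)) \<in> borel_measurable lborel"
      using m by measurable
    also have "(\<lambda>x. indicator {a<..<b} x * (indicator {a..b} x * f x)) = (\<lambda>x. f x * indicator {a<..<b} x)"
      by (auto simp: indicator_def)
    finally show "(\<lambda>x. f x * indicator {a<..<b} x) \<in> borel_measurable lborel" .
  qed (use m in simp)
  then show "(LBINT x:{a..b}. f x) = 0" using z by simp
qed

lemma locally_integrable_diff:
  "locally_integrable f \<Longrightarrow> locally_integrable g \<Longrightarrow> locally_integrable (\<lambda>x. f x - g x)"
  unfolding locally_integrable_def by auto

lemma locally_integrable_const: "locally_integrable (\<lambda>x. c)"
  unfolding locally_integrable_def set_integrable_def
  by (auto intro!: integrable_real_indicator simp: emeasure_lborel_Icc_eq)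

lemma integrable_imp_locally_integrable: "integrable lborel f \<Longrightarrow> locally_integrable f"
  unfolding locally_integrable_def set_integrable_def by (intro allI integrable_mult_indicator) auto

lemma has_weak_deriv_unique:
  assumes "has_weak_deriv g h1" "has_weak_deriv g h2"
  shows "AE x in lborel. h1 x = h2 x"
proof -
  have l: "locally_integrable h1" "locally_integrable h2" using assms by (auto simp: has_weak_deriv_def)
  have "AE x in lborel. h1 x - h2 x = 0"
  proof (rule AE_eq_0_if_bump_integrals_0[OF locally_integrable_diff[OF l]])
    fix a b c :: real assume "c > 0"
    then have t: "test_function (bump 1 0 c a b)" by (rule test_function_bump)
    have "(LINT x|lborel. (h1 x - h2 x) * bump 1 0 c a b x)
      = (LINT x|lborel. h1 x * bump 1 0 c a b x) - (LINT x|lborel. h2 x * bump 1 0 c a b x)"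
      using integrable_mult_test_function[OF l(1) t] integrable_mult_test_function[OF l(2) t]
      by (simp add: left_diff_distrib)
    also have "\<dots> = 0" using assms t by (simp add: has_weak_deriv_def)
    finally show "(LINT x|lborel. (h1 x - h2 x) * bump 1 0 c a b x) = 0" .
  qed
  then show ?thesis by eventually_elim simp
qed

lemma weak_deriv_AE:
  assumes "has_weak_deriv g h"
  shows "AE x in lborel. weak_deriv g x = h x"
proof -
  have "has_weak_deriv g (weak_deriv g)" unfolding weak_deriv_def by (rule someI[of _ h]) (rule assms)
  then show ?thesis using has_weak_deriv_unique assms by blast
qed

text \<open>Testing against the primitive of \<open>\<eta> - (\<integral>\<eta>) \<rho>\<close>, for bumps \<open>\<eta>\<close> and a fixed bump \<open>\<rho>\<close> of integral
  one, identifies the constant as \<open>\<integral> f \<rho>\<close>.\<close>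

lemma AE_const_if_weak_deriv_0:
  fixes f :: "real \<Rightarrow> real"
  assumes f: "locally_integrable f"
    and orth: "\<And>\<phi>. test_function \<phi> \<Longrightarrow> (LINT x|lborel. f x * deriv \<phi> x) = 0"
  obtains C where "AE x in lborel. f x = C"
proof -
  define \<rho> where "\<rho> = bump 1 0 1 0 1"
  have tr: "test_function \<rho>" unfolding \<rho>_def by (rule test_function_bump) simp
  have ir: "integrable lborel \<rho>"
    using integrable_mult_test_function[OF locally_integrable_const[of 1] tr] by simp
  define I where "I = (LINT x|lborel. \<rho> x)"
  have "I > 0"
  proof -
    have "I \<noteq> 0"
    proof
      assume "I = 0"
      then have "AE x in lborel. \<rho> x = 0"
        unfolding I_def using ir bump_bounded_indicator(2)[of 1 0 1]
        by (subst (asm) integral_nonneg_eq_0_iff_AE) (auto simp: \<rho>_def)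
      then have "AE x in lborel. x \<notin> {0<..<1::real}"
        by eventually_elim (auto simp: \<rho>_def bump_def)
      then have "{0<..<1::real} \<in> null_sets lborel"
        by (subst (asm) AE_iff_null_sets[symmetric]) auto
      then show False by (simp add: null_sets_def)
    qed
    moreover have "I \<ge> 0" unfolding I_def \<rho>_def by (intro Bochner_Integration.integral_nonneg bump_bounded_indicator) auto
    ultimately show ?thesis by simp
  qed
  define C where "C = (LINT x|lborel. f x * \<rho> x) / I"
  have "AE x in lborel. f x - C = 0"
  proof (rule AE_eq_0_if_bump_integrals_0[OF locally_integrable_diff[OF f locally_integrable_const]])
    fix a b c :: real assume c: "c > 0"
    define \<eta> where "\<eta> = bump 1 0 c a b"
    have tc: "test_function \<eta>" unfolding \<eta>_def using c by (rule test_function_bump)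
    have ic: "integrable lborel \<eta>"
      using integrable_mult_test_function[OF locally_integrable_const[of 1] tc] by simp
    define K where "K = (LINT x|lborel. \<eta> x) / I"
    define g where "g x = \<eta> x - K * \<rho> x" for x
    have "(LINT x|lborel. g x) = 0" unfolding g_def using ic ir \<open>I > 0\<close> by (simp add: K_def I_def)
    moreover have "continuous_on UNIV g"
      unfolding g_def \<eta>_def \<rho>_def using c by (intro continuous_intros bump_continuous) auto
    moreover have "g x = 0" if "x \<le> min a 0 \<or> x \<ge> max b 1" for x
      using that by (auto simp: g_def \<eta>_def \<rho>_def bump_def)
    ultimately obtain \<phi> where phi: "\<And>x. (\<phi> has_real_derivative g x) (at x)"
      "\<And>x. x \<le> min a 0 \<or> x \<ge> max b 1 \<Longrightarrow> \<phi> x = 0"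
      by (rule_tac compactly_supported_primitive[of g "min a 0" "max b 1"]) auto
    have dphi: "deriv \<phi> = g" using phi by (intro ext DERIV_imp_deriv)
    have "test_function \<phi>"
      unfolding test_function_def
    proof (intro conjI allI)
      fix k x
      show "(deriv ^^ k) \<phi> differentiable at x"
      proof (cases k)
        case 0
        then show ?thesis using phi(1) real_differentiable_def by auto
      next
        case (Suc j)
        then have "(deriv ^^ k) \<phi> = (deriv ^^ j) g" by (simp only: funpow_Suc_right comp_apply dphi)
        also have "g = (\<lambda>x. bump 1 0 c a b x - K * bump 1 0 1 0 1 x)"
          by (auto simp: g_def \<eta>_def \<rho>_def)
        finally show ?thesis using bump_linear_combination_smooth[OF c zero_less_one] by simp
      qed
    next
      show "\<exists>R. \<forall>x. R < \<bar>x\<bar> \<longrightarrow> \<phi> x = 0"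
        by (rule exI[of _ "\<bar>a\<bar> + \<bar>b\<bar> + 1"]) (auto intro!: phi(2))
    qed
    from orth[OF this] have "(LINT x|lborel. f x * (\<eta> x - K * \<rho> x)) = 0" unfolding dphi g_def .
    moreover have "(LINT x|lborel. f x * (\<eta> x - K * \<rho> x)) = (LINT x|lborel. f x * \<eta> x) - K * (LINT x|lborel. f x * \<rho> x)"
    proof -
      have "(LINT x|lborel. f x * (\<eta> x - K * \<rho> x)) = (LINT x|lborel. f x * \<eta> x - K * (f x * \<rho> x))"
        by (simp add: algebra_simps)
      then show ?thesis
        using integrable_mult_test_function[OF f tc] integrable_mult_test_function[OF f tr] by simp
    qed
    moreover have "K * (LINT x|lborel. f x * \<rho> x) = C * (LINT x|lborel. \<eta> x)"
      using \<open>I > 0\<close> by (simp add: K_def C_def)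
    moreover have "(LINT x|lborel. (f x - C) * \<eta> x) = (LINT x|lborel. f x * \<eta> x) - C * (LINT x|lborel. \<eta> x)"
      using integrable_mult_test_function[OF f tc] ic by (simp add: left_diff_distrib)
    ultimately show "(LINT x|lborel. (f x - C) * bump 1 0 c a b x) = 0" unfolding \<eta>_def by simp
  qed
  then have "AE x in lborel. f x = C" by eventually_elim simp
  then show ?thesis using that by blast
qed

section \<open>Primitives of integrable functions and their weak derivatives\<close>

lemma integrable_mult_pair:
  fixes f g :: "real \<Rightarrow> real"
  assumes f: "integrable lborel f" and g: "integrable lborel g"
  shows "integrable (lborel \<Otimes>\<^sub>M lborel) (\<lambda>z. f (fst z) * g (snd z))"
proof -
  have [measurable]: "f \<in> borel_measurable borel" "g \<in> borel_measurable borel" using f g by auto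
  show ?thesis
  proof (rule lborel_pair.Fubini_integrable)
    have "integrable lborel (\<lambda>x. \<bar>f x\<bar> * (LINT y|lborel. \<bar>g y\<bar>))" using f by simp
    then show "integrable lborel (\<lambda>x. LINT y|lborel. norm (f (fst (x, y)) * g (snd (x, y))))"
      by (simp add: abs_mult)
    show "AE x in lborel. integrable lborel (\<lambda>y. f (fst (x, y)) * g (snd (x, y)))" using g by simp
  qed measurable
qed

lemma primitive_diff:
  fixes h :: "real \<Rightarrow> real"
  assumes h: "integrable lborel h" and "x \<le> y"
  shows "(LBINT z:{..y}. h z) - (LBINT z:{..x}. h z) = (LBINT z:{x..y}. h z)"
proof -
  have [measurable]: "h \<in> borel_measurable borel" using h by auto
  have i: "integrable lborel (\<lambda>z. indicator A z * h z)" if "A \<in> sets borel" for A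
    using integrable_mult_indicator[of A lborel h] h that by simp
  have "(LBINT z:{..y}. h z) - (LBINT z:{..x}. h z) = (LINT z|lborel. indicator {..y} z * h z - indicator {..x} z * h z)"
    unfolding set_lebesgue_integral_def by (simp add: i)
  also have "\<dots> = (LINT z|lborel. indicator {x..y} z * h z)"
  proof (rule integral_cong_AE)
    show "AE z in lborel. indicator {..y} z * h z - indicator {..x} z * h z = indicator {x..y} z * h z"
      using AE_lborel_singleton[of x] by eventually_elim (use assms in \<open>auto simp: indicator_def\<close>)
  qed measurable
  finally show ?thesis unfolding set_lebesgue_integral_def by simp
qed

lemma primitive_bound:
  fixes h :: "real \<Rightarrow> real"
  assumes h: "integrable lborel h"
  shows "\<bar>LBINT z:{..x}. h z\<bar> \<le> (LINT z|lborel. \<bar>h z\<bar>)"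
proof -
  have [measurable]: "h \<in> borel_measurable borel" using h by auto
  have "\<bar>LBINT z:{..x}. h z\<bar> \<le> (LINT z|lborel. \<bar>indicator {..x} z *\<^sub>R h z\<bar>)"
    unfolding set_lebesgue_integral_def by (rule integral_abs_bound)
  also have "\<dots> \<le> (LINT z|lborel. \<bar>h z\<bar>)"
    using h by (intro integral_mono integrable_abs integrable_mult_indicator) (auto simp: indicator_def)
  finally show ?thesis .
qed

lemma primitive_continuous:
  fixes h :: "real \<Rightarrow> real"
  assumes h: "integrable lborel h"
  shows "continuous_on UNIV (\<lambda>x. LBINT z:{..x}. h z)"
proof -
  have [measurable]: "h \<in> borel_measurable borel" using h by auto
  show ?thesis
    unfolding continuous_on_sequentially comp_def
  proof (intro allI ballI impI)
    fix X :: "nat \<Rightarrow> real" and x assume X: "(\<forall>n. X n \<in> UNIV) \<and> X \<longlonglongrightarrow> x"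
    show "(\<lambda>n. LBINT z:{..X n}. h z) \<longlonglongrightarrow> (LBINT z:{..x}. h z)"
      unfolding set_lebesgue_integral_def
    proof (rule integral_dominated_convergence[where w="\<lambda>z. \<bar>h z\<bar>"])
      show "AE z in lborel. (\<lambda>n. indicator {..X n} z *\<^sub>R h z) \<longlonglongrightarrow> indicator {..x} z *\<^sub>R h z"
        using AE_lborel_singleton[of x]
      proof eventually_elim
        case (elim z)
        have "eventually (\<lambda>n. indicator {..X n} z = (indicator {..x} z :: real)) sequentially"
        proof (cases "z < x")
          case True
          then have "eventually (\<lambda>n. z < X n) sequentially" using X order_tendstoD(1) by blast
          then show ?thesis by eventually_elim (use True in auto)
        next
          case False
          then have "x < z" using elim by simp
          then have "eventually (\<lambda>n. X n < z) sequentially" using X order_tendstoD(2) by blast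
          then show ?thesis by eventually_elim (use False elim in auto)
        qed
        then have "eventually (\<lambda>n. indicator {..X n} z *\<^sub>R h z = indicator {..x} z *\<^sub>R h z) sequentially"
          by eventually_elim simp
        then show ?case by (rule tendsto_eventually)
      qed
      show "AE z in lborel. norm (indicator {..X n} z *\<^sub>R h z) \<le> \<bar>h z\<bar>" for n
        by (auto simp: indicator_def)
    qed (use h in auto)
  qed
qed

lemma test_function_integral_deriv_atLeast:
  assumes "test_function \<phi>"
  shows "(LINT x|lborel. indicator {y..} x * deriv \<phi> x) = - \<phi> y"
proof -
  obtain R where R: "\<And>x. \<bar>x\<bar> > R \<Longrightarrow> \<phi> x = 0" using assms unfolding test_function_def by auto
  obtain R' where R': "\<And>x. \<bar>x\<bar> > R' \<Longrightarrow> deriv \<phi> x = 0"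
    using test_function_deriv[OF assms] unfolding test_function_def by auto
  define b where "b = max y (max \<bar>R\<bar> \<bar>R'\<bar>) + 1"
  have b: "y \<le> b" "b > R" "b \<ge> 0" "b > R'" unfolding b_def by auto
  have "(LINT x|lborel. indicator {y..} x * deriv \<phi> x) = (LINT x|lborel. deriv \<phi> x * indicator {y..b} x)"
  proof (intro Bochner_Integration.integral_cong refl)
    fix x show "indicator {y..} x * deriv \<phi> x = deriv \<phi> x * indicator {y..b} x"
      using R'[of x] b by (cases "x \<le> b") (auto simp: indicator_def)
  qed
  also have "\<dots> = \<phi> b - \<phi> y"
    using b test_function_has_derivative[OF assms] test_function_continuous[OF test_function_deriv[OF assms]]
    by (intro integral_FTC_Icc_real) (auto intro!: continuous_on_interior[of UNIV])
  also have "\<phi> b = 0" using R[of b] b by simp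
  finally show ?thesis by simp
qed

lemma test_function_integral_deriv:
  assumes "test_function \<phi>"
  shows "(LINT x|lborel. deriv \<phi> x) = 0"
proof -
  obtain R where R: "\<And>x. \<bar>x\<bar> > R \<Longrightarrow> \<phi> x = 0" using assms unfolding test_function_def by auto
  obtain R' where R': "\<And>x. \<bar>x\<bar> > R' \<Longrightarrow> deriv \<phi> x = 0"
    using test_function_deriv[OF assms] unfolding test_function_def by auto
  define b where "b = - max \<bar>R\<bar> \<bar>R'\<bar> - 1"
  have "(LINT x|lborel. deriv \<phi> x) = (LINT x|lborel. indicator {b..} x * deriv \<phi> x)"
  proof (intro Bochner_Integration.integral_cong refl)
    fix x show "deriv \<phi> x = indicator {b..} x * deriv \<phi> x"
      using R'[of x] by (cases "x < b") (auto simp: indicator_def b_def)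
  qed
  then show ?thesis
    using test_function_integral_deriv_atLeast[OF assms, of b] R[of b] by (simp add: b_def)
qed

text \<open>Integration by parts as an exchange of integrals: \<open>g\<close> is a constant plus a
  primitive of \<open>h\<close>, Fubini turns the double integral of
  \<open>h y * deriv \<phi> x\<close> over \<open>y \<le> x\<close> into the integral of
  \<open>- h y * \<phi> y\<close>, and the constant drops out because \<open>deriv \<phi>\<close>
  has integral 0.\<close>

lemma has_weak_deriv_AC:
  fixes g h :: "real \<Rightarrow> real"
  assumes h: "integrable lborel h" and g: "locally_integrable g"
    and diff: "\<And>x y. x \<le> y \<Longrightarrow> g y - g x = (LBINT z:{x..y}. h z)"
  shows "has_weak_deriv g h"
  unfolding has_weak_deriv_def
proof (intro conjI allI impI)
  show "locally_integrable g" "locally_integrable h" using g h by (auto intro: integrable_imp_locally_integrable)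
  have [measurable]: "h \<in> borel_measurable borel" using h by auto
  fix \<phi> assume phi: "test_function \<phi>"
  define \<psi> where "\<psi> = deriv \<phi>"
  have tpsi: "test_function \<psi>" unfolding \<psi>_def by (rule test_function_deriv[OF phi])
  have ipsi: "integrable lborel \<psi>"
    using integrable_mult_test_function[OF locally_integrable_const[of 1] tpsi] by simp
  have [measurable]: "\<psi> \<in> borel_measurable borel" using ipsi by auto
  define \<Phi> where "\<Phi> x = (LBINT z:{..x}. h z)" for x
  define C where "C = g 0 - \<Phi> 0"
  have gx: "g x = C + \<Phi> x" for x
    using diff[of 0 x] diff[of x 0] primitive_diff[OF h, of 0 x] primitive_diff[OF h, of x 0]
    unfolding C_def \<Phi>_def by (cases "0 \<le> x") auto
  have int: "integrable (lborel \<Otimes>\<^sub>M lborel) (\<lambda>(x, y). indicator {..x} y * (h y * \<psi> x))"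
  proof (rule Bochner_Integration.integrable_bound[OF integrable_mult_pair[OF ipsi h]])
    show "(\<lambda>(x, y). indicator {..x} y * (h y * \<psi> x)) \<in> borel_measurable (lborel \<Otimes>\<^sub>M lborel)"
      unfolding indicator_def atMost_iff by measurable
  qed (auto simp: indicator_def mult.commute)
  have "(LINT x|lborel. \<Phi> x * \<psi> x) = (LINT x|lborel. (LINT y|lborel. indicator {..x} y * (h y * \<psi> x)))"
    unfolding \<Phi>_def set_lebesgue_integral_def
    by (subst integral_mult_left_zero[symmetric]) (simp add: mult_ac)
  also have "\<dots> = (LINT y|lborel. (LINT x|lborel. indicator {..x} y * (h y * \<psi> x)))"
    by (rule lborel_pair.Fubini_integral[OF int, symmetric])
  also have "\<dots> = (LINT y|lborel. h y * (LINT x|lborel. indicator {y..} x * \<psi> x))"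
  proof (intro Bochner_Integration.integral_cong refl)
    fix y
    have "(LINT x|lborel. indicator {..x} y * (h y * \<psi> x)) = (LINT x|lborel. h y * (indicator {y..} x * \<psi> x))"
      by (intro Bochner_Integration.integral_cong) (auto simp: indicator_def)
    then show "(LINT x|lborel. indicator {..x} y * (h y * \<psi> x)) = h y * (LINT x|lborel. indicator {y..} x * \<psi> x)"
      by simp
  qed
  also have "\<dots> = - (LINT y|lborel. h y * \<phi> y)"
    unfolding \<psi>_def test_function_integral_deriv_atLeast[OF phi] by simp
  finally have *: "(LINT x|lborel. \<Phi> x * \<psi> x) = - (LINT y|lborel. h y * \<phi> y)" .
  have "integrable lborel (\<lambda>x. g x * \<psi> x)" using g tpsi by (rule integrable_mult_test_function)
  from Bochner_Integration.integrable_diff[OF this integrable_mult_right[OF ipsi, of C]] have i2: "integrable lborel (\<lambda>x. \<Phi> x * \<psi> x)"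
    by (simp add: gx distrib_right)
  have "(LINT x|lborel. g x * \<psi> x) = C * (LINT x|lborel. \<psi> x) + (LINT x|lborel. \<Phi> x * \<psi> x)"
    unfolding gx using i2 ipsi by (simp add: distrib_right)
  then show "(LINT x|lborel. g x * deriv \<phi> x) = - (LINT x|lborel. h x * \<phi> x)"
    using * test_function_integral_deriv[OF phi] unfolding \<psi>_def by simp
qed

text \<open>\<open>g\<close> and the primitive of \<open>h\<close> have the same weak derivative, so
  they differ by a constant \<open>C\<close>. The primitive tends to 0 at minus infinity; for
  \<open>C \<noteq> 0\<close> this would keep the absolute value of \<open>g\<close> above that of
  \<open>C / 2\<close> almost everywhere on a half-line, against integrability.\<close>

lemma W11_representative:
  fixes g h :: "real \<Rightarrow> real"
  assumes g: "integrable lborel g" and h: "integrable lborel h" and w: "has_weak_deriv g h"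
  shows "AE x in lborel. g x = (LBINT z:{..x}. h z)"
proof -
  have [measurable]: "h \<in> borel_measurable borel" using h by auto
  define \<Phi> where "\<Phi> x = (LBINT z:{..x}. h z)" for x
  have cont: "continuous_on A \<Phi>" for A
    unfolding \<Phi>_def using primitive_continuous[OF h] continuous_on_subset by blast
  have lPhi: "locally_integrable \<Phi>"
    unfolding locally_integrable_def set_integrable_def
    using borel_integrable_compact[OF compact_Icc cont] by simp
  have lg: "locally_integrable g" using g by (rule integrable_imp_locally_integrable)
  have wPhi: "has_weak_deriv \<Phi> h"
    using h lPhi by (rule has_weak_deriv_AC) (simp add: \<Phi>_def primitive_diff[OF h])
  obtain C where C: "AE x in lborel. g x - \<Phi> x = C"
  proof (rule AE_const_if_weak_deriv_0[OF locally_integrable_diff[OF lg lPhi]])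
    fix \<phi> assume t: "test_function \<phi>"
    have "(LINT x|lborel. (g x - \<Phi> x) * deriv \<phi> x) = (LINT x|lborel. g x * deriv \<phi> x) - (LINT x|lborel. \<Phi> x * deriv \<phi> x)"
      using integrable_mult_test_function[OF lg test_function_deriv[OF t]]
        integrable_mult_test_function[OF lPhi test_function_deriv[OF t]] by (simp add: left_diff_distrib)
    also have "\<dots> = 0" using w wPhi t by (simp add: has_weak_deriv_def)
    finally show "(LINT x|lborel. (g x - \<Phi> x) * deriv \<phi> x) = 0" .
  qed
  have "C = 0"
  proof (rule ccontr)
    assume "C \<noteq> 0"
    have "(\<lambda>n. LINT z|lborel. indicator {..- real n} z * \<bar>h z\<bar>) \<longlonglongrightarrow> (LINT z|(lborel::real measure). (0::real))"
    proof (rule integral_dominated_convergence[where w="\<lambda>z. \<bar>h z\<bar>"])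
      show "AE z in lborel. (\<lambda>n. indicator {..- real n} z * \<bar>h z\<bar>) \<longlonglongrightarrow> 0"
      proof (intro AE_I2 tendsto_eventually)
        fix z
        obtain N :: nat where "real N > - z" using reals_Archimedean2 by blast
        then show "\<forall>\<^sub>F n in sequentially. indicator {..- real n} z * \<bar>h z\<bar> = 0"
          by (intro eventually_sequentiallyI[of N]) (auto simp: indicator_def)
      qed
    qed (use h in \<open>auto simp: indicator_def\<close>)
    then have "eventually (\<lambda>n. (LINT z|lborel. indicator {..- real n} z * \<bar>h z\<bar>) < \<bar>C\<bar> / 2) sequentially"
      using \<open>C \<noteq> 0\<close> by (intro order_tendstoD(2)) auto
    then obtain n where n: "(LINT z|lborel. indicator {..- real n} z * \<bar>h z\<bar>) < \<bar>C\<bar> / 2"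
      using eventually_happens'[OF sequentially_bot] by blast
    have small: "\<bar>\<Phi> x\<bar> \<le> \<bar>C\<bar> / 2" if "x \<le> - real n" for x
    proof -
      have "\<bar>\<Phi> x\<bar> \<le> (LINT z|lborel. \<bar>indicator {..x} z *\<^sub>R h z\<bar>)"
        unfolding \<Phi>_def set_lebesgue_integral_def by (rule integral_abs_bound)
      also have "\<dots> \<le> (LINT z|lborel. indicator {..- real n} z * \<bar>h z\<bar>)"
      proof (rule integral_mono)
        show "integrable lborel (\<lambda>z. \<bar>indicator {..x} z *\<^sub>R h z\<bar>)"
          using h by (intro integrable_abs integrable_mult_indicator) auto
        show "integrable lborel (\<lambda>z. indicator {..- real n} z * \<bar>h z\<bar>)"
          using integrable_mult_indicator[of "{..- real n}" lborel "\<lambda>z. \<bar>h z\<bar>"] h by simp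
      qed (use that in \<open>auto simp: indicator_def\<close>)
      finally show ?thesis using n by simp
    qed
    have "(\<integral>\<^sup>+x. ennreal (\<bar>C\<bar> / 2) * indicator {..- real n} x \<partial>lborel) \<le> (\<integral>\<^sup>+x. ennreal \<bar>g x\<bar> \<partial>lborel)"
    proof (rule nn_integral_mono_AE)
      show "AE x in lborel. ennreal (\<bar>C\<bar> / 2) * indicator {..- real n} x \<le> ennreal \<bar>g x\<bar>"
        using C
      proof eventually_elim
        case (elim x)
        then show ?case using small[of x] by (cases "x \<le> - real n") (auto intro!: ennreal_leI)
      qed
    qed
    moreover have "emeasure lborel {..- real n} = \<infinity>"
    proof (rule ccontr)
      assume "emeasure lborel {..- real n} \<noteq> \<infinity>"
      then obtain r where r: "emeasure lborel {..- real n} = ennreal r" "r \<ge> 0"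
        by (cases "emeasure lborel {..- real n}") auto
      have "emeasure lborel {- real n - (r + 1)..- real n} \<le> emeasure lborel {..- real n}"
        by (rule emeasure_mono) auto
      then show False using r by simp
    qed
    ultimately have "(\<integral>\<^sup>+x. ennreal \<bar>g x\<bar> \<partial>lborel) = \<infinity>"
      using \<open>C \<noteq> 0\<close> by (simp add: nn_integral_cmult ennreal_mult_top top_unique)
    then show False using g by (simp add: integrable_iff_bounded)
  qed
  with C show ?thesis unfolding \<Phi>_def by simp
qed

section \<open>The Bessel kernels\<close>

text \<open>The Bessel function of order 0 at \<open>sqrt s / 2\<close>. With
  \<open>s = t\<^sup>2 - y\<^sup>2\<close> as variable the square root disappears and the kernel is
  a power series in \<open>s\<close>.\<close>

definition I0 :: "real \<Rightarrow> real" where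
  "I0 s = (\<Sum>k. (s / 16) ^ k / (fact k)\<^sup>2)"

text \<open>The derivative of \<open>I0\<close>. It equals the Bessel function of order 1 at
  \<open>sqrt s / 2\<close> divided by \<open>4 * sqrt s\<close>, so the removable singularity at
  the edge of the light cone is gone.\<close>

definition I1 :: "real \<Rightarrow> real" where
  "I1 s = (\<Sum>k. (s / 16) ^ k / (16 * fact k * fact (Suc k)))"

lemma summable_power_div_fact: "summable (\<lambda>k. (x::real) ^ k / fact k)"
  using summable_exp[of x] by (simp add: divide_inverse mult.commute)

lemma summable_I0: "summable (\<lambda>k. ((s::real) / 16) ^ k / (fact k)\<^sup>2)"
proof (rule summable_comparison_test'[OF summable_power_div_fact[of "\<bar>s / 16\<bar>"]])
  fix k :: nat
  have "(1::real) \<le> fact k" by simp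
  then have "(fact k::real) \<le> (fact k)\<^sup>2" by (simp add: power2_eq_square)
  then show "norm ((s / 16) ^ k / (fact k)\<^sup>2) \<le> \<bar>s / 16\<bar> ^ k / fact k"
    by (auto simp: abs_mult power_abs intro!: frac_le)
qed

lemma summable_I1: "summable (\<lambda>k. ((s::real) / 16) ^ k / (16 * fact k * fact (Suc k)))"
proof (rule summable_comparison_test'[OF summable_power_div_fact[of "\<bar>s / 16\<bar>"]])
  fix k :: nat
  have "1 * fact k * (1::real) \<le> 16 * fact k * fact (Suc k)" by (intro mult_mono) (auto simp del: fact_Suc)
  then show "norm ((s / 16) ^ k / (16 * fact k * fact (Suc k))) \<le> \<bar>s / 16\<bar> ^ k / fact k"
    by (auto simp: abs_mult power_abs simp del: fact_Suc intro!: frac_le)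
qed

lemma I0_measurable [measurable]: "I0 \<in> borel_measurable borel"
  unfolding I0_def by measurable

lemma I1_measurable [measurable]: "I1 \<in> borel_measurable borel"
  unfolding I1_def by measurable

lemma I0_nonneg: "s \<ge> 0 \<Longrightarrow> I0 s \<ge> 0"
  unfolding I0_def by (intro suminf_nonneg summable_I0) auto

lemma I1_nonneg: "s \<ge> 0 \<Longrightarrow> I1 s \<ge> 0"
  unfolding I1_def by (intro suminf_nonneg summable_I1) auto

lemma I0_mono: "0 \<le> s \<Longrightarrow> s \<le> s' \<Longrightarrow> I0 s \<le> I0 s'"
  unfolding I0_def by (intro suminf_le summable_I0 divide_right_mono power_mono) auto

lemma I1_mono: "0 \<le> s \<Longrightarrow> s \<le> s' \<Longrightarrow> I1 s \<le> I1 s'"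
  unfolding I1_def by (intro suminf_le summable_I1 divide_right_mono power_mono) auto

lemma bessel_I_0_eq:
  assumes "s \<ge> 0"
  shows "bessel_I 0 (sqrt s / 2) = I0 s"
  unfolding bessel_I_def I0_def
proof (intro suminf_cong)
  fix k
  have "(sqrt s / 2 / 2) ^ (2 * k + 0) = ((sqrt s / 4)\<^sup>2) ^ k" by (simp add: power_mult)
  also have "\<dots> = (s / 16) ^ k" using assms by (simp add: power_divide)
  finally show "1 / (fact k * fact (k + 0)) * (sqrt s / 2 / 2) ^ (2 * k + 0) = (s / 16) ^ k / (fact k)\<^sup>2"
    by (simp add: power2_eq_square)
qed

lemma bessel_I_1_eq:
  assumes "s \<ge> 0"
  shows "bessel_I 1 (sqrt s / 2) = 4 * sqrt s * I1 s"
proof -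
  have "bessel_I 1 (sqrt s / 2) = (\<Sum>k. 4 * sqrt s * ((s / 16) ^ k / (16 * fact k * fact (Suc k))))"
    unfolding bessel_I_def
  proof (intro suminf_cong)
    fix k
    have "(sqrt s / 2 / 2) ^ (2 * k + 1) = sqrt s / 4 * ((sqrt s / 4)\<^sup>2) ^ k" by (simp add: power_mult)
    also have "\<dots> = sqrt s / 4 * (s / 16) ^ k" using assms by (simp add: power_divide)
    finally have e: "(sqrt s / 2 / 2) ^ (2 * k + 1) = sqrt s / 4 * (s / 16) ^ k" .
    show "1 / (fact k * fact (k + 1)) * (sqrt s / 2 / 2) ^ (2 * k + 1)
      = 4 * sqrt s * ((s / 16) ^ k / (16 * fact k * fact (Suc k)))"
      unfolding e by (simp del: fact_Suc)
  qed
  also have "\<dots> = 4 * sqrt s * I1 s"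
    unfolding I1_def by (intro suminf_mult summable_I1)
  finally show ?thesis .
qed

lemma sum_power_div_fact_le_exp:
  assumes "x \<ge> (0::real)"
  shows "(\<Sum>k<n. x ^ k / fact k) \<le> exp x"
proof -
  have "(\<Sum>k<n. inverse (fact k) * x ^ k) \<le> (\<Sum>k. inverse (fact k) * x ^ k)"
    using assms by (intro sum_le_suminf summable_exp) auto
  then show ?thesis by (simp add: exp_def divide_inverse mult.commute scaleR_conv_of_real)
qed

text \<open>Both bounds: with \<open>a\<^sub>k = (t/4)\<^sup>k / k!\<close> the series are \<open>\<Sum> a\<^sub>k a\<^sub>k\<close> and \<open>\<Sum> a\<^sub>k a\<^sub>k\<^sub>+\<^sub>1\<close>, and every \<open>a\<^sub>k\<close> is at most
  \<open>\<Sum> a\<^sub>k = e\<^bsup>t/4\<^esup>\<close>.\<close>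

lemma I0_square_le_exp:
  assumes t: "t \<ge> 0"
  shows "I0 (t\<^sup>2) \<le> exp (t / 2)"
  unfolding I0_def
proof (rule suminf_le_const[OF summable_I0])
  fix n
  define a where "a k = (t / 4) ^ k / fact k" for k :: nat
  have a0: "a k \<ge> 0" for k unfolding a_def using t by simp
  have "(\<Sum>k<n. (t\<^sup>2 / 16) ^ k / (fact k)\<^sup>2) = (\<Sum>k<n. a k * a k)"
  proof (intro sum.cong refl)
    fix k
    have "(t\<^sup>2 / 16) ^ k = (t / 4) ^ k * (t / 4) ^ k"
      by (simp add: power2_eq_square power_mult_distrib[symmetric])
    then show "(t\<^sup>2 / 16) ^ k / (fact k)\<^sup>2 = a k * a k" by (simp add: a_def power2_eq_square)
  qed
  also have "\<dots> \<le> (\<Sum>k<n. a k * exp (t / 4))"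
    using t a0 power_div_fact_le_exp[of "t / 4"] by (intro sum_mono mult_left_mono) (auto simp: a_def)
  also have "\<dots> = (\<Sum>k<n. a k) * exp (t / 4)" by (rule sum_distrib_right[symmetric])
  also have "\<dots> \<le> exp (t / 4) * exp (t / 4)"
    using sum_power_div_fact_le_exp[of "t / 4" n] t by (intro mult_right_mono) (auto simp: a_def)
  also have "\<dots> = exp (t / 2)" by (simp flip: exp_add)
  finally show "(\<Sum>k<n. (t\<^sup>2 / 16) ^ k / (fact k)\<^sup>2) \<le> exp (t / 2)" .
qed

lemma I1_square_le_exp:
  assumes t: "t \<ge> 0"
  shows "4 * t * I1 (t\<^sup>2) \<le> exp (t / 2)"
proof -
  have "4 * t * I1 (t\<^sup>2) = (\<Sum>k. 4 * t * ((t\<^sup>2 / 16) ^ k / (16 * fact k * fact (Suc k))))"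
    unfolding I1_def by (intro suminf_mult[symmetric] summable_I1)
  also have "\<dots> \<le> exp (t / 2)"
  proof (rule suminf_le_const[OF summable_mult[OF summable_I1]])
    fix n
    define a where "a k = (t / 4) ^ k / fact k" for k :: nat
    have a0: "a k \<ge> 0" for k unfolding a_def using t by simp
    have "(\<Sum>k<n. 4 * t * ((t\<^sup>2 / 16) ^ k / (16 * fact k * fact (Suc k)))) = (\<Sum>k<n. a k * a (Suc k))"
    proof (intro sum.cong refl)
      fix k
      have "(t\<^sup>2 / 16) ^ k = (t / 4) ^ k * (t / 4) ^ k"
        by (simp add: power2_eq_square power_mult_distrib[symmetric])
      then show "4 * t * ((t\<^sup>2 / 16) ^ k / (16 * fact k * fact (Suc k))) = a k * a (Suc k)"
        by (simp add: a_def field_simps del: fact_Suc)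
    qed
    also have "\<dots> \<le> (\<Sum>k<n. a k * exp (t / 4))"
    proof (intro sum_mono mult_left_mono a0)
      fix k
      show "a (Suc k) \<le> exp (t / 4)" unfolding a_def using t by (intro power_div_fact_le_exp) simp
    qed
    also have "\<dots> = (\<Sum>k<n. a k) * exp (t / 4)" by (rule sum_distrib_right[symmetric])
    also have "\<dots> \<le> exp (t / 4) * exp (t / 4)"
      using sum_power_div_fact_le_exp[of "t / 4" n] t by (intro mult_right_mono) (auto simp: a_def)
    also have "\<dots> = exp (t / 2)" by (simp flip: exp_add)
    finally show "(\<Sum>k<n. 4 * t * ((t\<^sup>2 / 16) ^ k / (16 * fact k * fact (Suc k)))) \<le> exp (t / 2)" .
  qed
  finally show ?thesis .
qed

section \<open>Integral identities of the Bessel kernels\<close>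

lemma nn_integral_power_series_Icc:
  fixes c :: "nat \<Rightarrow> real"
  assumes c: "\<And>k. c k \<ge> 0" and X: "X \<ge> 0" and sm: "\<And>\<xi>. summable (\<lambda>k. c k * \<xi> ^ k)"
  shows "(\<integral>\<^sup>+\<xi>. ennreal (\<Sum>k. c k * \<xi> ^ k) * indicator {0..X} \<xi> \<partial>lborel) = (\<Sum>k. ennreal (c k * X ^ Suc k / Suc k))"
proof -
  have "(\<integral>\<^sup>+\<xi>. ennreal (\<Sum>k. c k * \<xi> ^ k) * indicator {0..X} \<xi> \<partial>lborel)
    = (\<integral>\<^sup>+\<xi>. (\<Sum>k. ennreal (c k * \<xi> ^ k) * indicator {0..X} \<xi>) \<partial>lborel)"
  proof (intro nn_integral_cong)
    fix \<xi> :: real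
    show "ennreal (\<Sum>k. c k * \<xi> ^ k) * indicator {0..X} \<xi> = (\<Sum>k. ennreal (c k * \<xi> ^ k) * indicator {0..X} \<xi>)"
    proof (cases "\<xi> \<in> {0..X}")
      case True
      then show ?thesis using sm c by (simp add: suminf_ennreal2)
    qed simp
  qed
  also have "\<dots> = (\<Sum>k. \<integral>\<^sup>+\<xi>. ennreal (c k * \<xi> ^ k) * indicator {0..X} \<xi> \<partial>lborel)"
    by (rule nn_integral_suminf) measurable
  also have "\<dots> = (\<Sum>k. ennreal (c k * X ^ Suc k / Suc k))"
  proof (intro suminf_cong)
    fix k
    have "(\<integral>\<^sup>+\<xi>. ennreal (c k * \<xi> ^ k) * indicator {0..X} \<xi> \<partial>lborel)
      = ennreal (c k * X ^ Suc k / Suc k - c k * 0 ^ Suc k / Suc k)"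
    proof (rule nn_integral_FTC_Icc)
      fix x assume "x \<in> {0..X}"
      show "((\<lambda>x. c k * x ^ Suc k / Suc k) has_real_derivative c k * x ^ k) (at x)"
        by (auto intro!: derivative_eq_intros simp del: power_Suc of_nat_Suc)
      show "0 \<le> c k * x ^ k" using c \<open>x \<in> {0..X}\<close> by simp
    qed (use X in auto)
    then show "(\<integral>\<^sup>+\<xi>. ennreal (c k * \<xi> ^ k) * indicator {0..X} \<xi> \<partial>lborel) = ennreal (c k * X ^ Suc k / Suc k)"
      by simp
  qed
  finally show ?thesis .
qed

text \<open>The integrated form of \<open>(s * I1 s)' = I0 s / 16\<close>.\<close>

lemma nn_integral_I0:
  assumes "X \<ge> 0" "Y \<ge> 0"
  shows "(\<integral>\<^sup>+\<xi>. ennreal (I0 (\<xi> * Y)) * indicator {0..X} \<xi> \<partial>lborel) = ennreal (16 * X * I1 (X * Y))"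
proof -
  define c where "c k = (Y / 16) ^ k / (fact k)\<^sup>2" for k :: nat
  have c: "c k * \<xi> ^ k = (\<xi> * Y / 16) ^ k / (fact k)\<^sup>2" for k \<xi>
    by (simp add: c_def power_mult_distrib[symmetric] mult_ac)
  have "(\<integral>\<^sup>+\<xi>. ennreal (\<Sum>k. c k * \<xi> ^ k) * indicator {0..X} \<xi> \<partial>lborel) = (\<Sum>k. ennreal (c k * X ^ Suc k / Suc k))"
  proof (rule nn_integral_power_series_Icc)
    show "0 \<le> c k" for k using assms by (simp add: c_def)
    show "summable (\<lambda>k. c k * \<xi> ^ k)" for \<xi> unfolding c by (rule summable_I0)
  qed fact
  also have "(\<lambda>k. c k * X ^ Suc k / Suc k) = (\<lambda>k. 16 * X * ((X * Y / 16) ^ k / (16 * fact k * fact (Suc k))))"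
  proof
    fix k
    have "c k * X ^ Suc k / Suc k = X * (c k * X ^ k) / Suc k" by simp
    also have "\<dots> = 16 * X * ((X * Y / 16) ^ k / (16 * fact k * fact (Suc k)))"
      unfolding c by (simp add: power2_eq_square divide_simps)
    finally show "c k * X ^ Suc k / Suc k = 16 * X * ((X * Y / 16) ^ k / (16 * fact k * fact (Suc k)))" .
  qed
  also have "(\<Sum>k. ennreal (16 * X * ((X * Y / 16) ^ k / (16 * fact k * fact (Suc k)))))
      = ennreal (\<Sum>k. 16 * X * ((X * Y / 16) ^ k / (16 * fact k * fact (Suc k))))"
    by (rule suminf_ennreal2[OF _ summable_mult[OF summable_I1]]) (use assms in simp)
  also have "(\<Sum>k. 16 * X * ((X * Y / 16) ^ k / (16 * fact k * fact (Suc k)))) = 16 * X * I1 (X * Y)"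
    unfolding I1_def by (rule suminf_mult[OF summable_I1])
  finally show ?thesis unfolding c I0_def .
qed

text \<open>The integrated form of \<open>I0' = I1\<close> with \<open>I0 0 = 1\<close>. The
  constant is added on the left because subtraction in \<open>ennreal\<close> is badly
  behaved.\<close>

lemma nn_integral_I1:
  assumes "X \<ge> 0" "Y \<ge> 0"
  shows "16 + (\<integral>\<^sup>+\<xi>. ennreal (16 * Y * I1 (\<xi> * Y)) * indicator {0..X} \<xi> \<partial>lborel) = ennreal (16 * I0 (X * Y))"
proof -
  define c where "c k = 16 * Y * ((Y / 16) ^ k / (16 * fact k * fact (Suc k)))" for k :: nat
  have c: "c k * \<xi> ^ k = 16 * Y * ((\<xi> * Y / 16) ^ k / (16 * fact k * fact (Suc k)))" for k \<xi>
    by (simp add: c_def power_mult_distrib power_divide)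
  have sm: "summable (\<lambda>k. 16 * ((X * Y / 16) ^ k / (fact k)\<^sup>2))"
    by (intro summable_mult summable_I0)
  have "(\<integral>\<^sup>+\<xi>. ennreal (\<Sum>k. c k * \<xi> ^ k) * indicator {0..X} \<xi> \<partial>lborel) = (\<Sum>k. ennreal (c k * X ^ Suc k / Suc k))"
  proof (rule nn_integral_power_series_Icc)
    show "0 \<le> c k" for k using assms by (simp add: c_def)
    show "summable (\<lambda>k. c k * \<xi> ^ k)" for \<xi> unfolding c by (intro summable_mult summable_I1)
  qed fact
  also have "(\<lambda>\<xi>. \<Sum>k. c k * \<xi> ^ k) = (\<lambda>\<xi>. 16 * Y * I1 (\<xi> * Y))"
    unfolding c I1_def by (intro ext suminf_mult summable_I1)
  also have "(\<lambda>k. c k * X ^ Suc k / Suc k) = (\<lambda>k. 16 * ((X * Y / 16) ^ Suc k / (fact (Suc k))\<^sup>2))"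
  proof
    fix k
    have "c k * X ^ Suc k / Suc k = X * (c k * X ^ k) / Suc k" by simp
    also have "\<dots> = 16 * ((X * Y / 16) ^ Suc k / (fact (Suc k))\<^sup>2)"
      unfolding c by (simp add: power2_eq_square divide_simps)
    finally show "c k * X ^ Suc k / Suc k = 16 * ((X * Y / 16) ^ Suc k / (fact (Suc k))\<^sup>2)" .
  qed
  also have "(\<Sum>k. ennreal (16 * ((X * Y / 16) ^ Suc k / (fact (Suc k))\<^sup>2)))
      = ennreal (\<Sum>k. 16 * ((X * Y / 16) ^ Suc k / (fact (Suc k))\<^sup>2))"
  proof (rule suminf_ennreal2)
    show "summable (\<lambda>k. 16 * ((X * Y / 16) ^ Suc k / (fact (Suc k))\<^sup>2))"
      using sm by (subst summable_Suc_iff) auto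
    show "0 \<le> 16 * ((X * Y / 16) ^ Suc k / (fact (Suc k))\<^sup>2)" for k
      using assms by simp
  qed
  also have "(\<Sum>k. 16 * ((X * Y / 16) ^ Suc k / (fact (Suc k))\<^sup>2)) = 16 * I0 (X * Y) - 16"
    using suminf_split_head[OF sm] suminf_mult[OF summable_I0[of "X * Y"], of 16] unfolding I0_def by simp
  finally have eq: "(\<integral>\<^sup>+\<xi>. ennreal (16 * Y * I1 (\<xi> * Y)) * indicator {0..X} \<xi> \<partial>lborel) = ennreal (16 * I0 (X * Y) - 16)" .
  have "I0 0 \<le> I0 (X * Y)" using assms by (intro I0_mono) auto
  moreover have "I0 0 = 1"
  proof -
    have "I0 0 = (\<Sum>k. if k = 0 then 1 else 0)" unfolding I0_def by (intro suminf_cong) auto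
    also have "\<dots> = 1" by (subst suminf_finite[of "{0}"]) auto
    finally show ?thesis .
  qed
  ultimately show ?thesis
    unfolding eq by (simp add: ennreal_numeral[symmetric] ennreal_plus[symmetric] del: ennreal_numeral ennreal_plus)
qed

text \<open>The Goursat problem solved by the Riemann function: \<open>I0 (X * Y)\<close> has mixed
  derivative \<open>I0 (X * Y) / 16\<close> and equals 1 on both axes. All resolvent identities
  below rest on this one.\<close>

lemma nn_integral_I0_rectangle:
  assumes "X \<ge> 0" "Y \<ge> 0"
  shows "16 + (\<integral>\<^sup>+\<xi>. (\<integral>\<^sup>+\<eta>. ennreal (I0 (\<xi> * \<eta>)) * indicator {0..Y} \<eta> \<partial>lborel) * indicator {0..X} \<xi> \<partial>lborel)
    = ennreal (16 * I0 (X * Y))"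
proof -
  have "(\<integral>\<^sup>+\<xi>. (\<integral>\<^sup>+\<eta>. ennreal (I0 (\<xi> * \<eta>)) * indicator {0..Y} \<eta> \<partial>lborel) * indicator {0..X} \<xi> \<partial>lborel)
    = (\<integral>\<^sup>+\<xi>. ennreal (16 * Y * I1 (\<xi> * Y)) * indicator {0..X} \<xi> \<partial>lborel)"
  proof (intro nn_integral_cong)
    fix \<xi> :: real
    show "(\<integral>\<^sup>+\<eta>. ennreal (I0 (\<xi> * \<eta>)) * indicator {0..Y} \<eta> \<partial>lborel) * indicator {0..X} \<xi>
      = ennreal (16 * Y * I1 (\<xi> * Y)) * indicator {0..X} \<xi>"
      using nn_integral_I0[of Y \<xi>] assms by (cases "\<xi> \<in> {0..X}") (auto simp: mult.commute[of \<xi>])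
  qed
  then show ?thesis using nn_integral_I1[OF assms] by simp
qed

section \<open>The wave operator in characteristic coordinates\<close>

lemma nn_integral_swap4:
  fixes F :: "real \<Rightarrow> real \<Rightarrow> real \<Rightarrow> real \<Rightarrow> ennreal"
  assumes [measurable]: "(\<lambda>(a, b, c, d). F a b c d) \<in> borel_measurable (borel \<Otimes>\<^sub>M borel \<Otimes>\<^sub>M borel \<Otimes>\<^sub>M borel)"
  shows "(\<integral>\<^sup>+a. \<integral>\<^sup>+b. \<integral>\<^sup>+c. \<integral>\<^sup>+d. F a b c d \<partial>lborel \<partial>lborel \<partial>lborel \<partial>lborel)
    = (\<integral>\<^sup>+c. \<integral>\<^sup>+d. \<integral>\<^sup>+a. \<integral>\<^sup>+b. F a b c d \<partial>lborel \<partial>lborel \<partial>lborel \<partial>lborel)"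
proof -
  have m: "(\<lambda>x. F (f1 x) (f2 x) (f3 x) (f4 x)) \<in> borel_measurable M"
    if [measurable]: "f1 \<in> borel_measurable M" "f2 \<in> borel_measurable M" "f3 \<in> borel_measurable M" "f4 \<in> borel_measurable M"
    for f1 f2 f3 f4 and M :: "'z measure"
  proof -
    have "(\<lambda>x. (\<lambda>(a, b, c, d). F a b c d) (f1 x, f2 x, f3 x, f4 x)) \<in> borel_measurable M"
      by measurable
    then show ?thesis by simp
  qed
  note [measurable] = m
  have "(\<integral>\<^sup>+a. \<integral>\<^sup>+b. \<integral>\<^sup>+c. \<integral>\<^sup>+d. F a b c d \<partial>lborel \<partial>lborel \<partial>lborel \<partial>lborel)
    = (\<integral>\<^sup>+a. \<integral>\<^sup>+c. \<integral>\<^sup>+b. \<integral>\<^sup>+d. F a b c d \<partial>lborel \<partial>lborel \<partial>lborel \<partial>lborel)"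
    by (intro nn_integral_cong lborel_pair.Fubini') measurable
  also have "\<dots> = (\<integral>\<^sup>+c. \<integral>\<^sup>+a. \<integral>\<^sup>+b. \<integral>\<^sup>+d. F a b c d \<partial>lborel \<partial>lborel \<partial>lborel \<partial>lborel)"
    by (intro lborel_pair.Fubini') measurable
  also have "\<dots> = (\<integral>\<^sup>+c. \<integral>\<^sup>+a. \<integral>\<^sup>+d. \<integral>\<^sup>+b. F a b c d \<partial>lborel \<partial>lborel \<partial>lborel \<partial>lborel)"
    by (intro nn_integral_cong lborel_pair.Fubini') measurable
  also have "\<dots> = (\<integral>\<^sup>+c. \<integral>\<^sup>+d. \<integral>\<^sup>+a. \<integral>\<^sup>+b. F a b c d \<partial>lborel \<partial>lborel \<partial>lborel \<partial>lborel)"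
    by (intro nn_integral_cong lborel_pair.Fubini') measurable
  finally show ?thesis .
qed

lemma nn_integral_cmult2:
  fixes f :: "real \<Rightarrow> real \<Rightarrow> ennreal"
  assumes [measurable]: "case_prod f \<in> borel_measurable (borel \<Otimes>\<^sub>M borel)"
  shows "(\<integral>\<^sup>+x. \<integral>\<^sup>+y. c * f x y \<partial>lborel \<partial>lborel) = c * (\<integral>\<^sup>+x. \<integral>\<^sup>+y. f x y \<partial>lborel \<partial>lborel)"
  by (simp add: nn_integral_cmult)

text \<open>The endpoints are arguments, so that joint measurability in endpoints and point is at
  hand for Tonelli; \<open>lcone\<close> is encoded in the same way.\<close>

definition inside :: "real \<Rightarrow> real \<Rightarrow> real \<Rightarrow> ennreal" where
  "inside a b y = (if a \<le> y \<and> y \<le> b then 1 else 0)"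

definition lcone :: "real \<Rightarrow> real \<Rightarrow> real \<Rightarrow> real \<Rightarrow> ennreal" where
  "lcone a b \<alpha> \<beta> = (if a \<le> \<alpha> \<and> \<alpha> \<le> \<beta> \<and> \<beta> \<le> b then 1 else 0)"

lemma inside_measurable [measurable]:
  assumes [measurable]: "f \<in> borel_measurable M" "g \<in> borel_measurable M" "h \<in> borel_measurable M"
  shows "(\<lambda>x. inside (f x) (g x) (h x)) \<in> borel_measurable M"
  unfolding inside_def by measurable

lemma lcone_measurable [measurable]:
  assumes [measurable]: "f \<in> borel_measurable M" "g \<in> borel_measurable M" "h \<in> borel_measurable M" "k \<in> borel_measurable M"
  shows "(\<lambda>x. lcone (f x) (g x) (h x) (k x)) \<in> borel_measurable M"
  unfolding lcone_def by measurable

text \<open>The characteristic coordinates are \<open>a = x - t\<close> and \<open>b = x + t\<close>; in these the backward light cone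
  of a point is \<open>a \<le> \<alpha> \<le> \<beta> \<le> b\<close>, and \<open>(t - \<tau>)\<^sup>2 - (x - y)\<^sup>2 = (\<alpha> - a) (b - \<beta>)\<close>. The retarded wave operator is
  \<open>Kop (\<lambda>_. 1)\<close>, and \<open>Kop I0\<close> is the one of \<open>\<partial>\<^sub>t\<^sup>2 - \<partial>\<^sub>x\<^sup>2 - 1/4\<close>.\<close>

definition Kop :: "(real \<Rightarrow> real) \<Rightarrow> (real \<Rightarrow> real \<Rightarrow> ennreal) \<Rightarrow> real \<Rightarrow> real \<Rightarrow> ennreal" where
  "Kop k g a b = ennreal (1 / 4) * (\<integral>\<^sup>+\<alpha>. \<integral>\<^sup>+\<beta>. lcone a b \<alpha> \<beta> * ennreal (k ((\<alpha> - a) * (b - \<beta>))) * g \<alpha> \<beta> \<partial>lborel \<partial>lborel)"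

abbreviation Eop :: "(real \<Rightarrow> real \<Rightarrow> ennreal) \<Rightarrow> real \<Rightarrow> real \<Rightarrow> ennreal" where
  "Eop \<equiv> Kop (\<lambda>_. 1)"

lemma Kop_measurable [measurable]:
  assumes [measurable]: "k \<in> borel_measurable borel" "case_prod g \<in> borel_measurable (borel \<Otimes>\<^sub>M borel)"
  shows "case_prod (Kop k g) \<in> borel_measurable (borel \<Otimes>\<^sub>M borel)"
  unfolding Kop_def by measurable

lemma Kop_mono:
  assumes "\<And>\<alpha> \<beta>. a \<le> \<alpha> \<Longrightarrow> \<alpha> \<le> \<beta> \<Longrightarrow> \<beta> \<le> b \<Longrightarrow> g \<alpha> \<beta> \<le> h \<alpha> \<beta>"
  shows "Kop k g a b \<le> Kop k h a b"
  unfolding Kop_def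
proof (rule mult_left_mono, intro nn_integral_mono)
  fix \<alpha> \<beta>
  show "lcone a b \<alpha> \<beta> * ennreal (k ((\<alpha> - a) * (b - \<beta>))) * g \<alpha> \<beta> \<le> lcone a b \<alpha> \<beta> * ennreal (k ((\<alpha> - a) * (b - \<beta>))) * h \<alpha> \<beta>"
    using assms by (cases "a \<le> \<alpha> \<and> \<alpha> \<le> \<beta> \<and> \<beta> \<le> b") (auto simp: lcone_def intro: mult_left_mono)
qed simp

lemma Kop_add:
  assumes [measurable]: "k \<in> borel_measurable borel"
    "case_prod g \<in> borel_measurable (borel \<Otimes>\<^sub>M borel)" "case_prod h \<in> borel_measurable (borel \<Otimes>\<^sub>M borel)"
  shows "Kop k (\<lambda>\<alpha> \<beta>. g \<alpha> \<beta> + h \<alpha> \<beta>) a b = Kop k g a b + Kop k h a b"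
  unfolding Kop_def by (simp add: distrib_left nn_integral_add)

lemma Kop_cmult:
  assumes [measurable]: "k \<in> borel_measurable borel" "case_prod g \<in> borel_measurable (borel \<Otimes>\<^sub>M borel)"
  shows "Kop k (\<lambda>\<alpha> \<beta>. c * g \<alpha> \<beta>) a b = c * Kop k g a b"
proof -
  have "(\<integral>\<^sup>+\<alpha>. \<integral>\<^sup>+\<beta>. lcone a b \<alpha> \<beta> * ennreal (k ((\<alpha> - a) * (b - \<beta>))) * (c * g \<alpha> \<beta>) \<partial>lborel \<partial>lborel)
    = (\<integral>\<^sup>+\<alpha>. \<integral>\<^sup>+\<beta>. c * (lcone a b \<alpha> \<beta> * ennreal (k ((\<alpha> - a) * (b - \<beta>))) * g \<alpha> \<beta>) \<partial>lborel \<partial>lborel)"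
    by (simp add: mult_ac)
  also have "\<dots> = c * (\<integral>\<^sup>+\<alpha>. \<integral>\<^sup>+\<beta>. lcone a b \<alpha> \<beta> * ennreal (k ((\<alpha> - a) * (b - \<beta>))) * g \<alpha> \<beta> \<partial>lborel \<partial>lborel)"
    by (simp add: nn_integral_cmult)
  finally show ?thesis unfolding Kop_def by (simp add: mult_ac)
qed

text \<open>The kernel of a composition is an integral over the diamond between the two points.\<close>

lemma Kop_Kop:
  assumes [measurable]: "k \<in> borel_measurable borel" "k' \<in> borel_measurable borel"
    "case_prod g \<in> borel_measurable (borel \<Otimes>\<^sub>M borel)"
  shows "Kop k (Kop k' g) a b = ennreal (1 / 16) * (\<integral>\<^sup>+\<alpha>'. \<integral>\<^sup>+\<beta>'. lcone a b \<alpha>' \<beta>' * g \<alpha>' \<beta>' *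
     (\<integral>\<^sup>+\<alpha>. \<integral>\<^sup>+\<beta>. inside a \<alpha>' \<alpha> * inside \<beta>' b \<beta> * ennreal (k ((\<alpha> - a) * (b - \<beta>))) * ennreal (k' ((\<alpha>' - \<alpha>) * (\<beta> - \<beta>')))
        \<partial>lborel \<partial>lborel) \<partial>lborel \<partial>lborel)"
proof -
  have *: "lcone a b \<alpha> \<beta> * lcone \<alpha> \<beta> \<alpha>' \<beta>' = lcone a b \<alpha>' \<beta>' * inside a \<alpha>' \<alpha> * inside \<beta>' b \<beta>" for \<alpha> \<beta> \<alpha>' \<beta>'
    by (auto simp: lcone_def inside_def)
  have "Kop k (Kop k' g) a b = ennreal (1 / 4) * (\<integral>\<^sup>+\<alpha>. \<integral>\<^sup>+\<beta>. lcone a b \<alpha> \<beta> * ennreal (k ((\<alpha> - a) * (b - \<beta>))) *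
      (ennreal (1 / 4) * (\<integral>\<^sup>+\<alpha>'. \<integral>\<^sup>+\<beta>'. lcone \<alpha> \<beta> \<alpha>' \<beta>' * ennreal (k' ((\<alpha>' - \<alpha>) * (\<beta> - \<beta>'))) * g \<alpha>' \<beta>' \<partial>lborel \<partial>lborel)) \<partial>lborel \<partial>lborel)"
    unfolding Kop_def ..
  also have "\<dots> = ennreal (1 / 4) * (\<integral>\<^sup>+\<alpha>. \<integral>\<^sup>+\<beta>. ennreal (1 / 4) * (\<integral>\<^sup>+\<alpha>'. \<integral>\<^sup>+\<beta>'.
      lcone a b \<alpha> \<beta> * ennreal (k ((\<alpha> - a) * (b - \<beta>))) * (lcone \<alpha> \<beta> \<alpha>' \<beta>' * ennreal (k' ((\<alpha>' - \<alpha>) * (\<beta> - \<beta>'))) * g \<alpha>' \<beta>') \<partial>lborel \<partial>lborel) \<partial>lborel \<partial>lborel)"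
  proof (intro arg_cong[where f="\<lambda>x. ennreal (1 / 4) * x"] nn_integral_cong)
    fix \<alpha> \<beta>
    have "(\<integral>\<^sup>+\<alpha>'. \<integral>\<^sup>+\<beta>'. lcone a b \<alpha> \<beta> * ennreal (k ((\<alpha> - a) * (b - \<beta>))) * (lcone \<alpha> \<beta> \<alpha>' \<beta>' * ennreal (k' ((\<alpha>' - \<alpha>) * (\<beta> - \<beta>'))) * g \<alpha>' \<beta>') \<partial>lborel \<partial>lborel)
      = lcone a b \<alpha> \<beta> * ennreal (k ((\<alpha> - a) * (b - \<beta>))) * (\<integral>\<^sup>+\<alpha>'. \<integral>\<^sup>+\<beta>'. lcone \<alpha> \<beta> \<alpha>' \<beta>' * ennreal (k' ((\<alpha>' - \<alpha>) * (\<beta> - \<beta>'))) * g \<alpha>' \<beta>' \<partial>lborel \<partial>lborel)"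
      by (rule nn_integral_cmult2) measurable
    then show "lcone a b \<alpha> \<beta> * ennreal (k ((\<alpha> - a) * (b - \<beta>))) *
      (ennreal (1 / 4) * (\<integral>\<^sup>+\<alpha>'. \<integral>\<^sup>+\<beta>'. lcone \<alpha> \<beta> \<alpha>' \<beta>' * ennreal (k' ((\<alpha>' - \<alpha>) * (\<beta> - \<beta>'))) * g \<alpha>' \<beta>' \<partial>lborel \<partial>lborel))
      = ennreal (1 / 4) * (\<integral>\<^sup>+\<alpha>'. \<integral>\<^sup>+\<beta>'.
      lcone a b \<alpha> \<beta> * ennreal (k ((\<alpha> - a) * (b - \<beta>))) * (lcone \<alpha> \<beta> \<alpha>' \<beta>' * ennreal (k' ((\<alpha>' - \<alpha>) * (\<beta> - \<beta>'))) * g \<alpha>' \<beta>') \<partial>lborel \<partial>lborel)"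
      by (simp only: mult.left_commute)
  qed
  also have "\<dots> = ennreal (1 / 4) * (ennreal (1 / 4) * (\<integral>\<^sup>+\<alpha>. \<integral>\<^sup>+\<beta>. \<integral>\<^sup>+\<alpha>'. \<integral>\<^sup>+\<beta>'.
      lcone a b \<alpha> \<beta> * ennreal (k ((\<alpha> - a) * (b - \<beta>))) * (lcone \<alpha> \<beta> \<alpha>' \<beta>' * ennreal (k' ((\<alpha>' - \<alpha>) * (\<beta> - \<beta>'))) * g \<alpha>' \<beta>') \<partial>lborel \<partial>lborel \<partial>lborel \<partial>lborel))"
    by (simp add: nn_integral_cmult)
  also have "(\<integral>\<^sup>+\<alpha>. \<integral>\<^sup>+\<beta>. \<integral>\<^sup>+\<alpha>'. \<integral>\<^sup>+\<beta>'.
      lcone a b \<alpha> \<beta> * ennreal (k ((\<alpha> - a) * (b - \<beta>))) * (lcone \<alpha> \<beta> \<alpha>' \<beta>' * ennreal (k' ((\<alpha>' - \<alpha>) * (\<beta> - \<beta>'))) * g \<alpha>' \<beta>') \<partial>lborel \<partial>lborel \<partial>lborel \<partial>lborel)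
    = (\<integral>\<^sup>+\<alpha>'. \<integral>\<^sup>+\<beta>'. \<integral>\<^sup>+\<alpha>. \<integral>\<^sup>+\<beta>.
      lcone a b \<alpha> \<beta> * ennreal (k ((\<alpha> - a) * (b - \<beta>))) * (lcone \<alpha> \<beta> \<alpha>' \<beta>' * ennreal (k' ((\<alpha>' - \<alpha>) * (\<beta> - \<beta>'))) * g \<alpha>' \<beta>') \<partial>lborel \<partial>lborel \<partial>lborel \<partial>lborel)"
    by (rule nn_integral_swap4) measurable
  also have "\<dots> = (\<integral>\<^sup>+\<alpha>'. \<integral>\<^sup>+\<beta>'. \<integral>\<^sup>+\<alpha>. \<integral>\<^sup>+\<beta>. lcone a b \<alpha>' \<beta>' * g \<alpha>' \<beta>' *
     (inside a \<alpha>' \<alpha> * inside \<beta>' b \<beta> * ennreal (k ((\<alpha> - a) * (b - \<beta>))) * ennreal (k' ((\<alpha>' - \<alpha>) * (\<beta> - \<beta>')))) \<partial>lborel \<partial>lborel \<partial>lborel \<partial>lborel)"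
  proof (intro nn_integral_cong)
    fix \<alpha>' \<beta>' \<alpha> \<beta>
    have "lcone a b \<alpha> \<beta> * ennreal (k ((\<alpha> - a) * (b - \<beta>))) * (lcone \<alpha> \<beta> \<alpha>' \<beta>' * ennreal (k' ((\<alpha>' - \<alpha>) * (\<beta> - \<beta>'))) * g \<alpha>' \<beta>')
      = (lcone a b \<alpha> \<beta> * lcone \<alpha> \<beta> \<alpha>' \<beta>') * (ennreal (k ((\<alpha> - a) * (b - \<beta>))) * ennreal (k' ((\<alpha>' - \<alpha>) * (\<beta> - \<beta>'))) * g \<alpha>' \<beta>')"
      by (simp only: mult_ac)
    then show "lcone a b \<alpha> \<beta> * ennreal (k ((\<alpha> - a) * (b - \<beta>))) * (lcone \<alpha> \<beta> \<alpha>' \<beta>' * ennreal (k' ((\<alpha>' - \<alpha>) * (\<beta> - \<beta>'))) * g \<alpha>' \<beta>')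
      = lcone a b \<alpha>' \<beta>' * g \<alpha>' \<beta>' * (inside a \<alpha>' \<alpha> * inside \<beta>' b \<beta> * ennreal (k ((\<alpha> - a) * (b - \<beta>))) * ennreal (k' ((\<alpha>' - \<alpha>) * (\<beta> - \<beta>'))))"
      unfolding * by (simp only: mult_ac)
  qed
  also have "\<dots> = (\<integral>\<^sup>+\<alpha>'. \<integral>\<^sup>+\<beta>'. lcone a b \<alpha>' \<beta>' * g \<alpha>' \<beta>' * (\<integral>\<^sup>+\<alpha>. \<integral>\<^sup>+\<beta>.
     (inside a \<alpha>' \<alpha> * inside \<beta>' b \<beta> * ennreal (k ((\<alpha> - a) * (b - \<beta>))) * ennreal (k' ((\<alpha>' - \<alpha>) * (\<beta> - \<beta>')))) \<partial>lborel \<partial>lborel) \<partial>lborel \<partial>lborel)"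
    by (simp add: nn_integral_cmult)
  also have "ennreal (1 / 4) * (ennreal (1 / 4) * X) = ennreal (1 / 16) * X" for X
    by (simp add: mult.assoc[symmetric] ennreal_mult[symmetric])
  finally show ?thesis .
qed

lemma nn_integral_inside_left:
  assumes [measurable]: "f \<in> borel_measurable borel"
  shows "(\<integral>\<^sup>+y. inside a b y * f (y - a) \<partial>lborel) = (\<integral>\<^sup>+\<xi>. f \<xi> * indicator {0..b - a} \<xi> \<partial>lborel)"
proof -
  have "(\<integral>\<^sup>+y. inside a b y * f (y - a) \<partial>lborel) = (\<integral>\<^sup>+\<xi>. inside a b (a + 1 * \<xi>) * f (a + 1 * \<xi> - a) \<partial>lborel)"
    by (subst nn_integral_real_affine[where c=1 and t=a]) auto
  then show ?thesis
    by (auto simp: inside_def indicator_def intro!: nn_integral_cong)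
qed

lemma nn_integral_inside_right:
  assumes [measurable]: "f \<in> borel_measurable borel"
  shows "(\<integral>\<^sup>+y. inside a b y * f (b - y) \<partial>lborel) = (\<integral>\<^sup>+\<xi>. f \<xi> * indicator {0..b - a} \<xi> \<partial>lborel)"
proof -
  have "(\<integral>\<^sup>+y. inside a b y * f (b - y) \<partial>lborel) = (\<integral>\<^sup>+\<xi>. inside a b (b + (-1) * \<xi>) * f (b - (b + (-1) * \<xi>)) \<partial>lborel)"
    by (subst nn_integral_real_affine[where c="-1" and t=b]) auto
  then show ?thesis
    by (auto simp: inside_def indicator_def intro!: nn_integral_cong)
qed

text \<open>With \<open>I0\<close> in the outer operator its argument is measured from the vertex
  \<open>(a, b)\<close>, in \<open>diamond_I0_right\<close> from the source point; in both cases an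
  affine substitution turns the diamond into the rectangle of
  \<open>nn_integral_I0_rectangle\<close>.\<close>

lemma diamond_I0_left:
  assumes "a \<le> \<alpha>'" "\<beta>' \<le> b"
  shows "16 + (\<integral>\<^sup>+\<alpha>. \<integral>\<^sup>+\<beta>. inside a \<alpha>' \<alpha> * inside \<beta>' b \<beta> * ennreal (I0 ((\<alpha> - a) * (b - \<beta>))) \<partial>lborel \<partial>lborel)
    = ennreal (16 * I0 ((\<alpha>' - a) * (b - \<beta>')))"
proof -
  have "(\<integral>\<^sup>+\<alpha>. \<integral>\<^sup>+\<beta>. inside a \<alpha>' \<alpha> * inside \<beta>' b \<beta> * ennreal (I0 ((\<alpha> - a) * (b - \<beta>))) \<partial>lborel \<partial>lborel)
    = (\<integral>\<^sup>+\<alpha>. inside a \<alpha>' \<alpha> * (\<integral>\<^sup>+\<beta>. inside \<beta>' b \<beta> * ennreal (I0 ((\<alpha> - a) * (b - \<beta>))) \<partial>lborel) \<partial>lborel)"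
    by (simp add: nn_integral_cmult mult.assoc)
  also have "\<dots> = (\<integral>\<^sup>+\<alpha>. inside a \<alpha>' \<alpha> * (\<integral>\<^sup>+\<eta>. ennreal (I0 ((\<alpha> - a) * \<eta>)) * indicator {0..b - \<beta>'} \<eta> \<partial>lborel) \<partial>lborel)"
    by (simp add: nn_integral_inside_right[where f="\<lambda>\<eta>. ennreal (I0 (_ * \<eta>))"])
  also have "\<dots> = (\<integral>\<^sup>+\<xi>. (\<integral>\<^sup>+\<eta>. ennreal (I0 (\<xi> * \<eta>)) * indicator {0..b - \<beta>'} \<eta> \<partial>lborel) * indicator {0..\<alpha>' - a} \<xi> \<partial>lborel)"
    by (rule nn_integral_inside_left[where f="\<lambda>\<xi>. \<integral>\<^sup>+\<eta>. ennreal (I0 (\<xi> * \<eta>)) * indicator {0..b - \<beta>'} \<eta> \<partial>lborel"]) measurable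
  finally show ?thesis using nn_integral_I0_rectangle assms by simp
qed

lemma diamond_I0_right:
  assumes "a \<le> \<alpha>'" "\<beta>' \<le> b"
  shows "16 + (\<integral>\<^sup>+\<alpha>. \<integral>\<^sup>+\<beta>. inside a \<alpha>' \<alpha> * inside \<beta>' b \<beta> * ennreal (I0 ((\<alpha>' - \<alpha>) * (\<beta> - \<beta>'))) \<partial>lborel \<partial>lborel)
    = ennreal (16 * I0 ((\<alpha>' - a) * (b - \<beta>')))"
proof -
  have "(\<integral>\<^sup>+\<alpha>. \<integral>\<^sup>+\<beta>. inside a \<alpha>' \<alpha> * inside \<beta>' b \<beta> * ennreal (I0 ((\<alpha>' - \<alpha>) * (\<beta> - \<beta>'))) \<partial>lborel \<partial>lborel)
    = (\<integral>\<^sup>+\<alpha>. inside a \<alpha>' \<alpha> * (\<integral>\<^sup>+\<beta>. inside \<beta>' b \<beta> * ennreal (I0 ((\<alpha>' - \<alpha>) * (\<beta> - \<beta>'))) \<partial>lborel) \<partial>lborel)"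
    by (simp add: nn_integral_cmult mult.assoc)
  also have "\<dots> = (\<integral>\<^sup>+\<alpha>. inside a \<alpha>' \<alpha> * (\<integral>\<^sup>+\<eta>. ennreal (I0 ((\<alpha>' - \<alpha>) * \<eta>)) * indicator {0..b - \<beta>'} \<eta> \<partial>lborel) \<partial>lborel)"
    by (simp add: nn_integral_inside_left[where f="\<lambda>\<eta>. ennreal (I0 (_ * \<eta>))"])
  also have "\<dots> = (\<integral>\<^sup>+\<xi>. (\<integral>\<^sup>+\<eta>. ennreal (I0 (\<xi> * \<eta>)) * indicator {0..b - \<beta>'} \<eta> \<partial>lborel) * indicator {0..\<alpha>' - a} \<xi> \<partial>lborel)"
    by (rule nn_integral_inside_right[where f="\<lambda>\<xi>. \<integral>\<^sup>+\<eta>. ennreal (I0 (\<xi> * \<eta>)) * indicator {0..b - \<beta>'} \<eta> \<partial>lborel"]) measurable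
  finally show ?thesis using nn_integral_I0_rectangle assms by simp
qed

text \<open>The kernel identity \<open>16 + J = 16 * I0\<close> is integrated against
  \<open>g\<close> over the cone. Keeping \<open>J\<close> abstract serves both orders of
  composition.\<close>

lemma resolvent_identity_aux:
  assumes [measurable]: "case_prod g \<in> borel_measurable (borel \<Otimes>\<^sub>M borel)"
    "case_prod J \<in> borel_measurable (borel \<Otimes>\<^sub>M borel)"
    and J: "\<And>\<alpha> \<beta>. a \<le> \<alpha> \<Longrightarrow> \<beta> \<le> b \<Longrightarrow> 16 + J \<alpha> \<beta> = ennreal (16 * I0 ((\<alpha> - a) * (b - \<beta>)))"
  shows "4 * Eop g a b + ennreal (1 / 16) * (\<integral>\<^sup>+\<alpha>. \<integral>\<^sup>+\<beta>. lcone a b \<alpha> \<beta> * g \<alpha> \<beta> * J \<alpha> \<beta> \<partial>lborel \<partial>lborel) = 4 * Kop I0 g a b"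
proof -
  let ?c = "ennreal (1 / 16)"
  have c: "4 * ennreal (1 / 4) = 1" "?c * 16 = 1"
    by (simp_all add: ennreal_mult[symmetric] flip: ennreal_numeral)
  have "4 * Eop g a b + ?c * (\<integral>\<^sup>+\<alpha>. \<integral>\<^sup>+\<beta>. lcone a b \<alpha> \<beta> * g \<alpha> \<beta> * J \<alpha> \<beta> \<partial>lborel \<partial>lborel)
    = (\<integral>\<^sup>+\<alpha>. \<integral>\<^sup>+\<beta>. lcone a b \<alpha> \<beta> * g \<alpha> \<beta> \<partial>lborel \<partial>lborel) + ?c * (\<integral>\<^sup>+\<alpha>. \<integral>\<^sup>+\<beta>. lcone a b \<alpha> \<beta> * g \<alpha> \<beta> * J \<alpha> \<beta> \<partial>lborel \<partial>lborel)"
    unfolding Kop_def by (simp add: mult.assoc[symmetric] c)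
  also have "(\<integral>\<^sup>+\<alpha>. \<integral>\<^sup>+\<beta>. lcone a b \<alpha> \<beta> * g \<alpha> \<beta> \<partial>lborel \<partial>lborel) = ?c * 16 * (\<integral>\<^sup>+\<alpha>. \<integral>\<^sup>+\<beta>. lcone a b \<alpha> \<beta> * g \<alpha> \<beta> \<partial>lborel \<partial>lborel)"
    by (simp add: c)
  also have "\<dots> = ?c * (\<integral>\<^sup>+\<alpha>. \<integral>\<^sup>+\<beta>. 16 * (lcone a b \<alpha> \<beta> * g \<alpha> \<beta>) \<partial>lborel \<partial>lborel)"
    by (subst nn_integral_cmult2, measurable) (simp only: mult.assoc)
  also have "(\<integral>\<^sup>+\<alpha>. \<integral>\<^sup>+\<beta>. 16 * (lcone a b \<alpha> \<beta> * g \<alpha> \<beta>) \<partial>lborel \<partial>lborel) = (\<integral>\<^sup>+\<alpha>. \<integral>\<^sup>+\<beta>. lcone a b \<alpha> \<beta> * g \<alpha> \<beta> * 16 \<partial>lborel \<partial>lborel)"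
    by (simp only: mult.commute)
  also have "?c * (\<integral>\<^sup>+\<alpha>. \<integral>\<^sup>+\<beta>. lcone a b \<alpha> \<beta> * g \<alpha> \<beta> * 16 \<partial>lborel \<partial>lborel) + ?c * (\<integral>\<^sup>+\<alpha>. \<integral>\<^sup>+\<beta>. lcone a b \<alpha> \<beta> * g \<alpha> \<beta> * J \<alpha> \<beta> \<partial>lborel \<partial>lborel)
    = ?c * (\<integral>\<^sup>+\<alpha>. \<integral>\<^sup>+\<beta>. lcone a b \<alpha> \<beta> * g \<alpha> \<beta> * (16 + J \<alpha> \<beta>) \<partial>lborel \<partial>lborel)"
    by (simp add: distrib_left nn_integral_add)
  also have "(\<integral>\<^sup>+\<alpha>. \<integral>\<^sup>+\<beta>. lcone a b \<alpha> \<beta> * g \<alpha> \<beta> * (16 + J \<alpha> \<beta>) \<partial>lborel \<partial>lborel)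
     = (\<integral>\<^sup>+\<alpha>. \<integral>\<^sup>+\<beta>. 16 * (lcone a b \<alpha> \<beta> * ennreal (I0 ((\<alpha> - a) * (b - \<beta>))) * g \<alpha> \<beta>) \<partial>lborel \<partial>lborel)"
    by (intro nn_integral_cong) (auto simp: lcone_def J ennreal_mult' mult_ac)
  also have "\<dots> = 16 * (\<integral>\<^sup>+\<alpha>. \<integral>\<^sup>+\<beta>. lcone a b \<alpha> \<beta> * ennreal (I0 ((\<alpha> - a) * (b - \<beta>))) * g \<alpha> \<beta> \<partial>lborel \<partial>lborel)"
    by (simp add: nn_integral_cmult)
  finally show ?thesis unfolding Kop_def by (simp add: mult.assoc[symmetric] c)
qed

text \<open>With \<open>E = Eop\<close> and \<open>K = Kop I0\<close> this reads
  \<open>K (1 - E/4) = E\<close>: thus \<open>K\<close> is the resummed Neumann series of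
  \<open>E/4\<close>, applied to \<open>E\<close>. This order yields the Duhamel formula for the
  nonlinear solution.\<close>

lemma Kop_I0_Eop:
  assumes [measurable]: "case_prod g \<in> borel_measurable (borel \<Otimes>\<^sub>M borel)"
  shows "4 * Eop g a b + Kop I0 (Eop g) a b = 4 * Kop I0 g a b"
proof -
  have "Kop I0 (Eop g) a b = ennreal (1 / 16) * (\<integral>\<^sup>+\<alpha>'. \<integral>\<^sup>+\<beta>'. lcone a b \<alpha>' \<beta>' * g \<alpha>' \<beta>' *
     (\<integral>\<^sup>+\<alpha>. \<integral>\<^sup>+\<beta>. inside a \<alpha>' \<alpha> * inside \<beta>' b \<beta> * ennreal (I0 ((\<alpha> - a) * (b - \<beta>))) \<partial>lborel \<partial>lborel) \<partial>lborel \<partial>lborel)"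
    by (subst Kop_Kop) simp_all
  then show ?thesis
    by (simp only:) (rule resolvent_identity_aux, measurable, rule diamond_I0_left)
qed

text \<open>The other order, \<open>(1 - E/4) K = E\<close>, which verifies that
  \<open>linear_solution\<close> solves its integral equation.\<close>

lemma Eop_Kop_I0:
  assumes [measurable]: "case_prod g \<in> borel_measurable (borel \<Otimes>\<^sub>M borel)"
  shows "4 * Eop g a b + Eop (Kop I0 g) a b = 4 * Kop I0 g a b"
proof -
  have "Eop (Kop I0 g) a b = ennreal (1 / 16) * (\<integral>\<^sup>+\<alpha>'. \<integral>\<^sup>+\<beta>'. lcone a b \<alpha>' \<beta>' * g \<alpha>' \<beta>' *
     (\<integral>\<^sup>+\<alpha>. \<integral>\<^sup>+\<beta>. inside a \<alpha>' \<alpha> * inside \<beta>' b \<beta> * ennreal (I0 ((\<alpha>' - \<alpha>) * (\<beta> - \<beta>'))) \<partial>lborel \<partial>lborel) \<partial>lborel \<partial>lborel)"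
    by (subst Kop_Kop) simp_all
  then show ?thesis
    by (simp only:) (rule resolvent_identity_aux, measurable, rule diamond_I0_right)
qed

section \<open>The linear equation with mass term\<close>

definition free :: "(real \<Rightarrow> real) \<Rightarrow> (real \<Rightarrow> real) \<Rightarrow> real \<Rightarrow> real \<Rightarrow> ennreal" where
  "free \<phi> \<psi> a b = ennreal (1 / 2) * (ennreal (\<phi> a) + ennreal (\<phi> b)) +
     ennreal (1 / 2) * (\<integral>\<^sup>+y. inside a b y * ennreal (\<psi> y) \<partial>lborel)"

text \<open>This is the inverse of \<open>1 - E/4\<close> applied to d'Alembert's formula
  \<open>free\<close>, since that inverse equals \<open>1 + K/4\<close>.\<close>

definition linear_solution :: "(real \<Rightarrow> real) \<Rightarrow> (real \<Rightarrow> real) \<Rightarrow> real \<Rightarrow> real \<Rightarrow> ennreal" where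
  "linear_solution \<phi> \<psi> a b = free \<phi> \<psi> a b + ennreal (1 / 4) * Kop I0 (free \<phi> \<psi>) a b"

lemma free_measurable [measurable]:
  assumes [measurable]: "\<phi> \<in> borel_measurable borel" "\<psi> \<in> borel_measurable borel"
  shows "case_prod (free \<phi> \<psi>) \<in> borel_measurable (borel \<Otimes>\<^sub>M borel)"
  unfolding free_def by measurable

lemma linear_solution_measurable [measurable]:
  assumes [measurable]: "\<phi> \<in> borel_measurable borel" "\<psi> \<in> borel_measurable borel"
  shows "case_prod (linear_solution \<phi> \<psi>) \<in> borel_measurable (borel \<Otimes>\<^sub>M borel)"
  unfolding linear_solution_def by measurable

lemma ennreal_quarter: "ennreal (1 / 4) * 4 = 1" "4 * ennreal (1 / 4) = 1"
  by (simp_all add: ennreal_mult[symmetric] flip: ennreal_numeral)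

lemma ennreal_mult_mult: "0 \<le> x \<Longrightarrow> 0 \<le> y \<Longrightarrow> ennreal x * (ennreal y * Z) = ennreal (x * y) * Z"
  by (simp only: ennreal_mult mult.assoc)

lemma ennreal_4_2_4: "ennreal (1 / 4) * (ennreal (1 / 2) * (ennreal (1 / 4) * X)) = ennreal (1 / 32) * X"
proof -
  have "ennreal (1 / 4) * (ennreal (1 / 2) * (ennreal (1 / 4) * X)) = ennreal (1 / 4 * (1 / 2) * (1 / 4)) * X"
    by (subst ennreal_mult_mult, simp, simp, subst ennreal_mult_mult, simp, simp, rule refl)
  then show ?thesis by simp
qed

text \<open>Applying \<open>E/4\<close> to \<open>f + K f / 4\<close> gives \<open>K f / 4\<close>,
  by the resolvent identity \<open>E f + E K f / 4 = K f\<close>.\<close>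

lemma linear_solution_fixed_point:
  assumes [measurable]: "\<phi> \<in> borel_measurable borel" "\<psi> \<in> borel_measurable borel"
  shows "linear_solution \<phi> \<psi> a b = free \<phi> \<psi> a b + ennreal (1 / 4) * Eop (linear_solution \<phi> \<psi>) a b"
proof -
  let ?f = "free \<phi> \<psi>"
  have "Eop (linear_solution \<phi> \<psi>) a b = Eop ?f a b + ennreal (1 / 4) * Eop (Kop I0 ?f) a b"
  proof -
    have [measurable]: "(\<lambda>_. 1::real) \<in> borel_measurable borel" by measurable
    have m1: "case_prod ?f \<in> borel_measurable (borel \<Otimes>\<^sub>M borel)" by measurable
    have m2: "case_prod (Kop I0 ?f) \<in> borel_measurable (borel \<Otimes>\<^sub>M borel)"
      by (rule Kop_measurable[OF I0_measurable m1])
    have m3: "case_prod (\<lambda>\<alpha> \<beta>. ennreal (1 / 4) * Kop I0 ?f \<alpha> \<beta>) \<in> borel_measurable (borel \<Otimes>\<^sub>M borel)"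
      using m2 by measurable
    have "(\<lambda>\<alpha> \<beta>. free \<phi> \<psi> \<alpha> \<beta> + ennreal (1 / 4) * Kop I0 ?f \<alpha> \<beta>) = linear_solution \<phi> \<psi>"
      by (intro ext) (simp only: linear_solution_def)
    then show ?thesis
      using Kop_add[OF _ m1 m3, of "\<lambda>_. 1" a b] Kop_cmult[OF _ m2, of "\<lambda>_. 1" "ennreal (1 / 4)" a b] by simp
  qed
  also have "\<dots> = ennreal (1 / 4) * (4 * Eop ?f a b + Eop (Kop I0 ?f) a b)"
    by (simp add: distrib_left mult.assoc[symmetric] ennreal_quarter)
  also have "\<dots> = Kop I0 ?f a b"
    by (subst Eop_Kop_I0) (auto simp: mult.assoc[symmetric] ennreal_quarter)
  finally show ?thesis unfolding linear_solution_def by simp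
qed

lemma nn_integral_swap3:
  fixes F :: "real \<Rightarrow> real \<Rightarrow> real \<Rightarrow> ennreal"
  assumes [measurable]: "(\<lambda>(a, b, c). F a b c) \<in> borel_measurable (borel \<Otimes>\<^sub>M borel \<Otimes>\<^sub>M borel)"
  shows "(\<integral>\<^sup>+a. \<integral>\<^sup>+b. \<integral>\<^sup>+c. F a b c \<partial>lborel \<partial>lborel \<partial>lborel)
    = (\<integral>\<^sup>+c. \<integral>\<^sup>+a. \<integral>\<^sup>+b. F a b c \<partial>lborel \<partial>lborel \<partial>lborel)"
proof -
  have m: "(\<lambda>x. F (f1 x) (f2 x) (f3 x)) \<in> borel_measurable M"
    if [measurable]: "f1 \<in> borel_measurable M" "f2 \<in> borel_measurable M" "f3 \<in> borel_measurable M"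
    for f1 f2 f3 and M :: "'z measure"
  proof -
    have "(\<lambda>x. (\<lambda>(a, b, c). F a b c) (f1 x, f2 x, f3 x)) \<in> borel_measurable M"
      by measurable
    then show ?thesis by simp
  qed
  note [measurable] = m
  have "(\<integral>\<^sup>+a. \<integral>\<^sup>+b. \<integral>\<^sup>+c. F a b c \<partial>lborel \<partial>lborel \<partial>lborel) = (\<integral>\<^sup>+a. \<integral>\<^sup>+c. \<integral>\<^sup>+b. F a b c \<partial>lborel \<partial>lborel \<partial>lborel)"
    by (intro nn_integral_cong lborel_pair.Fubini') measurable
  also have "\<dots> = (\<integral>\<^sup>+c. \<integral>\<^sup>+a. \<integral>\<^sup>+b. F a b c \<partial>lborel \<partial>lborel \<partial>lborel)"
    by (intro lborel_pair.Fubini') measurable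
  finally show ?thesis .
qed

text \<open>An initial velocity acts like a source concentrated at
  \<open>\<alpha> = \<beta> = y\<close>. The diamond identity with both inner corners equal to
  \<open>y\<close> therefore replaces the kernel 1 by \<open>I0\<close>.\<close>

lemma Kop_I0_source:
  assumes [measurable]: "\<psi> \<in> borel_measurable borel"
  shows "ennreal (1 / 2) * (\<integral>\<^sup>+y. inside a b y * ennreal (\<psi> y) \<partial>lborel)
     + ennreal (1 / 4) * Kop I0 (\<lambda>\<alpha> \<beta>. ennreal (1 / 2) * (\<integral>\<^sup>+y. inside \<alpha> \<beta> y * ennreal (\<psi> y) \<partial>lborel)) a b
     = ennreal (1 / 2) * (\<integral>\<^sup>+y. inside a b y * (ennreal (I0 ((y - a) * (b - y))) * ennreal (\<psi> y)) \<partial>lborel)"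
proof -
  define J where "J y = (\<integral>\<^sup>+\<alpha>. \<integral>\<^sup>+\<beta>. inside a y \<alpha> * inside y b \<beta> * ennreal (I0 ((\<alpha> - a) * (b - \<beta>))) \<partial>lborel \<partial>lborel)" for y
  have [measurable]: "J \<in> borel_measurable borel" unfolding J_def by measurable
  have *: "lcone a b \<alpha> \<beta> * inside \<alpha> \<beta> y = inside a b y * (inside a y \<alpha> * inside y b \<beta>)" for \<alpha> \<beta> y
    by (auto simp: lcone_def inside_def)
  have "Kop I0 (\<lambda>\<alpha> \<beta>. \<integral>\<^sup>+y. inside \<alpha> \<beta> y * ennreal (\<psi> y) \<partial>lborel) a b
    = ennreal (1 / 4) * (\<integral>\<^sup>+\<alpha>. \<integral>\<^sup>+\<beta>. \<integral>\<^sup>+y. lcone a b \<alpha> \<beta> * ennreal (I0 ((\<alpha> - a) * (b - \<beta>))) * (inside \<alpha> \<beta> y * ennreal (\<psi> y)) \<partial>lborel \<partial>lborel \<partial>lborel)"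
    unfolding Kop_def by (simp add: nn_integral_cmult)
  also have "(\<integral>\<^sup>+\<alpha>. \<integral>\<^sup>+\<beta>. \<integral>\<^sup>+y. lcone a b \<alpha> \<beta> * ennreal (I0 ((\<alpha> - a) * (b - \<beta>))) * (inside \<alpha> \<beta> y * ennreal (\<psi> y)) \<partial>lborel \<partial>lborel \<partial>lborel)
    = (\<integral>\<^sup>+y. \<integral>\<^sup>+\<alpha>. \<integral>\<^sup>+\<beta>. lcone a b \<alpha> \<beta> * ennreal (I0 ((\<alpha> - a) * (b - \<beta>))) * (inside \<alpha> \<beta> y * ennreal (\<psi> y)) \<partial>lborel \<partial>lborel \<partial>lborel)"
    by (rule nn_integral_swap3) measurable
  also have "\<dots> = (\<integral>\<^sup>+y. \<integral>\<^sup>+\<alpha>. \<integral>\<^sup>+\<beta>. (inside a b y * ennreal (\<psi> y)) * (inside a y \<alpha> * inside y b \<beta> * ennreal (I0 ((\<alpha> - a) * (b - \<beta>)))) \<partial>lborel \<partial>lborel \<partial>lborel)"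
  proof (intro nn_integral_cong)
    fix y \<alpha> \<beta>
    have "lcone a b \<alpha> \<beta> * ennreal (I0 ((\<alpha> - a) * (b - \<beta>))) * (inside \<alpha> \<beta> y * ennreal (\<psi> y))
      = (lcone a b \<alpha> \<beta> * inside \<alpha> \<beta> y) * (ennreal (I0 ((\<alpha> - a) * (b - \<beta>))) * ennreal (\<psi> y))"
      by (simp only: mult_ac)
    then show "lcone a b \<alpha> \<beta> * ennreal (I0 ((\<alpha> - a) * (b - \<beta>))) * (inside \<alpha> \<beta> y * ennreal (\<psi> y))
      = (inside a b y * ennreal (\<psi> y)) * (inside a y \<alpha> * inside y b \<beta> * ennreal (I0 ((\<alpha> - a) * (b - \<beta>))))"
      unfolding * by (simp only: mult_ac)
  qed
  also have "\<dots> = (\<integral>\<^sup>+y. (inside a b y * ennreal (\<psi> y)) * J y \<partial>lborel)"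
    unfolding J_def by (subst nn_integral_cmult2) auto
  finally have K: "Kop I0 (\<lambda>\<alpha> \<beta>. \<integral>\<^sup>+y. inside \<alpha> \<beta> y * ennreal (\<psi> y) \<partial>lborel) a b
    = ennreal (1 / 4) * (\<integral>\<^sup>+y. (inside a b y * ennreal (\<psi> y)) * J y \<partial>lborel)" .
  \<comment> \<open>\<open>1/32\<close> is the product of the three factors \<open>1/4\<close>,
    \<open>1/2\<close> and \<open>1/4\<close>; writing \<open>1/2\<close> as \<open>16/32\<close>
    produces the sum \<open>16 + J y\<close> of the diamond identity.\<close>
  have c1: "ennreal (1 / 2) = ennreal (1 / 32) * 16"
    by (simp add: ennreal_mult[symmetric] flip: ennreal_numeral)
  have "ennreal (1 / 2) * (\<integral>\<^sup>+y. inside a b y * ennreal (\<psi> y) \<partial>lborel)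
     + ennreal (1 / 4) * Kop I0 (\<lambda>\<alpha> \<beta>. ennreal (1 / 2) * (\<integral>\<^sup>+y. inside \<alpha> \<beta> y * ennreal (\<psi> y) \<partial>lborel)) a b
    = ennreal (1 / 32) * (16 * (\<integral>\<^sup>+y. inside a b y * ennreal (\<psi> y) \<partial>lborel)) + ennreal (1 / 32) * (\<integral>\<^sup>+y. (inside a b y * ennreal (\<psi> y)) * J y \<partial>lborel)"
  proof -
    have m: "case_prod (\<lambda>\<alpha> \<beta>. \<integral>\<^sup>+y. inside \<alpha> \<beta> y * ennreal (\<psi> y) \<partial>lborel) \<in> borel_measurable (borel \<Otimes>\<^sub>M borel)"
      by measurable
    show ?thesis
      by (simp only: Kop_cmult[OF I0_measurable m] K ennreal_4_2_4) (simp only: c1 mult.assoc)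
  qed
  also have "\<dots> = ennreal (1 / 32) * (\<integral>\<^sup>+y. (inside a b y * ennreal (\<psi> y)) * (16 + J y) \<partial>lborel)"
  proof -
    have "(\<integral>\<^sup>+y. (inside a b y * ennreal (\<psi> y)) * (16 + J y) \<partial>lborel)
      = (\<integral>\<^sup>+y. 16 * (inside a b y * ennreal (\<psi> y)) + (inside a b y * ennreal (\<psi> y)) * J y \<partial>lborel)"
      by (simp only: distrib_left mult.commute[of _ 16])
    also have "\<dots> = (\<integral>\<^sup>+y. 16 * (inside a b y * ennreal (\<psi> y)) \<partial>lborel) + (\<integral>\<^sup>+y. (inside a b y * ennreal (\<psi> y)) * J y \<partial>lborel)"
      by (rule nn_integral_add) measurable
    also have "(\<integral>\<^sup>+y. 16 * (inside a b y * ennreal (\<psi> y)) \<partial>lborel) = 16 * (\<integral>\<^sup>+y. inside a b y * ennreal (\<psi> y) \<partial>lborel)"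
      by (rule nn_integral_cmult) measurable
    finally show ?thesis by (simp only: distrib_left)
  qed
  also have "(\<integral>\<^sup>+y. (inside a b y * ennreal (\<psi> y)) * (16 + J y) \<partial>lborel)
    = (\<integral>\<^sup>+y. 16 * (inside a b y * (ennreal (I0 ((y - a) * (b - y))) * ennreal (\<psi> y))) \<partial>lborel)"
  proof (intro nn_integral_cong)
    fix y
    show "inside a b y * ennreal (\<psi> y) * (16 + J y) = 16 * (inside a b y * (ennreal (I0 ((y - a) * (b - y))) * ennreal (\<psi> y)))"
    proof (cases "a \<le> y \<and> y \<le> b")
      case True
      then have "16 + J y = 16 * ennreal (I0 ((y - a) * (b - y)))"
        unfolding J_def using diamond_I0_left[of a y y b] by (simp add: ennreal_mult')
      then show ?thesis by (simp only: mult_ac)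
    qed (auto simp: inside_def)
  qed
  also have "\<dots> = 16 * (\<integral>\<^sup>+y. inside a b y * (ennreal (I0 ((y - a) * (b - y))) * ennreal (\<psi> y)) \<partial>lborel)"
    by (rule nn_integral_cmult) measurable
  finally show ?thesis by (simp only: c1 mult.assoc)
qed

text \<open>Each boundary term depends on one characteristic coordinate only, so the other one is
  integrated out by \<open>nn_integral_I0\<close>. The resulting weights \<open>16 * (b - y)\<close>
  and \<open>16 * (y - a)\<close> add up to \<open>16 * (b - a)\<close>.\<close>

lemma Kop_I0_boundary:
  assumes [measurable]: "\<phi> \<in> borel_measurable borel"
  shows "ennreal (1 / 4) * Kop I0 (\<lambda>\<alpha> \<beta>. ennreal (1 / 2) * (ennreal (\<phi> \<alpha>) + ennreal (\<phi> \<beta>))) a b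
     = (\<integral>\<^sup>+y. inside a b y * (ennreal ((b - a) / 2 * I1 ((y - a) * (b - y))) * ennreal (\<phi> y)) \<partial>lborel)"
proof -
  have l1: "lcone a b \<alpha> \<beta> = inside a b \<alpha> * inside \<alpha> b \<beta>" for \<alpha> \<beta>
    by (auto simp: lcone_def inside_def)
  have l2: "lcone a b \<alpha> \<beta> = inside a b \<beta> * inside a \<beta> \<alpha>" for \<alpha> \<beta>
    by (auto simp: lcone_def inside_def)
  have i1: "inside a b \<alpha> * (\<integral>\<^sup>+\<beta>. inside \<alpha> b \<beta> * ennreal (I0 ((\<alpha> - a) * (b - \<beta>))) \<partial>lborel)
    = inside a b \<alpha> * ennreal (16 * (b - \<alpha>) * I1 ((\<alpha> - a) * (b - \<alpha>)))" for \<alpha>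
  proof (cases "a \<le> \<alpha> \<and> \<alpha> \<le> b")
    case True
    have "(\<integral>\<^sup>+\<beta>. inside \<alpha> b \<beta> * ennreal (I0 ((b - \<beta>) * (\<alpha> - a))) \<partial>lborel) = (\<integral>\<^sup>+\<xi>. ennreal (I0 (\<xi> * (\<alpha> - a))) * indicator {0..b - \<alpha>} \<xi> \<partial>lborel)"
      by (rule nn_integral_inside_right[where f="\<lambda>\<xi>. ennreal (I0 (\<xi> * (\<alpha> - a)))"]) measurable
    also have "\<dots> = ennreal (16 * (b - \<alpha>) * I1 ((b - \<alpha>) * (\<alpha> - a)))"
      using True by (intro nn_integral_I0) auto
    finally show ?thesis by (simp add: mult.commute)
  qed (auto simp: inside_def)
  have i2: "inside a b \<beta> * (\<integral>\<^sup>+\<alpha>. inside a \<beta> \<alpha> * ennreal (I0 ((\<alpha> - a) * (b - \<beta>))) \<partial>lborel)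
    = inside a b \<beta> * ennreal (16 * (\<beta> - a) * I1 ((\<beta> - a) * (b - \<beta>)))" for \<beta>
  proof (cases "a \<le> \<beta> \<and> \<beta> \<le> b")
    case True
    have "(\<integral>\<^sup>+\<alpha>. inside a \<beta> \<alpha> * ennreal (I0 ((\<alpha> - a) * (b - \<beta>))) \<partial>lborel) = (\<integral>\<^sup>+\<xi>. ennreal (I0 (\<xi> * (b - \<beta>))) * indicator {0..\<beta> - a} \<xi> \<partial>lborel)"
      by (rule nn_integral_inside_left[where f="\<lambda>\<xi>. ennreal (I0 (\<xi> * (b - \<beta>)))"]) measurable
    also have "\<dots> = ennreal (16 * (\<beta> - a) * I1 ((\<beta> - a) * (b - \<beta>)))"
      using True by (intro nn_integral_I0) auto
    finally show ?thesis by simp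
  qed (auto simp: inside_def)
  have k1: "(\<integral>\<^sup>+\<alpha>. \<integral>\<^sup>+\<beta>. lcone a b \<alpha> \<beta> * ennreal (I0 ((\<alpha> - a) * (b - \<beta>))) * ennreal (\<phi> \<alpha>) \<partial>lborel \<partial>lborel)
    = (\<integral>\<^sup>+\<alpha>. inside a b \<alpha> * ennreal (16 * (b - \<alpha>) * I1 ((\<alpha> - a) * (b - \<alpha>))) * ennreal (\<phi> \<alpha>) \<partial>lborel)"
  proof (intro nn_integral_cong)
    fix \<alpha>
    have "(\<integral>\<^sup>+\<beta>. lcone a b \<alpha> \<beta> * ennreal (I0 ((\<alpha> - a) * (b - \<beta>))) * ennreal (\<phi> \<alpha>) \<partial>lborel)
      = (\<integral>\<^sup>+\<beta>. (inside a b \<alpha> * ennreal (\<phi> \<alpha>)) * (inside \<alpha> b \<beta> * ennreal (I0 ((\<alpha> - a) * (b - \<beta>)))) \<partial>lborel)"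
      unfolding l1 by (simp only: mult_ac)
    also have "\<dots> = (inside a b \<alpha> * ennreal (\<phi> \<alpha>)) * (\<integral>\<^sup>+\<beta>. inside \<alpha> b \<beta> * ennreal (I0 ((\<alpha> - a) * (b - \<beta>))) \<partial>lborel)"
      by (rule nn_integral_cmult) measurable
    also have "\<dots> = inside a b \<alpha> * ennreal (16 * (b - \<alpha>) * I1 ((\<alpha> - a) * (b - \<alpha>))) * ennreal (\<phi> \<alpha>)"
      unfolding i1[symmetric] by (simp only: mult_ac)
    finally show "(\<integral>\<^sup>+\<beta>. lcone a b \<alpha> \<beta> * ennreal (I0 ((\<alpha> - a) * (b - \<beta>))) * ennreal (\<phi> \<alpha>) \<partial>lborel)
      = inside a b \<alpha> * ennreal (16 * (b - \<alpha>) * I1 ((\<alpha> - a) * (b - \<alpha>))) * ennreal (\<phi> \<alpha>)" .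
  qed
  have "(\<integral>\<^sup>+\<alpha>. \<integral>\<^sup>+\<beta>. lcone a b \<alpha> \<beta> * ennreal (I0 ((\<alpha> - a) * (b - \<beta>))) * ennreal (\<phi> \<beta>) \<partial>lborel \<partial>lborel)
    = (\<integral>\<^sup>+\<beta>. \<integral>\<^sup>+\<alpha>. lcone a b \<alpha> \<beta> * ennreal (I0 ((\<alpha> - a) * (b - \<beta>))) * ennreal (\<phi> \<beta>) \<partial>lborel \<partial>lborel)"
    by (rule lborel_pair.Fubini') measurable
  also have "\<dots> = (\<integral>\<^sup>+\<beta>. inside a b \<beta> * ennreal (16 * (\<beta> - a) * I1 ((\<beta> - a) * (b - \<beta>))) * ennreal (\<phi> \<beta>) \<partial>lborel)"
  proof (intro nn_integral_cong)
    fix \<beta>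
    have "(\<integral>\<^sup>+\<alpha>. lcone a b \<alpha> \<beta> * ennreal (I0 ((\<alpha> - a) * (b - \<beta>))) * ennreal (\<phi> \<beta>) \<partial>lborel)
      = (\<integral>\<^sup>+\<alpha>. (inside a b \<beta> * ennreal (\<phi> \<beta>)) * (inside a \<beta> \<alpha> * ennreal (I0 ((\<alpha> - a) * (b - \<beta>)))) \<partial>lborel)"
      unfolding l2 by (simp only: mult_ac)
    also have "\<dots> = (inside a b \<beta> * ennreal (\<phi> \<beta>)) * (\<integral>\<^sup>+\<alpha>. inside a \<beta> \<alpha> * ennreal (I0 ((\<alpha> - a) * (b - \<beta>))) \<partial>lborel)"
      by (rule nn_integral_cmult) measurable
    also have "\<dots> = inside a b \<beta> * ennreal (16 * (\<beta> - a) * I1 ((\<beta> - a) * (b - \<beta>))) * ennreal (\<phi> \<beta>)"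
      unfolding i2[symmetric] by (simp only: mult_ac)
    finally show "(\<integral>\<^sup>+\<alpha>. lcone a b \<alpha> \<beta> * ennreal (I0 ((\<alpha> - a) * (b - \<beta>))) * ennreal (\<phi> \<beta>) \<partial>lborel)
      = inside a b \<beta> * ennreal (16 * (\<beta> - a) * I1 ((\<beta> - a) * (b - \<beta>))) * ennreal (\<phi> \<beta>)" .
  qed
  finally have k2: "(\<integral>\<^sup>+\<alpha>. \<integral>\<^sup>+\<beta>. lcone a b \<alpha> \<beta> * ennreal (I0 ((\<alpha> - a) * (b - \<beta>))) * ennreal (\<phi> \<beta>) \<partial>lborel \<partial>lborel)
    = (\<integral>\<^sup>+\<beta>. inside a b \<beta> * ennreal (16 * (\<beta> - a) * I1 ((\<beta> - a) * (b - \<beta>))) * ennreal (\<phi> \<beta>) \<partial>lborel)" .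
  have "ennreal (1 / 4) * Kop I0 (\<lambda>\<alpha> \<beta>. ennreal (1 / 2) * (ennreal (\<phi> \<alpha>) + ennreal (\<phi> \<beta>))) a b
    = ennreal (1 / 32) * (\<integral>\<^sup>+\<alpha>. \<integral>\<^sup>+\<beta>. lcone a b \<alpha> \<beta> * ennreal (I0 ((\<alpha> - a) * (b - \<beta>))) * (ennreal (\<phi> \<alpha>) + ennreal (\<phi> \<beta>)) \<partial>lborel \<partial>lborel)"
  proof -
    have m: "case_prod (\<lambda>\<alpha> \<beta>. ennreal (\<phi> \<alpha>) + ennreal (\<phi> \<beta>)) \<in> borel_measurable (borel \<Otimes>\<^sub>M borel)"
      by measurable
    show ?thesis
      by (simp only: Kop_cmult[OF I0_measurable m]) (simp only: Kop_def ennreal_4_2_4)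
  qed
  also have "\<dots> = ennreal (1 / 32) * ((\<integral>\<^sup>+\<alpha>. inside a b \<alpha> * ennreal (16 * (b - \<alpha>) * I1 ((\<alpha> - a) * (b - \<alpha>))) * ennreal (\<phi> \<alpha>) \<partial>lborel)
     + (\<integral>\<^sup>+\<beta>. inside a b \<beta> * ennreal (16 * (\<beta> - a) * I1 ((\<beta> - a) * (b - \<beta>))) * ennreal (\<phi> \<beta>) \<partial>lborel))"
    unfolding k1[symmetric] k2[symmetric] by (simp add: distrib_left nn_integral_add)
  also have "\<dots> = (\<integral>\<^sup>+y. ennreal (1 / 32) * (inside a b y * ennreal (16 * (b - y) * I1 ((y - a) * (b - y))) * ennreal (\<phi> y)
     + inside a b y * ennreal (16 * (y - a) * I1 ((y - a) * (b - y))) * ennreal (\<phi> y)) \<partial>lborel)"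
    by (simp add: nn_integral_cmult nn_integral_add)
  also have "\<dots> = (\<integral>\<^sup>+y. inside a b y * (ennreal ((b - a) / 2 * I1 ((y - a) * (b - y))) * ennreal (\<phi> y)) \<partial>lborel)"
  proof (intro nn_integral_cong)
    fix y
    show "ennreal (1 / 32) * (inside a b y * ennreal (16 * (b - y) * I1 ((y - a) * (b - y))) * ennreal (\<phi> y)
       + inside a b y * ennreal (16 * (y - a) * I1 ((y - a) * (b - y))) * ennreal (\<phi> y))
      = inside a b y * (ennreal ((b - a) / 2 * I1 ((y - a) * (b - y))) * ennreal (\<phi> y))"
    proof (cases "a \<le> y \<and> y \<le> b")
      case True
      define i where "i = I1 ((y - a) * (b - y))"
      have i: "i \<ge> 0" unfolding i_def using True by (intro I1_nonneg) simp
      have "ennreal (16 * (b - y) * i) + ennreal (16 * (y - a) * i) = ennreal (16 * (b - a) * i)"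
      proof -
        have "16 * (b - y) * i + 16 * (y - a) * i = 16 * (b - a) * i" by (simp add: algebra_simps)
        moreover have "ennreal (16 * (b - y) * i) + ennreal (16 * (y - a) * i) = ennreal (16 * (b - y) * i + 16 * (y - a) * i)"
          by (rule ennreal_plus[symmetric]) (use True i in auto)
        ultimately show ?thesis by (simp only:)
      qed
      moreover have "ennreal (1 / 32) * ennreal (16 * (b - a) * i) = ennreal ((b - a) / 2 * i)"
        using True i by (simp add: ennreal_mult[symmetric])
      ultimately have "ennreal (1 / 32) * ((ennreal (16 * (b - y) * i) + ennreal (16 * (y - a) * i)) * ennreal (\<phi> y)) = ennreal ((b - a) / 2 * i) * ennreal (\<phi> y)"
        by (simp only: mult.assoc[symmetric])
      then show ?thesis using True unfolding i_def[symmetric] by (simp add: inside_def distrib_right)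
    qed (auto simp: inside_def)
  qed
  finally show ?thesis .
qed

text \<open>In the original variables this is \<open>e\<^bsup>t/2\<^esup>\<close> times the linear part of the mild formulation.\<close>

lemma linear_solution_eq:
  assumes [measurable]: "\<phi> \<in> borel_measurable borel" "\<psi> \<in> borel_measurable borel"
  shows "linear_solution \<phi> \<psi> a b = ennreal (1 / 2) * (ennreal (\<phi> a) + ennreal (\<phi> b))
    + (\<integral>\<^sup>+y. inside a b y * (ennreal ((b - a) / 2 * I1 ((y - a) * (b - y))) * ennreal (\<phi> y)) \<partial>lborel)
    + ennreal (1 / 2) * (\<integral>\<^sup>+y. inside a b y * (ennreal (I0 ((y - a) * (b - y))) * ennreal (\<psi> y)) \<partial>lborel)"
proof -
  have "Kop I0 (free \<phi> \<psi>) a b = Kop I0 (\<lambda>\<alpha> \<beta>. ennreal (1 / 2) * (ennreal (\<phi> \<alpha>) + ennreal (\<phi> \<beta>))) a b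
     + Kop I0 (\<lambda>\<alpha> \<beta>. ennreal (1 / 2) * (\<integral>\<^sup>+y. inside \<alpha> \<beta> y * ennreal (\<psi> y) \<partial>lborel)) a b"
  proof -
    have m1: "case_prod (\<lambda>\<alpha> \<beta>. ennreal (1 / 2) * (ennreal (\<phi> \<alpha>) + ennreal (\<phi> \<beta>))) \<in> borel_measurable (borel \<Otimes>\<^sub>M borel)"
      by measurable
    have m2: "case_prod (\<lambda>\<alpha> \<beta>. ennreal (1 / 2) * (\<integral>\<^sup>+y. inside \<alpha> \<beta> y * ennreal (\<psi> y) \<partial>lborel)) \<in> borel_measurable (borel \<Otimes>\<^sub>M borel)"
      by measurable
    have "free \<phi> \<psi> = (\<lambda>\<alpha> \<beta>. ennreal (1 / 2) * (ennreal (\<phi> \<alpha>) + ennreal (\<phi> \<beta>)) + ennreal (1 / 2) * (\<integral>\<^sup>+y. inside \<alpha> \<beta> y * ennreal (\<psi> y) \<partial>lborel))"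
      by (intro ext) (simp only: free_def)
    then show ?thesis using Kop_add[OF I0_measurable m1 m2] by simp
  qed
  then show ?thesis
    unfolding linear_solution_def Kop_I0_boundary[symmetric, OF assms(1)] Kop_I0_source[symmetric, OF assms(2)] free_def
    by (simp add: distrib_left add_ac)
qed

lemma nn_integral_inside_le:
  assumes [measurable]: "f \<in> borel_measurable borel" "\<phi> \<in> borel_measurable borel"
    and "\<And>y. a \<le> y \<Longrightarrow> y \<le> b \<Longrightarrow> f y \<le> C"
  shows "(\<integral>\<^sup>+y. inside a b y * (ennreal (f y) * ennreal (\<phi> y)) \<partial>lborel) \<le> ennreal C * (\<integral>\<^sup>+y. inside a b y * ennreal (\<phi> y) \<partial>lborel)"
proof -
  have "(\<integral>\<^sup>+y. inside a b y * (ennreal (f y) * ennreal (\<phi> y)) \<partial>lborel) \<le> (\<integral>\<^sup>+y. ennreal C * (inside a b y * ennreal (\<phi> y)) \<partial>lborel)"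
    using assms(3) by (intro nn_integral_mono) (auto simp: inside_def intro!: mult_right_mono ennreal_leI)
  then show ?thesis by (simp add: nn_integral_cmult)
qed

text \<open>In the original variables this is
  \<open>t\<^sup>2 - (x - y)\<^sup>2 \<le> t\<^sup>2\<close>.\<close>

lemma mult_le_half_sum_square:
  fixes a b y :: real
  shows "(y - a) * (b - y) \<le> ((b - a) / 2)\<^sup>2"
proof -
  have "((b - a) / 2)\<^sup>2 - (y - a) * (b - y) = (y - (a + b) / 2)\<^sup>2" by (simp add: power2_eq_square algebra_simps) (simp add: field_simps)
  then show ?thesis by (metis diff_ge_0_iff_ge zero_le_power2)
qed

text \<open>The kernels increase in their argument and so are largest at the midpoint of the
  interval, where \<open>I0_square_le_exp\<close> and \<open>I1_square_le_exp\<close> apply with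
  \<open>t = (b - a) / 2\<close>.\<close>

lemma linear_solution_le:
  assumes [measurable]: "\<phi> \<in> borel_measurable borel" "\<psi> \<in> borel_measurable borel" and ab: "a \<le> b"
  shows "linear_solution \<phi> \<psi> a b \<le> ennreal (1 / 2) * (ennreal (\<phi> a) + ennreal (\<phi> b))
    + ennreal (exp ((b - a) / 4) / 4) * (\<integral>\<^sup>+y. inside a b y * ennreal (\<phi> y) \<partial>lborel)
    + ennreal (exp ((b - a) / 4) / 2) * (\<integral>\<^sup>+y. inside a b y * ennreal (\<psi> y) \<partial>lborel)"
proof -
  define t where "t = (b - a) / 2"
  have t: "t \<ge> 0" unfolding t_def using ab by simp
  have 1: "(\<integral>\<^sup>+y. inside a b y * (ennreal ((b - a) / 2 * I1 ((y - a) * (b - y))) * ennreal (\<phi> y)) \<partial>lborel)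
    \<le> ennreal (exp ((b - a) / 4) / 4) * (\<integral>\<^sup>+y. inside a b y * ennreal (\<phi> y) \<partial>lborel)"
  proof (rule nn_integral_inside_le)
    fix y assume y: "a \<le> y" "y \<le> b"
    have "t * I1 ((y - a) * (b - y)) \<le> t * I1 (t\<^sup>2)"
      using t y by (intro mult_left_mono I1_mono) (auto simp: t_def mult_le_half_sum_square)
    also have "\<dots> \<le> exp (t / 2) / 4" using I1_square_le_exp[OF t] by simp
    finally show "(b - a) / 2 * I1 ((y - a) * (b - y)) \<le> exp ((b - a) / 4) / 4" by (simp add: t_def)
  qed measurable
  have 2: "(\<integral>\<^sup>+y. inside a b y * (ennreal (I0 ((y - a) * (b - y))) * ennreal (\<psi> y)) \<partial>lborel)
    \<le> ennreal (exp ((b - a) / 4)) * (\<integral>\<^sup>+y. inside a b y * ennreal (\<psi> y) \<partial>lborel)"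
  proof (rule nn_integral_inside_le)
    fix y assume y: "a \<le> y" "y \<le> b"
    have "I0 ((y - a) * (b - y)) \<le> I0 (t\<^sup>2)"
      using y by (intro I0_mono) (auto simp: t_def mult_le_half_sum_square)
    then show "I0 ((y - a) * (b - y)) \<le> exp ((b - a) / 4)"
      using I0_square_le_exp[OF t] by (simp add: t_def)
  qed measurable
  have "ennreal (1 / 2) * (\<integral>\<^sup>+y. inside a b y * (ennreal (I0 ((y - a) * (b - y))) * ennreal (\<psi> y)) \<partial>lborel)
    \<le> ennreal (1 / 2) * (ennreal (exp ((b - a) / 4)) * (\<integral>\<^sup>+y. inside a b y * ennreal (\<psi> y) \<partial>lborel))"
    by (rule mult_left_mono[OF 2]) simp
  also have "\<dots> = ennreal (exp ((b - a) / 4) / 2) * (\<integral>\<^sup>+y. inside a b y * ennreal (\<psi> y) \<partial>lborel)"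
    by (subst ennreal_mult_mult) auto
  finally show ?thesis
    unfolding linear_solution_eq[OF assms(1,2)] using 1 by (intro add_mono) auto
qed

section \<open>Monotone iteration\<close>

text \<open>\<open>pm\<close> bounds the slope of \<open>s powr p\<close> on \<open>{0..m}\<close>
  by 1/4. The weights 1, 1/4 and 1/2 in \<open>small\<close> are those of
  \<open>linear_solution_le\<close> with the exponential factor taken out, so that
  \<open>lin_le\<close> follows.\<close>

locale small_data =
  fixes p m :: real and \<phi> \<psi> :: "real \<Rightarrow> real" and M :: real
  assumes p: "p > 1" and m: "m > 0" and pm: "p * m powr (p - 1) \<le> 1 / 4"
    and phi_nonneg: "\<And>x. 0 \<le> \<phi> x" and phi_le: "\<And>x. \<phi> x \<le> M" and phi_int: "integrable lborel \<phi>"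
    and psi_nonneg: "\<And>x. 0 \<le> \<psi> x" and psi_int: "integrable lborel \<psi>"
    and small: "M + (LINT x|lborel. \<phi> x) / 4 + (LINT x|lborel. \<psi> x) / 2 \<le> m"
begin

lemma phi_measurable [measurable]: "\<phi> \<in> borel_measurable borel" using phi_int by auto
lemma psi_measurable [measurable]: "\<psi> \<in> borel_measurable borel" using psi_int by auto

text \<open>The truncation at \<open>m\<close> makes the right-hand side of \<open>w\<^sub>t\<^sub>t - w\<^sub>x\<^sub>x = w/4 - e\<^bsup>t/2\<^esup> (e\<^bsup>-t/2\<^esup> w)\<^sup>p\<close> monotone in \<open>w \<ge> 0\<close>;
  it turns out to be inactive.\<close>

definition absorption :: "real \<Rightarrow> real \<Rightarrow> real" where
  "absorption t w = exp (t / 2) * (min (exp (- t / 2) * w) m) powr p"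

definition rhs :: "real \<Rightarrow> real \<Rightarrow> real" where
  "rhs t w = w / 4 - absorption t w"

lemma absorption_measurable [measurable]: "(\<lambda>(t, w). absorption t w) \<in> borel_measurable (borel \<Otimes>\<^sub>M borel)"
  unfolding absorption_def by measurable

lemma rhs_measurable [measurable]: "(\<lambda>(t, w). rhs t w) \<in> borel_measurable (borel \<Otimes>\<^sub>M borel)"
  unfolding rhs_def by measurable

lemma absorption_nonneg: "absorption t w \<ge> 0"
  unfolding absorption_def by simp

lemma powr_diff_le:
  assumes "0 \<le> x" "x \<le> y" "y \<le> m"
  shows "y powr p - x powr p \<le> (y - x) / 4"
proof (cases "x = y")
  case False
  then have xy: "x < y" using assms by simp
  have "continuous_on {x..y} (\<lambda>z. z powr p)"
    using p assms by (intro continuous_on_powr' continuous_intros) auto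
  then have "\<exists>z. x < z \<and> z < y \<and> y powr p - x powr p = (\<lambda>v. (p * z powr (p - 1)) * v) (y - x)"
  proof (rule mvt[OF xy])
    fix z assume "x < z" "z < y"
    then have "((\<lambda>z. z powr p) has_real_derivative p * z powr (p - 1)) (at z)"
      using assms by (auto intro!: derivative_eq_intros)
    then show "((\<lambda>z. z powr p) has_derivative (*) (p * z powr (p - 1))) (at z)"
      unfolding has_field_derivative_def .
  qed auto
  then have "\<exists>z. x < z \<and> z < y \<and> y powr p - x powr p = (y - x) * (p * z powr (p - 1))"
    by (simp add: mult.commute)
  then obtain z where z: "x < z" "z < y" "y powr p - x powr p = (y - x) * (p * z powr (p - 1))" by blast
  have "p * z powr (p - 1) \<le> p * m powr (p - 1)"
    using z assms p by (intro mult_left_mono powr_mono2) auto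
  then have "p * z powr (p - 1) \<le> 1 / 4" using pm by simp
  then have "(y - x) * (p * z powr (p - 1)) \<le> (y - x) * (1 / 4)" using xy by (intro mult_left_mono) auto
  then show ?thesis unfolding z(3) by simp
qed simp

text \<open>After rescaling by the exponential weight, truncation at \<open>m\<close> is
  nondecreasing and 1-Lipschitz, and below \<open>m\<close> the power has slope at most 1/4. The
  linear term therefore compensates the absorption.\<close>

lemma rhs_mono:
  assumes "0 \<le> w" "w \<le> w'"
  shows "rhs t w \<le> rhs t w'"
proof -
  define v v' where "v = exp (- t / 2) * w" and "v' = exp (- t / 2) * w'"
  have v: "0 \<le> v" "v \<le> v'" unfolding v_def v'_def using assms by auto
  have "(min v' m) powr p - (min v m) powr p \<le> (min v' m - min v m) / 4"
    using v m by (intro powr_diff_le) auto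
  also have "\<dots> \<le> (v' - v) / 4" using v by auto
  finally have "v / 4 - (min v m) powr p \<le> v' / 4 - (min v' m) powr p" by (simp add: field_simps)
  then have "exp (t / 2) * (v / 4 - (min v m) powr p) \<le> exp (t / 2) * (v' / 4 - (min v' m) powr p)"
    by (intro mult_left_mono) auto
  moreover have "exp (t / 2) * v = w" "exp (t / 2) * v' = w'"
    unfolding v_def v'_def by (simp_all add: mult.assoc[symmetric] flip: exp_add)
  ultimately show ?thesis
    unfolding rhs_def absorption_def v_def[symmetric] v'_def[symmetric] by (simp add: right_diff_distrib)
qed

lemma rhs_0: "rhs t 0 = 0"
  unfolding rhs_def absorption_def using m by simp

lemma rhs_nonneg: "0 \<le> w \<Longrightarrow> 0 \<le> rhs t w"
  using rhs_mono[of 0 w t] rhs_0 by simp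

lemma rhs_le: "rhs t w \<le> w / 4"
  unfolding rhs_def using absorption_nonneg[of t w] by simp

lemma rhs_continuous: "continuous_on {0..} (rhs t)"
  unfolding rhs_def absorption_def using p m
  by (intro continuous_intros continuous_on_powr') (auto intro: less_imp_le)

text \<open>At infinite values \<open>enn2real\<close> returns 0 and hence \<open>rhs'\<close> is 0.
  The upper bound \<open>rhs'_le\<close> survives this, whereas \<open>rhs'_mono\<close> has to ask
  for a finite upper function.\<close>

definition rhs' :: "(real \<Rightarrow> real \<Rightarrow> ennreal) \<Rightarrow> real \<Rightarrow> real \<Rightarrow> ennreal" where
  "rhs' V \<alpha> \<beta> = ennreal (rhs ((\<beta> - \<alpha>) / 2) (enn2real (V \<alpha> \<beta>)))"

lemma rhs'_measurable [measurable]: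
  assumes [measurable]: "case_prod V \<in> borel_measurable (borel \<Otimes>\<^sub>M borel)"
  shows "case_prod (rhs' V) \<in> borel_measurable (borel \<Otimes>\<^sub>M borel)"
proof -
  have "(\<lambda>z. (\<lambda>(t, w). rhs t w) ((snd z - fst z) / 2, enn2real (case_prod V z))) \<in> borel_measurable (borel \<Otimes>\<^sub>M borel)"
    by measurable
  then show ?thesis unfolding rhs'_def by (simp add: case_prod_beta')
qed

lemma rhs'_le: "rhs' V \<alpha> \<beta> \<le> ennreal (1 / 4) * V \<alpha> \<beta>"
proof (cases "V \<alpha> \<beta> = \<infinity>")
  case True
  then show ?thesis by (simp add: rhs'_def rhs_0)
next
  case False
  then obtain r where r: "V \<alpha> \<beta> = ennreal r" "r \<ge> 0" by (cases "V \<alpha> \<beta>") auto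
  then show ?thesis
    unfolding rhs'_def using rhs_le[of "(\<beta> - \<alpha>) / 2" r] by (auto simp: ennreal_mult[symmetric] intro!: ennreal_leI)
qed

lemma rhs'_mono:
  assumes "V \<alpha> \<beta> \<le> V' \<alpha> \<beta>" "V' \<alpha> \<beta> < \<infinity>"
  shows "rhs' V \<alpha> \<beta> \<le> rhs' V' \<alpha> \<beta>"
  unfolding rhs'_def using assms by (intro ennreal_leI rhs_mono enn2real_mono) auto

abbreviation "lin \<equiv> linear_solution \<phi> \<psi>"

primrec iterate :: "nat \<Rightarrow> real \<Rightarrow> real \<Rightarrow> ennreal" where
  "iterate 0 = (\<lambda>a b. 0)"
| "iterate (Suc n) = (\<lambda>a b. free \<phi> \<psi> a b + Eop (rhs' (iterate n)) a b)"

lemma iterate_measurable [measurable]: "case_prod (iterate n) \<in> borel_measurable (borel \<Otimes>\<^sub>M borel)"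
proof (induction n)
  case (Suc n)
  note Suc [measurable]
  have [measurable]: "case_prod (Eop (rhs' (iterate n))) \<in> borel_measurable (borel \<Otimes>\<^sub>M borel)"
    by (intro Kop_measurable rhs'_measurable Suc) simp
  show ?case by simp
qed simp

lemma Eop_quarter:
  assumes "case_prod V \<in> borel_measurable (borel \<Otimes>\<^sub>M borel)"
  shows "Eop (\<lambda>\<alpha> \<beta>. ennreal (1 / 4) * V \<alpha> \<beta>) a b = ennreal (1 / 4) * Eop V a b"
  using Kop_cmult[OF _ assms] by simp

text \<open>The source of an iterate is at most a quarter of the iterate, and \<open>lin\<close> is
  the fixed point with source exactly one quarter of itself; comparison propagates by monotonicity
  of \<open>Eop\<close>.\<close>

lemma iterate_le_lin: "iterate n a b \<le> lin a b"
proof (induction n arbitrary: a b)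
  case (Suc n)
  have "Eop (rhs' (iterate n)) a b \<le> Eop (\<lambda>\<alpha> \<beta>. ennreal (1 / 4) * lin \<alpha> \<beta>) a b"
    by (intro Kop_mono order_trans[OF rhs'_le] mult_left_mono Suc) simp
  also have "\<dots> = ennreal (1 / 4) * Eop lin a b"
    by (intro Eop_quarter linear_solution_measurable) auto
  finally show ?case
    by (subst linear_solution_fixed_point) (auto intro: add_left_mono)
qed simp

lemma data_bounds:
  "(\<integral>\<^sup>+y. inside a b y * ennreal (\<phi> y) \<partial>lborel) \<le> ennreal (LINT x|lborel. \<phi> x)"
  "(\<integral>\<^sup>+y. inside a b y * ennreal (\<psi> y) \<partial>lborel) \<le> ennreal (LINT x|lborel. \<psi> x)"
proof -
  have "(\<integral>\<^sup>+y. inside a b y * ennreal (\<phi> y) \<partial>lborel) \<le> (\<integral>\<^sup>+y. ennreal (\<phi> y) \<partial>lborel)"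
    by (intro nn_integral_mono) (auto simp: inside_def)
  then show "(\<integral>\<^sup>+y. inside a b y * ennreal (\<phi> y) \<partial>lborel) \<le> ennreal (LINT x|lborel. \<phi> x)"
    using nn_integral_eq_integral[OF phi_int] phi_nonneg by simp
  have "(\<integral>\<^sup>+y. inside a b y * ennreal (\<psi> y) \<partial>lborel) \<le> (\<integral>\<^sup>+y. ennreal (\<psi> y) \<partial>lborel)"
    by (intro nn_integral_mono) (auto simp: inside_def)
  then show "(\<integral>\<^sup>+y. inside a b y * ennreal (\<psi> y) \<partial>lborel) \<le> ennreal (LINT x|lborel. \<psi> x)"
    using nn_integral_eq_integral[OF psi_int] psi_nonneg by simp
qed

text \<open>For \<open>a \<le> b\<close> the data assumption \<open>small\<close> absorbs all three
  terms, as the boundary term only gains from the factor \<open>e \<ge> 1\<close>. For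
  \<open>b < a\<close> the cone is empty and only the boundary term remains; the absolute value
  makes one bound serve both cases.\<close>

lemma lin_le: "lin a b \<le> ennreal (m * exp (\<bar>b - a\<bar> / 4))"
proof (cases "a \<le> b")
  case True
  define e where "e = exp ((b - a) / 4)"
  have e: "e \<ge> 1" unfolding e_def using True by simp
  have M: "M \<ge> 0" using phi_nonneg phi_le order_trans by blast
  define P Q where "P = (LINT x|lborel. \<phi> x)" and "Q = (LINT x|lborel. \<psi> x)"
  have PQ: "P \<ge> 0" "Q \<ge> 0" unfolding P_def Q_def using phi_nonneg psi_nonneg by auto
  have "lin a b \<le> ennreal (1 / 2) * (ennreal (\<phi> a) + ennreal (\<phi> b))
    + ennreal (e / 4) * (\<integral>\<^sup>+y. inside a b y * ennreal (\<phi> y) \<partial>lborel)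
    + ennreal (e / 2) * (\<integral>\<^sup>+y. inside a b y * ennreal (\<psi> y) \<partial>lborel)"
    unfolding e_def using True by (intro linear_solution_le) auto
  also have "\<dots> \<le> ennreal (1 / 2) * (ennreal M + ennreal M) + ennreal (e / 4) * ennreal P + ennreal (e / 2) * ennreal Q"
    unfolding P_def Q_def using phi_le by (intro add_mono mult_left_mono data_bounds ennreal_leI) auto
  also have "\<dots> = ennreal (M + e / 4 * P + e / 2 * Q)"
  proof -
    have "ennreal (1 / 2) * (ennreal M + ennreal M) = ennreal (1 / 2 * (M + M))"
      using M by (simp only: ennreal_plus ennreal_mult)
    moreover have "ennreal (e / 4) * ennreal P = ennreal (e / 4 * P)" "ennreal (e / 2) * ennreal Q = ennreal (e / 2 * Q)"
      using e PQ by (simp_all only: ennreal_mult)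
    ultimately show ?thesis using M e PQ by simp
  qed
  also have "\<dots> \<le> ennreal (m * e)"
  proof (rule ennreal_leI)
    have "M \<le> M * e" using M e by (simp add: mult_le_cancel_left1)
    then have "M + e / 4 * P + e / 2 * Q \<le> (M + P / 4 + Q / 2) * e" by (simp add: algebra_simps)
    also have "\<dots> \<le> m * e" using small e unfolding P_def Q_def by (intro mult_right_mono) auto
    finally show "M + e / 4 * P + e / 2 * Q \<le> m * e" .
  qed
  finally show ?thesis using True by (simp add: e_def)
next
  case False
  have M: "0 \<le> M" using phi_nonneg phi_le order_trans by blast
  have "lin a b = ennreal (1 / 2) * (ennreal (\<phi> a) + ennreal (\<phi> b))"
  proof -
    have z: "inside a b y = 0" for y using False by (auto simp: inside_def)
    show ?thesis by (subst linear_solution_eq) (auto simp: z)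
  qed
  also have "\<dots> \<le> ennreal (1 / 2) * (ennreal M + ennreal M)"
    using phi_le by (intro add_mono mult_left_mono ennreal_leI) auto
  also have "\<dots> = ennreal (1 / 2 * (M + M))"
    using M by (simp only: ennreal_plus ennreal_mult)
  also have "\<dots> \<le> ennreal (m * exp (\<bar>b - a\<bar> / 4))"
  proof (rule ennreal_leI)
    have "(LINT x|lborel. \<phi> x) \<ge> 0" "(LINT x|lborel. \<psi> x) \<ge> 0" using phi_nonneg psi_nonneg by auto
    then have "M \<le> m" using small by linarith
    also have "m \<le> m * exp (\<bar>b - a\<bar> / 4)" using m by simp
    finally show "1 / 2 * (M + M) \<le> m * exp (\<bar>b - a\<bar> / 4)" by simp
  qed
  finally show ?thesis .
qed

lemma lin_finite: "lin a b < \<infinity>"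
  using lin_le[of a b] by (simp add: le_less_trans ennreal_less_top)

lemma iterate_finite: "iterate n a b < \<infinity>"
  using iterate_le_lin lin_finite le_less_trans by blast

lemma iterate_mono: "iterate n a b \<le> iterate (Suc n) a b"
proof (induction n arbitrary: a b)
  case (Suc n)
  have "Eop (rhs' (iterate n)) a b \<le> Eop (rhs' (iterate (Suc n))) a b"
    by (intro Kop_mono rhs'_mono Suc iterate_finite)
  then have "free \<phi> \<psi> a b + Eop (rhs' (iterate n)) a b \<le> free \<phi> \<psi> a b + Eop (rhs' (iterate (Suc n))) a b"
    by (rule add_left_mono)
  then show ?case by (simp only: iterate.simps)
qed simp

lemma incseq_iterate: "incseq (\<lambda>n. iterate n a b)"
  by (intro incseq_SucI iterate_mono)

definition sol :: "real \<Rightarrow> real \<Rightarrow> ennreal" where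
  "sol a b = (SUP n. iterate n a b)"

lemma sol_measurable [measurable]: "case_prod sol \<in> borel_measurable (borel \<Otimes>\<^sub>M borel)"
proof -
  have "case_prod sol = (\<lambda>z. SUP n. case_prod (iterate n) z)"
    by (auto simp: sol_def fun_eq_iff)
  then show ?thesis by simp
qed

lemma sol_le_lin: "sol a b \<le> lin a b"
  unfolding sol_def by (intro SUP_least iterate_le_lin)

lemma sol_finite: "sol a b < \<infinity>"
  using sol_le_lin lin_finite le_less_trans by blast

text \<open>The same sequence has two limits: its supremum, by monotonicity, and
  \<open>rhs' sol\<close>, by continuity of \<open>rhs\<close>. Finiteness of \<open>sol\<close>
  lets the limit pass through \<open>enn2real\<close>.\<close>

lemma rhs'_sol: "rhs' sol \<alpha> \<beta> = (SUP n. rhs' (iterate n) \<alpha> \<beta>)"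
proof (rule LIMSEQ_unique)
  have "incseq (\<lambda>n. rhs' (iterate n) \<alpha> \<beta>)"
    by (intro incseq_SucI rhs'_mono iterate_mono iterate_finite)
  then show "(\<lambda>n. rhs' (iterate n) \<alpha> \<beta>) \<longlonglongrightarrow> (SUP n. rhs' (iterate n) \<alpha> \<beta>)"
    by (rule LIMSEQ_SUP)
  have "(\<lambda>n. iterate n \<alpha> \<beta>) \<longlonglongrightarrow> sol \<alpha> \<beta>"
    unfolding sol_def by (intro LIMSEQ_SUP incseq_iterate)
  then have "(\<lambda>n. iterate n \<alpha> \<beta>) \<longlonglongrightarrow> ennreal (enn2real (sol \<alpha> \<beta>))"
    using sol_finite[of \<alpha> \<beta>] by simp
  then have "(\<lambda>n. enn2real (iterate n \<alpha> \<beta>)) \<longlonglongrightarrow> enn2real (sol \<alpha> \<beta>)"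
    by (rule tendsto_enn2real) simp
  then have "(\<lambda>n. rhs ((\<beta> - \<alpha>) / 2) (enn2real (iterate n \<alpha> \<beta>))) \<longlonglongrightarrow> rhs ((\<beta> - \<alpha>) / 2) (enn2real (sol \<alpha> \<beta>))"
    by (intro continuous_on_tendsto_compose[OF rhs_continuous]) auto
  then show "(\<lambda>n. rhs' (iterate n) \<alpha> \<beta>) \<longlonglongrightarrow> rhs' sol \<alpha> \<beta>"
    unfolding rhs'_def by (intro tendsto_ennrealI)
qed

lemma Eop_SUP:
  assumes [measurable]: "\<And>n. case_prod (V n) \<in> borel_measurable (borel \<Otimes>\<^sub>M borel)"
    and inc: "\<And>\<alpha> \<beta>. incseq (\<lambda>n. V n \<alpha> \<beta>)"
  shows "Eop (\<lambda>\<alpha> \<beta>. SUP n. V n \<alpha> \<beta>) a b = (SUP n. Eop (V n) a b)"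
proof -
  have inc1: "incseq (\<lambda>n. \<lambda>\<beta>. lcone a b \<alpha> \<beta> * V n \<alpha> \<beta>)" for \<alpha>
    using inc by (auto simp: incseq_def le_fun_def intro!: mult_left_mono)
  then have inc2: "incseq (\<lambda>n. \<lambda>\<alpha>. \<integral>\<^sup>+\<beta>. lcone a b \<alpha> \<beta> * V n \<alpha> \<beta> \<partial>lborel)"
    by (auto simp: incseq_def le_fun_def intro!: nn_integral_mono)
  have "Eop (\<lambda>\<alpha> \<beta>. SUP n. V n \<alpha> \<beta>) a b = ennreal (1 / 4) * (\<integral>\<^sup>+\<alpha>. \<integral>\<^sup>+\<beta>. (SUP n. lcone a b \<alpha> \<beta> * V n \<alpha> \<beta>) \<partial>lborel \<partial>lborel)"
    unfolding Kop_def by (simp add: SUP_mult_left_ennreal)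
  also have "\<dots> = ennreal (1 / 4) * (\<integral>\<^sup>+\<alpha>. (SUP n. \<integral>\<^sup>+\<beta>. lcone a b \<alpha> \<beta> * V n \<alpha> \<beta> \<partial>lborel) \<partial>lborel)"
    by (intro arg_cong[where f="\<lambda>x. _ * x"] nn_integral_cong nn_integral_monotone_convergence_SUP inc1) auto
  also have "\<dots> = ennreal (1 / 4) * (SUP n. \<integral>\<^sup>+\<alpha>. \<integral>\<^sup>+\<beta>. lcone a b \<alpha> \<beta> * V n \<alpha> \<beta> \<partial>lborel \<partial>lborel)"
    by (intro arg_cong[where f="\<lambda>x. _ * x"] nn_integral_monotone_convergence_SUP inc2) auto
  also have "\<dots> = (SUP n. Eop (V n) a b)"
    unfolding Kop_def by (simp add: SUP_mult_left_ennreal)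
  finally show ?thesis .
qed

lemma sol_fixed_point: "sol a b = free \<phi> \<psi> a b + Eop (rhs' sol) a b"
proof (rule LIMSEQ_unique)
  have inc: "incseq (\<lambda>n. rhs' (iterate n) \<alpha> \<beta>)" for \<alpha> \<beta>
    by (intro incseq_SucI rhs'_mono iterate_mono iterate_finite)
  have "rhs' sol = (\<lambda>\<alpha> \<beta>. SUP n. rhs' (iterate n) \<alpha> \<beta>)" by (intro ext rhs'_sol)
  then have "Eop (rhs' sol) a b = (SUP n. Eop (rhs' (iterate n)) a b)"
    using Eop_SUP[OF _ inc] by simp
  moreover have "incseq (\<lambda>n. Eop (rhs' (iterate n)) a b)"
    using inc by (auto simp: incseq_def intro!: Kop_mono)
  ultimately have "(\<lambda>n. Eop (rhs' (iterate n)) a b) \<longlonglongrightarrow> Eop (rhs' sol) a b"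
    using LIMSEQ_SUP by simp
  then show "(\<lambda>n. iterate (Suc n) a b) \<longlonglongrightarrow> free \<phi> \<psi> a b + Eop (rhs' sol) a b"
    unfolding iterate.simps by (intro tendsto_add tendsto_const)
  show "(\<lambda>n. iterate (Suc n) a b) \<longlonglongrightarrow> sol a b"
    unfolding sol_def by (intro LIMSEQ_Suc LIMSEQ_SUP incseq_iterate)
qed

text \<open>What \<open>rhs'\<close> takes away from a quarter of \<open>sol\<close>; by
  \<open>absorbed_eq\<close> it becomes the source of the Duhamel term.\<close>

definition absorbed :: "real \<Rightarrow> real \<Rightarrow> ennreal" where
  "absorbed \<alpha> \<beta> = ennreal (absorption ((\<beta> - \<alpha>) / 2) (enn2real (sol \<alpha> \<beta>)))"

lemma absorbed_measurable [measurable]: "case_prod absorbed \<in> borel_measurable (borel \<Otimes>\<^sub>M borel)"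
proof -
  have "(\<lambda>z. (\<lambda>(t, w). absorption t w) ((snd z - fst z) / 2, enn2real (case_prod sol z))) \<in> borel_measurable (borel \<Otimes>\<^sub>M borel)"
    by measurable
  then show ?thesis unfolding absorbed_def by (simp add: case_prod_beta')
qed

lemma rhs'_plus_absorbed: "rhs' sol \<alpha> \<beta> + absorbed \<alpha> \<beta> = ennreal (1 / 4) * sol \<alpha> \<beta>"
proof -
  obtain r where r: "sol \<alpha> \<beta> = ennreal r" "r \<ge> 0" using sol_finite[of \<alpha> \<beta>] by (cases "sol \<alpha> \<beta>") auto
  then show ?thesis
    unfolding rhs'_def absorbed_def using rhs_nonneg[of r] absorption_nonneg
    by (simp add: ennreal_plus[symmetric] ennreal_mult[symmetric] rhs_def del: ennreal_plus)
qed

text \<open>The cone is bounded and the kernel on it is at most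
  \<open>I0 ((b - a) * (b - a))\<close>. Finiteness is what permits cancellation in
  \<open>sol_plus_duhamel\<close>.\<close>

lemma Kop_I0_finite:
  assumes "\<And>\<alpha> \<beta>. a \<le> \<alpha> \<Longrightarrow> \<alpha> \<le> \<beta> \<Longrightarrow> \<beta> \<le> b \<Longrightarrow> g \<alpha> \<beta> \<le> ennreal B"
  shows "Kop I0 g a b < \<infinity>"
proof -
  have "(\<integral>\<^sup>+\<alpha>. \<integral>\<^sup>+\<beta>. lcone a b \<alpha> \<beta> * ennreal (I0 ((\<alpha> - a) * (b - \<beta>))) * g \<alpha> \<beta> \<partial>lborel \<partial>lborel)
    \<le> (\<integral>\<^sup>+\<alpha>. \<integral>\<^sup>+\<beta>. (ennreal (I0 ((b - a) * (b - a))) * ennreal B * indicator {a..b} \<alpha>) * indicator {a..b} \<beta> \<partial>lborel \<partial>lborel)"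
  proof (intro nn_integral_mono)
    fix \<alpha> \<beta>
    show "lcone a b \<alpha> \<beta> * ennreal (I0 ((\<alpha> - a) * (b - \<beta>))) * g \<alpha> \<beta>
      \<le> (ennreal (I0 ((b - a) * (b - a))) * ennreal B * indicator {a..b} \<alpha>) * indicator {a..b} \<beta>"
    proof (cases "a \<le> \<alpha> \<and> \<alpha> \<le> \<beta> \<and> \<beta> \<le> b")
      case True
      have "ennreal (I0 ((\<alpha> - a) * (b - \<beta>))) * g \<alpha> \<beta> \<le> ennreal (I0 ((b - a) * (b - a))) * ennreal B"
        using True assms by (intro mult_mono ennreal_leI I0_mono) auto
      then show ?thesis using True by (simp add: lcone_def)
    qed (auto simp: lcone_def)
  qed
  also have "\<dots> < \<infinity>"
    by (simp add: nn_integral_cmult nn_integral_multc ennreal_mult_less_top emeasure_lborel_Icc_eq ennreal_less_top)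
  finally show ?thesis unfolding Kop_def by (simp add: ennreal_mult_less_top)
qed

text \<open>Apply \<open>K\<close> to the fixed point equation and use the resolvent identity.\<close>

lemma sol_plus_duhamel: "sol a b + Kop I0 absorbed a b = lin a b"
proof -
  note mI = I0_measurable
  have m1: "(\<lambda>_. 1::real) \<in> borel_measurable borel" by simp
  have mf: "case_prod (free \<phi> \<psi>) \<in> borel_measurable (borel \<Otimes>\<^sub>M borel)" by measurable
  note ms = sol_measurable and ma = absorbed_measurable
  have mr: "case_prod (rhs' sol) \<in> borel_measurable (borel \<Otimes>\<^sub>M borel)" by measurable
  have mq: "case_prod (\<lambda>\<alpha> \<beta>. ennreal (1 / 4) * sol \<alpha> \<beta>) \<in> borel_measurable (borel \<Otimes>\<^sub>M borel)" by measurable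
  have mE: "case_prod (Eop V) \<in> borel_measurable (borel \<Otimes>\<^sub>M borel)" if "case_prod V \<in> borel_measurable (borel \<Otimes>\<^sub>M borel)" for V
    using Kop_measurable[OF m1 that] .
  have mqE: "case_prod (\<lambda>\<alpha> \<beta>. ennreal (1 / 4) * Eop sol \<alpha> \<beta>) \<in> borel_measurable (borel \<Otimes>\<^sub>M borel)"
    using mE[OF ms] by measurable
  \<comment> \<open>The absorption is moved to the left of the fixed point equation, so that only
    sums of nonnegative terms occur.\<close>
  have eq: "sol \<alpha> \<beta> + Eop absorbed \<alpha> \<beta> = free \<phi> \<psi> \<alpha> \<beta> + ennreal (1 / 4) * Eop sol \<alpha> \<beta>" for \<alpha> \<beta>
  proof -
    have "sol \<alpha> \<beta> + Eop absorbed \<alpha> \<beta> = free \<phi> \<psi> \<alpha> \<beta> + (Eop (rhs' sol) \<alpha> \<beta> + Eop absorbed \<alpha> \<beta>)"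
      by (subst sol_fixed_point) (simp only: add.assoc)
    also have "Eop (rhs' sol) \<alpha> \<beta> + Eop absorbed \<alpha> \<beta> = ennreal (1 / 4) * Eop sol \<alpha> \<beta>"
      using Kop_add[OF m1 mr ma] Kop_cmult[OF m1 ms] by (simp add: rhs'_plus_absorbed)
    finally show ?thesis .
  qed
  have K1: "Kop I0 sol a b + Kop I0 (Eop absorbed) a b = Kop I0 (free \<phi> \<psi>) a b + ennreal (1 / 4) * Kop I0 (Eop sol) a b"
    using Kop_add[OF mI ms mE[OF ma], of a b] Kop_add[OF mI mf mqE, of a b] Kop_cmult[OF mI mE[OF ms], of "ennreal (1 / 4)" a b]
    by (simp only: eq)
  have fin: "Kop I0 V a b < \<infinity>" if V: "\<And>\<alpha> \<beta>. V \<alpha> \<beta> \<le> lin \<alpha> \<beta>" for V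
  proof (rule Kop_I0_finite)
    fix \<alpha> \<beta> assume *: "a \<le> \<alpha>" "\<alpha> \<le> \<beta>" "\<beta> \<le> b"
    have "V \<alpha> \<beta> \<le> ennreal (m * exp (\<bar>\<beta> - \<alpha>\<bar> / 4))" using V lin_le order_trans by blast
    also have "\<dots> \<le> ennreal (m * exp ((b - a) / 4))" using * m by (intro ennreal_leI) auto
    finally show "V \<alpha> \<beta> \<le> ennreal (m * exp ((b - a) / 4))" .
  qed
  have absl: "absorbed \<alpha> \<beta> \<le> lin \<alpha> \<beta>" for \<alpha> \<beta>
  proof -
    have "absorbed \<alpha> \<beta> \<le> ennreal (1 / 4) * sol \<alpha> \<beta>" using rhs'_plus_absorbed[of \<alpha> \<beta>] by (metis add_increasing order_refl zero_le)
    also have "\<dots> \<le> 1 * lin \<alpha> \<beta>" by (intro mult_mono sol_le_lin) (auto simp: ennreal_le_1)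
    finally show ?thesis by simp
  qed
  have freel: "free \<phi> \<psi> \<alpha> \<beta> \<le> lin \<alpha> \<beta>" for \<alpha> \<beta>
    unfolding linear_solution_def by simp
  have EK: "4 * Eop V a b + Kop I0 (Eop V) a b = 4 * Kop I0 V a b"
    if "case_prod V \<in> borel_measurable (borel \<Otimes>\<^sub>M borel)" for V
    using Kop_I0_Eop[OF that] .
  \<comment> \<open>Every quantity is finite, so the rest is linear algebra over the reals.\<close>
  obtain s where s: "sol a b = ennreal s" "s \<ge> 0" using sol_finite[of a b] by (cases "sol a b") auto
  obtain l where l: "lin a b = ennreal l" "l \<ge> 0" using lin_finite[of a b] by (cases "lin a b") auto
  obtain f where f: "free \<phi> \<psi> a b = ennreal f" "f \<ge> 0"
    using le_less_trans[OF freel lin_finite, of a b] by (cases "free \<phi> \<psi> a b") auto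
  obtain ks where ks: "Kop I0 sol a b = ennreal ks" "ks \<ge> 0"
    using fin[OF sol_le_lin] by (cases "Kop I0 sol a b") auto
  obtain ka where ka: "Kop I0 absorbed a b = ennreal ka" "ka \<ge> 0"
    using fin[OF absl] by (cases "Kop I0 absorbed a b") auto
  obtain kf where kf: "Kop I0 (free \<phi> \<psi>) a b = ennreal kf" "kf \<ge> 0"
    using fin[OF freel] by (cases "Kop I0 (free \<phi> \<psi>) a b") auto
  have fE: "Eop V a b < \<infinity> \<and> Kop I0 (Eop V) a b < \<infinity>"
    if "case_prod V \<in> borel_measurable (borel \<Otimes>\<^sub>M borel)" "Kop I0 V a b < \<infinity>" for V
  proof -
    have "4 * Eop V a b + Kop I0 (Eop V) a b < \<infinity>" unfolding EK[OF that(1)] using that(2) by (simp add: ennreal_mult_less_top)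
    then show ?thesis by (auto simp: ennreal_mult_less_top)
  qed
  obtain es where es: "Eop sol a b = ennreal es" "es \<ge> 0"
    using fE[OF ms fin[OF sol_le_lin]] by (cases "Eop sol a b") auto
  obtain ea where ea: "Eop absorbed a b = ennreal ea" "ea \<ge> 0"
    using fE[OF ma fin[OF absl]] by (cases "Eop absorbed a b") auto
  obtain kes where kes: "Kop I0 (Eop sol) a b = ennreal kes" "kes \<ge> 0"
    using fE[OF ms fin[OF sol_le_lin]] by (cases "Kop I0 (Eop sol) a b") auto
  obtain kea where kea: "Kop I0 (Eop absorbed) a b = ennreal kea" "kea \<ge> 0"
    using fE[OF ma fin[OF absl]] by (cases "Kop I0 (Eop absorbed) a b") auto
  have q: "ennreal (1 / 4) * ennreal x = ennreal (x / 4)" "4 * ennreal x = ennreal (4 * x)" if "x \<ge> 0" for x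
    using that by (simp_all add: ennreal_mult[symmetric] ennreal_mult)
  have r1: "s + ea = f + es / 4"
    using eq[of a b] s ea f es by (simp add: q ennreal_plus[symmetric] del: ennreal_plus)
  have r2: "ks + kea = kf + kes / 4"
    using K1 ks kea kf kes by (simp add: q ennreal_plus[symmetric] del: ennreal_plus)
  have r3: "4 * es + kes = 4 * ks"
    using EK[OF ms] es kes ks by (simp add: q ennreal_plus[symmetric] del: ennreal_plus)
  have r4: "4 * ea + kea = 4 * ka"
    using EK[OF ma] ea kea ka by (simp add: q ennreal_plus[symmetric] del: ennreal_plus)
  have r5: "l = f + kf / 4"
    using l(1) f kf l(2) unfolding linear_solution_def by (simp add: q ennreal_plus[symmetric] del: ennreal_plus)
  \<comment> \<open>\<open>r3\<close> and \<open>r4\<close> eliminate \<open>kes\<close> and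
    \<open>kea\<close> from \<open>r2\<close>, where \<open>ks\<close> then cancels; a quarter of
    the result added to \<open>r1\<close> is the claim by \<open>r5\<close>.\<close>
  have "s + ka = l" using r1 r2 r3 r4 r5 by argo
  then show ?thesis using s ka l by (simp add: ennreal_plus[symmetric] del: ennreal_plus)
qed

end

section \<open>Regularity of solutions of the wave equation\<close>

text \<open>Interpolation between \<open>L^1\<close> and bounded functions; through it the sup and
  \<open>L^1\<close> bounds of the source control every \<open>L^q\<close>.\<close>

lemma Lpow_bounded_le:
  assumes "q \<ge> 1" "\<And>x. 0 \<le> f x" "\<And>x. f x \<le> K" and [measurable]: "f \<in> borel_measurable borel"
  shows "Lpow q f \<le> ennreal (K powr (q - 1)) * Lpow 1 f"
proof -
  have "Lpow q f \<le> (\<integral>\<^sup>+x. ennreal (K powr (q - 1)) * ennreal \<bar>f x\<bar> \<partial>lborel)"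
    unfolding Lpow_def
  proof (intro nn_integral_mono)
    fix x
    have "\<bar>f x\<bar> powr q \<le> K powr (q - 1) * \<bar>f x\<bar>"
    proof (cases "f x = 0")
      case False
      then have "f x > 0" using assms(2)[of x] by simp
      then have "\<bar>f x\<bar> powr q = f x powr (q - 1) * f x" by (simp add: powr_diff)
      also have "\<dots> \<le> K powr (q - 1) * f x"
        using assms \<open>f x > 0\<close> by (intro mult_right_mono powr_mono2) auto
      finally show ?thesis using \<open>f x > 0\<close> by simp
    qed simp
    then show "ennreal (\<bar>f x\<bar> powr q) \<le> ennreal (K powr (q - 1)) * ennreal \<bar>f x\<bar>"
      by (simp add: ennreal_mult[symmetric] ennreal_leI)
  qed
  also have "\<dots> = ennreal (K powr (q - 1)) * Lpow 1 f" unfolding Lpow_1 by (rule nn_integral_cmult) simp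
  finally show ?thesis .
qed

lemma integrable_bounded_box:
  fixes f :: "real \<Rightarrow> real \<Rightarrow> real"
  assumes [measurable]: "case_prod f \<in> borel_measurable (borel \<Otimes>\<^sub>M borel)"
    and "\<And>x y. \<bar>f x y\<bar> \<le> B * (indicator {a..b} x * indicator {c..d} y)"
  shows "integrable (lborel \<Otimes>\<^sub>M lborel) (\<lambda>(x, y). f x y)"
proof (rule Bochner_Integration.integrable_bound)
  have i: "integrable lborel (indicator {a..b} :: real \<Rightarrow> real)" for a b :: real
    by (intro integrable_real_indicator) (auto simp: emeasure_lborel_Icc_eq)
  show "integrable (lborel \<Otimes>\<^sub>M lborel) (\<lambda>z. B * (indicator {a..b} (fst z) * indicator {c..d} (snd z) :: real))"
    by (intro integrable_mult_right integrable_mult_pair i)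
  show "(\<lambda>(x, y). f x y) \<in> borel_measurable (lborel \<Otimes>\<^sub>M lborel)" by measurable
  show "AE z in lborel \<Otimes>\<^sub>M lborel. norm (case z of (x, y) \<Rightarrow> f x y) \<le> norm (B * (indicator {a..b} (fst z) * indicator {c..d} (snd z) :: real))"
  proof (intro AE_I2)
    fix z :: "real \<times> real"
    show "norm (case z of (x, y) \<Rightarrow> f x y) \<le> norm (B * (indicator {a..b} (fst z) * indicator {c..d} (snd z) :: real))"
      using assms(2)[of "fst z" "snd z"] by (auto simp: case_prod_beta intro: order_trans[OF _ abs_ge_self])
  qed
qed

lemma LBINT_translate:
  fixes f :: "real \<Rightarrow> real"
  assumes f: "integrable lborel f" and "a \<le> b"
  shows "(LBINT z:{a..b}. f (c + z)) = (LBINT y:{..c + b}. f y) - (LBINT y:{..c + a}. f y)"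
    and "set_integrable lborel {a..b} (\<lambda>z. f (c + z))"
proof -
  have "(LBINT z:{a..b}. f (c + z)) = (LINT z|lborel. indicator {c + a..c + b} (c + 1 * z) * f (c + 1 * z))"
    unfolding set_lebesgue_integral_def by (intro Bochner_Integration.integral_cong) (auto simp: indicator_def)
  also have "\<dots> = (LINT y|lborel. indicator {c + a..c + b} y * f y)"
    using lborel_integral_real_affine[of 1 "\<lambda>y. indicator {c + a..c + b} y * f y" c] by simp
  also have "\<dots> = (LBINT y:{..c + b}. f y) - (LBINT y:{..c + a}. f y)"
    using primitive_diff[OF f, of "c + a" "c + b"] assms(2) by (simp add: set_lebesgue_integral_def)
  finally show "(LBINT z:{a..b}. f (c + z)) = (LBINT y:{..c + b}. f y) - (LBINT y:{..c + a}. f y)" .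
  have "integrable lborel (\<lambda>z. f (c + z))"
    using lborel_integrable_real_affine[OF f, of 1 c] by simp
  then show "set_integrable lborel {a..b} (\<lambda>z. f (c + z))"
    unfolding set_integrable_def by (intro integrable_mult_indicator) auto
qed

lemma LBINT_reflect:
  fixes f :: "real \<Rightarrow> real"
  assumes f: "integrable lborel f" and "a \<le> b"
  shows "(LBINT z:{a..b}. f (c - z)) = (LBINT y:{..c - a}. f y) - (LBINT y:{..c - b}. f y)"
    and "set_integrable lborel {a..b} (\<lambda>z. f (c - z))"
proof -
  have "(LBINT z:{a..b}. f (c - z)) = (LINT z|lborel. indicator {c - b..c - a} (c + (-1) * z) * f (c + (-1) * z))"
    unfolding set_lebesgue_integral_def by (intro Bochner_Integration.integral_cong) (auto simp: indicator_def)
  also have "\<dots> = (LINT y|lborel. indicator {c - b..c - a} y * f y)"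
    using lborel_integral_real_affine[of "-1" "\<lambda>y. indicator {c - b..c - a} y * f y" c] by simp
  also have "\<dots> = (LBINT y:{..c - a}. f y) - (LBINT y:{..c - b}. f y)"
    using primitive_diff[OF f, of "c - b" "c - a"] assms(2) by (simp add: set_lebesgue_integral_def)
  finally show "(LBINT z:{a..b}. f (c - z)) = (LBINT y:{..c - a}. f y) - (LBINT y:{..c - b}. f y)" .
  have "integrable lborel (\<lambda>z. f (c - z))"
    using lborel_integrable_real_affine[OF f, of "-1" c] by simp
  then show "set_integrable lborel {a..b} (\<lambda>z. f (c - z))"
    unfolding set_integrable_def by (intro integrable_mult_indicator) auto
qed

lemma LBINT_Icc_split:
  fixes g :: "real \<Rightarrow> real"
  assumes g: "set_integrable lborel {0..t} g" and "0 \<le> s" "s \<le> t"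
  shows "(LBINT z:{0..t}. g z) - (LBINT z:{0..s}. g z) = (LBINT z:{s..t}. g z)"
proof -
  have i: "integrable lborel (\<lambda>z. indicator {0..t} z * g z)" using g by (simp add: set_integrable_def)
  have "(LBINT z:{..t}. indicator {0..t} z * g z) - (LBINT z:{..s}. indicator {0..t} z * g z)
    = (LBINT z:{s..t}. indicator {0..t} z * g z)"
    using i assms by (intro primitive_diff)
  moreover have "(LBINT z:{..t}. indicator {0..t} z * g z) = (LBINT z:{0..t}. g z)"
    unfolding set_lebesgue_integral_def by (intro Bochner_Integration.integral_cong) (auto simp: indicator_def)
  moreover have "(LBINT z:{..s}. indicator {0..t} z * g z) = (LBINT z:{0..s}. g z)"
    unfolding set_lebesgue_integral_def by (intro Bochner_Integration.integral_cong) (use assms in \<open>auto simp: indicator_def\<close>)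
  moreover have "(LBINT z:{s..t}. indicator {0..t} z * g z) = (LBINT z:{s..t}. g z)"
    unfolding set_lebesgue_integral_def by (intro Bochner_Integration.integral_cong) (use assms in \<open>auto simp: indicator_def\<close>)
  ultimately show ?thesis by simp
qed

text \<open>A solution of the wave equation with source \<open>h\<close>: \<open>P1\<close> and \<open>P2\<close> are the initial values of
  \<open>w\<^sub>t + w\<^sub>x\<close> and \<open>w\<^sub>t - w\<^sub>x\<close>.\<close>

locale wave =
  fixes P1 P2 :: "real \<Rightarrow> real" and h :: "real \<Rightarrow> real \<Rightarrow> real"
  assumes P1: "integrable lborel P1" and P2: "integrable lborel P2"
    and h_measurable [measurable]: "case_prod h \<in> borel_measurable (borel \<Otimes>\<^sub>M borel)"
    and h_nonneg: "\<And>t x. 0 \<le> h t x"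
    and h_bound: "\<And>T. \<exists>B\<ge>0. \<forall>t x. 0 \<le> t \<longrightarrow> t \<le> T \<longrightarrow> h t x \<le> B"
    and h_L1: "\<And>T. \<exists>C\<ge>0. \<forall>t. 0 \<le> t \<longrightarrow> t \<le> T \<longrightarrow> Lpow 1 (h t) \<le> ennreal C"
begin

lemma P_measurable [measurable]: "P1 \<in> borel_measurable borel" "P2 \<in> borel_measurable borel"
  using P1 P2 by auto

lemma h_integrable: "0 \<le> t \<Longrightarrow> integrable lborel (h t)"
  using h_L1[of t] Lpow_1_less_top_iff[of "h t"] by (auto intro: le_less_trans)

text \<open>The initial profile is transported with speed of absolute value 1, and the source is
  integrated along the characteristic through \<open>(t, x)\<close>. With
  \<open>\<sigma> = 1\<close> and \<open>P1\<close> this is \<open>w_t + w_x\<close>, with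
  \<open>\<sigma> = -1\<close> and \<open>P2\<close> it is \<open>w_t - w_x\<close>.\<close>

definition mover :: "real \<Rightarrow> (real \<Rightarrow> real) \<Rightarrow> real \<Rightarrow> real \<Rightarrow> real" where
  "mover \<sigma> P t x = P (x + \<sigma> * t) + (LBINT \<tau>:{0..t}. h \<tau> (x + \<sigma> * (t - \<tau>)))"

text \<open>d'Alembert's formula with all integrals expressed by primitives from minus infinity, so
  that changing \<open>t\<close> or \<open>x\<close> only moves their endpoints. That
  \<open>wt\<close> and \<open>wx\<close> are its derivatives is the content of
  \<open>w_time_integral\<close> and \<open>w_space_integral\<close>.\<close>

definition w :: "real \<Rightarrow> real \<Rightarrow> real" where
  "w t x = ((LBINT y:{..x + t}. P1 y) - (LBINT y:{..x - t}. P2 y)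
     + (LBINT \<tau>:{0..t}. (LBINT y:{..x + (t - \<tau>)}. h \<tau> y) - (LBINT y:{..x - (t - \<tau>)}. h \<tau> y))) / 2"

definition wt :: "real \<Rightarrow> real \<Rightarrow> real" where
  "wt t x = (mover 1 P1 t x + mover (-1) P2 t x) / 2"

definition wx :: "real \<Rightarrow> real \<Rightarrow> real" where
  "wx t x = (mover 1 P1 t x - mover (-1) P2 t x) / 2"

lemma mover_measurable [measurable]:
  assumes [measurable]: "P \<in> borel_measurable borel"
  shows "case_prod (mover \<sigma> P) \<in> borel_measurable (borel \<Otimes>\<^sub>M borel)"
proof -
  have "(\<lambda>(t, x). P (x + \<sigma> * t) + (LINT \<tau>|lborel. (if 0 \<le> \<tau> \<and> \<tau> \<le> t then 1 else 0) * h \<tau> (x + \<sigma> * (t - \<tau>)))) \<in> borel_measurable (borel \<Otimes>\<^sub>M borel)"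
    by measurable
  also have "(\<lambda>(t, x). P (x + \<sigma> * t) + (LINT \<tau>|lborel. (if 0 \<le> \<tau> \<and> \<tau> \<le> t then 1 else 0) * h \<tau> (x + \<sigma> * (t - \<tau>)))) = case_prod (mover \<sigma> P)"
    unfolding mover_def set_lebesgue_integral_def
    by (intro ext) (auto intro!: Bochner_Integration.integral_cong simp: indicator_def)
  finally show ?thesis .
qed

lemma wt_measurable [measurable]: "case_prod wt \<in> borel_measurable (borel \<Otimes>\<^sub>M borel)"
  unfolding wt_def by measurable

lemma wx_measurable1 [measurable]: "wx t \<in> borel_measurable borel"
  unfolding wx_def by measurable

lemma source_integral_bounds:
  assumes "0 \<le> s" "s \<le> t" "\<And>\<tau> x. 0 \<le> \<tau> \<Longrightarrow> \<tau> \<le> t \<Longrightarrow> h \<tau> x \<le> B"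
  shows "set_integrable lborel {s..t} (\<lambda>\<tau>. h \<tau> (x + \<sigma> * \<tau>))"
    and "0 \<le> (LBINT \<tau>:{s..t}. h \<tau> (x + \<sigma> * \<tau>))"
    and "(LBINT \<tau>:{s..t}. h \<tau> (x + \<sigma> * \<tau>)) \<le> B * (t - s)"
proof -
  have iB: "integrable lborel (\<lambda>\<tau>. indicator {s..t} \<tau> * B)"
    by (intro integrable_mult_left integrable_real_indicator) (auto simp: emeasure_lborel_Icc_eq)
  have "integrable lborel (\<lambda>\<tau>. indicator {s..t} \<tau> * h \<tau> (x + \<sigma> * \<tau>))"
  proof (rule Bochner_Integration.integrable_bound[OF iB])
    show "AE \<tau> in lborel. norm (indicator {s..t} \<tau> * h \<tau> (x + \<sigma> * \<tau>)) \<le> norm (indicator {s..t} \<tau> * B)"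
      using assms h_nonneg by (intro AE_I2) (auto simp: indicator_def intro: order_trans[OF _ abs_ge_self])
  qed measurable
  then show i: "set_integrable lborel {s..t} (\<lambda>\<tau>. h \<tau> (x + \<sigma> * \<tau>))" by (simp add: set_integrable_def)
  show "0 \<le> (LBINT \<tau>:{s..t}. h \<tau> (x + \<sigma> * \<tau>))"
    unfolding set_lebesgue_integral_def using h_nonneg by (intro Bochner_Integration.integral_nonneg) auto
  have "(LBINT \<tau>:{s..t}. h \<tau> (x + \<sigma> * \<tau>)) \<le> (LINT \<tau>|lborel. indicator {s..t} \<tau> * B)"
    unfolding set_lebesgue_integral_def using i iB assms
    by (intro integral_mono) (auto simp: set_integrable_def indicator_def)
  then show "(LBINT \<tau>:{s..t}. h \<tau> (x + \<sigma> * \<tau>)) \<le> B * (t - s)" using assms by (simp add: mult.commute)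
qed

text \<open>Fubini on the triangle \<open>0 \<le> \<tau> \<le> s \<le> t\<close>. In the new order
  the inner integral over \<open>s\<close> has a fixed source time and becomes a difference of
  primitives of \<open>h \<tau>\<close>.\<close>

lemma time_integral_source:
  assumes t: "0 \<le> t" and \<sigma>: "\<sigma> = 1 \<or> \<sigma> = -1"
  shows "set_integrable lborel {0..t} (\<lambda>s. LBINT \<tau>:{0..s}. h \<tau> (x + \<sigma> * (s - \<tau>)))"
    and "(LBINT s:{0..t}. LBINT \<tau>:{0..s}. h \<tau> (x + \<sigma> * (s - \<tau>)))
      = (LBINT \<tau>:{0..t}. LBINT s:{\<tau>..t}. h \<tau> (x + \<sigma> * (s - \<tau>)))"
proof -
  obtain B where B: "B \<ge> 0" "\<And>\<tau> x. 0 \<le> \<tau> \<Longrightarrow> \<tau> \<le> t \<Longrightarrow> h \<tau> x \<le> B" using h_bound[of t] by blast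
  define F where "F s \<tau> = (if 0 \<le> \<tau> \<and> \<tau> \<le> s \<and> s \<le> t then 1 else 0) * h \<tau> (x + \<sigma> * (s - \<tau>))" for s \<tau>
  have [measurable]: "case_prod F \<in> borel_measurable (borel \<Otimes>\<^sub>M borel)" unfolding F_def by measurable
  have int: "integrable (lborel \<Otimes>\<^sub>M lborel) (\<lambda>(s, \<tau>). F s \<tau>)"
    by (rule integrable_bounded_box[where B=B and a=0 and b=t and c=0 and d=t])
       (use B h_nonneg in \<open>auto simp: F_def indicator_def\<close>)
  have e1: "indicator {0..t} s * (LBINT \<tau>:{0..s}. h \<tau> (x + \<sigma> * (s - \<tau>))) = (LINT \<tau>|lborel. F s \<tau>)" for s
  proof (cases "s \<in> {0..t}")
    case True
    then show ?thesis unfolding set_lebesgue_integral_def F_def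
      by (simp, intro Bochner_Integration.integral_cong) (auto simp: indicator_def)
  next
    case False
    then have "F s \<tau> = 0" for \<tau> unfolding F_def by auto
    then show ?thesis using False by simp
  qed
  have e2: "indicator {0..t} \<tau> * (LBINT s:{\<tau>..t}. h \<tau> (x + \<sigma> * (s - \<tau>))) = (LINT s|lborel. F s \<tau>)" for \<tau>
  proof (cases "\<tau> \<in> {0..t}")
    case True
    then show ?thesis unfolding set_lebesgue_integral_def F_def
      by (simp, intro Bochner_Integration.integral_cong) (auto simp: indicator_def)
  next
    case False
    then have "F s \<tau> = 0" for s unfolding F_def by auto
    then show ?thesis using False by simp
  qed
  show "set_integrable lborel {0..t} (\<lambda>s. LBINT \<tau>:{0..s}. h \<tau> (x + \<sigma> * (s - \<tau>)))"
    unfolding set_integrable_def real_scaleR_def e1 using lborel_pair.integrable_fst'[OF int] by simp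
  show "(LBINT s:{0..t}. LBINT \<tau>:{0..s}. h \<tau> (x + \<sigma> * (s - \<tau>)))
      = (LBINT \<tau>:{0..t}. LBINT s:{\<tau>..t}. h \<tau> (x + \<sigma> * (s - \<tau>)))"
    unfolding set_lebesgue_integral_def[of _ "{0..t}"] real_scaleR_def e1 e2
    by (rule lborel_pair.Fubini_integral[OF int, symmetric])
qed

lemma space_integral_source:
  assumes t: "0 \<le> t"
  shows "set_integrable lborel {x1..x2} (\<lambda>x. LBINT \<tau>:{0..t}. h \<tau> (x + \<sigma> * (t - \<tau>)))"
    and "(LBINT x:{x1..x2}. LBINT \<tau>:{0..t}. h \<tau> (x + \<sigma> * (t - \<tau>)))
      = (LBINT \<tau>:{0..t}. LBINT x:{x1..x2}. h \<tau> (x + \<sigma> * (t - \<tau>)))"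
    and "set_integrable lborel {0..t} (\<lambda>\<tau>. LBINT x:{x1..x2}. h \<tau> (x + \<sigma> * (t - \<tau>)))"
proof -
  obtain B where B: "B \<ge> 0" "\<And>\<tau> x. 0 \<le> \<tau> \<Longrightarrow> \<tau> \<le> t \<Longrightarrow> h \<tau> x \<le> B" using h_bound[of t] by blast
  define F where "F x \<tau> = indicator {x1..x2} x * (indicator {0..t} \<tau> * h \<tau> (x + \<sigma> * (t - \<tau>)))" for x \<tau>
  have [measurable]: "case_prod F \<in> borel_measurable (borel \<Otimes>\<^sub>M borel)" unfolding F_def by measurable
  have int: "integrable (lborel \<Otimes>\<^sub>M lborel) (\<lambda>(x, \<tau>). F x \<tau>)"
    by (rule integrable_bounded_box[where B=B and a=x1 and b=x2 and c=0 and d=t])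
       (use B h_nonneg in \<open>auto simp: F_def indicator_def\<close>)
  have e1: "indicator {x1..x2} x * (LBINT \<tau>:{0..t}. h \<tau> (x + \<sigma> * (t - \<tau>))) = (LINT \<tau>|lborel. F x \<tau>)" for x
    unfolding set_lebesgue_integral_def F_def by simp
  have e2: "indicator {0..t} \<tau> * (LBINT x:{x1..x2}. h \<tau> (x + \<sigma> * (t - \<tau>))) = (LINT x|lborel. F x \<tau>)" for \<tau>
    unfolding set_lebesgue_integral_def F_def
    by (subst integral_mult_right_zero[symmetric]) (simp add: mult.left_commute)
  show "set_integrable lborel {x1..x2} (\<lambda>x. LBINT \<tau>:{0..t}. h \<tau> (x + \<sigma> * (t - \<tau>)))"
    unfolding set_integrable_def real_scaleR_def e1 using lborel_pair.integrable_fst'[OF int] by simp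
  show "set_integrable lborel {0..t} (\<lambda>\<tau>. LBINT x:{x1..x2}. h \<tau> (x + \<sigma> * (t - \<tau>)))"
    unfolding set_integrable_def real_scaleR_def e2
    using lborel_pair.integrable_snd[OF int] by simp
  show "(LBINT x:{x1..x2}. LBINT \<tau>:{0..t}. h \<tau> (x + \<sigma> * (t - \<tau>)))
      = (LBINT \<tau>:{0..t}. LBINT x:{x1..x2}. h \<tau> (x + \<sigma> * (t - \<tau>)))"
    unfolding set_lebesgue_integral_def[of _ "{0..t}" "\<lambda>\<tau>. LBINT x:{x1..x2}. _ \<tau> x"] set_lebesgue_integral_def[of _ "{x1..x2}" "\<lambda>x. LBINT \<tau>:{0..t}. _ \<tau> x"] real_scaleR_def e1 e2
    by (rule lborel_pair.Fubini_integral[OF int, symmetric])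
qed

lemma h_primitive_integrable:
  assumes t: "0 \<le> t"
  shows "set_integrable lborel {0..t} (\<lambda>\<tau>. (LBINT y:{..x + \<sigma> * (t - \<tau>)}. h \<tau> y))"
proof -
  obtain C where C: "C \<ge> 0" "\<And>\<tau>. 0 \<le> \<tau> \<Longrightarrow> \<tau> \<le> t \<Longrightarrow> Lpow 1 (h \<tau>) \<le> ennreal C" using h_L1[of t] by blast
  have m: "(\<lambda>\<tau>. LINT y|lborel. (if y \<le> x + \<sigma> * (t - \<tau>) then 1 else 0) * h \<tau> y) \<in> borel_measurable borel"
    by measurable
  have eq: "(LINT y|lborel. (if y \<le> x + \<sigma> * (t - \<tau>) then 1 else 0) * h \<tau> y) = (LBINT y:{..x + \<sigma> * (t - \<tau>)}. h \<tau> y)" for \<tau>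
    unfolding set_lebesgue_integral_def by (intro Bochner_Integration.integral_cong) (auto simp: indicator_def)
  have [measurable]: "(\<lambda>\<tau>. (LBINT y:{..x + \<sigma> * (t - \<tau>)}. h \<tau> y)) \<in> borel_measurable borel" using m unfolding eq .
  have iB: "integrable lborel (\<lambda>\<tau>. indicator {0..t} \<tau> * C)"
    by (intro integrable_mult_left integrable_real_indicator) (auto simp: emeasure_lborel_Icc_eq)
  show ?thesis
    unfolding set_integrable_def real_scaleR_def
  proof (rule Bochner_Integration.integrable_bound[OF iB])
    show "AE \<tau> in lborel. norm (indicator {0..t} \<tau> * (LBINT y:{..x + \<sigma> * (t - \<tau>)}. h \<tau> y)) \<le> norm (indicator {0..t} \<tau> * C)"
    proof (intro AE_I2)
      fix \<tau>
      have "\<bar>LBINT y:{..x + \<sigma> * (t - \<tau>)}. h \<tau> y\<bar> \<le> C" if "\<tau> \<in> {0..t}"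
      proof -
        have i: "integrable lborel (h \<tau>)" using that by (intro h_integrable) simp
        have "ennreal (LINT z|lborel. \<bar>h \<tau> z\<bar>) = Lpow 1 (h \<tau>)"
          unfolding Lpow_1 using i by (subst nn_integral_eq_integral) auto
        also have "\<dots> \<le> ennreal C" using C that by auto
        finally have "(LINT z|lborel. \<bar>h \<tau> z\<bar>) \<le> C" using C(1) by (simp add: ennreal_le_iff)
        then show ?thesis using primitive_bound[OF i] order_trans by blast
      qed
      then show "norm (indicator {0..t} \<tau> * (LBINT y:{..x + \<sigma> * (t - \<tau>)}. h \<tau> y)) \<le> norm (indicator {0..t} \<tau> * C)"
        using C(1) by (auto simp: indicator_def)
    qed
  qed measurable
qed

lemma h_primitive_diff_integral:
  assumes t: "0 \<le> t"
  shows "(LBINT \<tau>:{0..t}. (LBINT y:{..x + \<sigma> * (t - \<tau>)}. h \<tau> y) - (LBINT y:{..x' + \<sigma>' * (t - \<tau>)}. h \<tau> y))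
    = (LBINT \<tau>:{0..t}. (LBINT y:{..x + \<sigma> * (t - \<tau>)}. h \<tau> y)) - (LBINT \<tau>:{0..t}. (LBINT y:{..x' + \<sigma>' * (t - \<tau>)}. h \<tau> y))"
  using h_primitive_integrable[OF t] by (intro set_integral_diff(2))

lemma w_time_integral_0:
  assumes t: "0 \<le> t"
  shows "set_integrable lborel {0..t} (\<lambda>s. wt s x)" "w t x - w 0 x = (LBINT s:{0..t}. wt s x)"
proof -
  have mone: "z + (-1) * (a - b) = z - (a - b)" for z a b :: real by simp
  \<comment> \<open>\<open>H 0\<close>, with the primitive taken at \<open>x\<close> itself, enters
    the two movers with opposite signs and cancels.\<close>
  define H where "H \<sigma> = (LBINT \<tau>:{0..t}. (LBINT y:{..x + \<sigma> * (t - \<tau>)}. h \<tau> y))" for \<sigma>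
  have p1: "(LBINT s:{0..t}. P1 (x + s)) = (LBINT y:{..x + t}. P1 y) - (LBINT y:{..x}. P1 y)"
    "set_integrable lborel {0..t} (\<lambda>s. P1 (x + s))"
    using LBINT_translate[OF P1 t, of x] by simp_all
  have p2: "(LBINT s:{0..t}. P2 (x - s)) = (LBINT y:{..x}. P2 y) - (LBINT y:{..x - t}. P2 y)"
    "set_integrable lborel {0..t} (\<lambda>s. P2 (x - s))"
    using LBINT_reflect[OF P2 t, of x] by simp_all
  have s1: "(LBINT s:{0..t}. LBINT \<tau>:{0..s}. h \<tau> (x + (s - \<tau>))) = H 1 - H 0"
  proof -
    have "(LBINT s:{0..t}. LBINT \<tau>:{0..s}. h \<tau> (x + 1 * (s - \<tau>))) = (LBINT \<tau>:{0..t}. LBINT s:{\<tau>..t}. h \<tau> (x + 1 * (s - \<tau>)))"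
      by (rule time_integral_source(2)[OF t]) simp
    also have "\<dots> = (LBINT \<tau>:{0..t}. (LBINT y:{..x + 1 * (t - \<tau>)}. h \<tau> y) - (LBINT y:{..x + 0 * (t - \<tau>)}. h \<tau> y))"
    proof (rule set_lebesgue_integral_cong, simp, intro allI impI)
      fix \<tau> assume "\<tau> \<in> {0..t}"
      then show "(LBINT s:{\<tau>..t}. h \<tau> (x + 1 * (s - \<tau>))) = (LBINT y:{..x + 1 * (t - \<tau>)}. h \<tau> y) - (LBINT y:{..x + 0 * (t - \<tau>)}. h \<tau> y)"
        using LBINT_translate(1)[OF h_integrable, of \<tau> \<tau> t "x - \<tau>"] by (simp add: algebra_simps)
    qed
    also have "\<dots> = H 1 - H 0" unfolding H_def by (rule h_primitive_diff_integral[OF t])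
    finally show ?thesis by simp
  qed
  have s2: "(LBINT s:{0..t}. LBINT \<tau>:{0..s}. h \<tau> (x - (s - \<tau>))) = H 0 - H (-1)"
  proof -
    have "(LBINT s:{0..t}. LBINT \<tau>:{0..s}. h \<tau> (x + (-1) * (s - \<tau>))) = (LBINT \<tau>:{0..t}. LBINT s:{\<tau>..t}. h \<tau> (x + (-1) * (s - \<tau>)))"
      by (rule time_integral_source(2)[OF t]) simp
    also have "\<dots> = (LBINT \<tau>:{0..t}. (LBINT y:{..x + 0 * (t - \<tau>)}. h \<tau> y) - (LBINT y:{..x + (-1) * (t - \<tau>)}. h \<tau> y))"
    proof (rule set_lebesgue_integral_cong, simp, intro allI impI)
      fix \<tau> assume "\<tau> \<in> {0..t}"
      then show "(LBINT s:{\<tau>..t}. h \<tau> (x + (-1) * (s - \<tau>))) = (LBINT y:{..x + 0 * (t - \<tau>)}. h \<tau> y) - (LBINT y:{..x + (-1) * (t - \<tau>)}. h \<tau> y)"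
        using LBINT_reflect(1)[OF h_integrable, of \<tau> \<tau> t "x + \<tau>"] by (simp add: algebra_simps)
    qed
    also have "\<dots> = H 0 - H (-1)" unfolding H_def by (rule h_primitive_diff_integral[OF t])
    finally show ?thesis unfolding mone .
  qed
  have i1: "set_integrable lborel {0..t} (\<lambda>s. LBINT \<tau>:{0..s}. h \<tau> (x + (s - \<tau>)))"
    using time_integral_source(1)[OF t, of 1 x] by simp
  have i2: "set_integrable lborel {0..t} (\<lambda>s. LBINT \<tau>:{0..s}. h \<tau> (x - (s - \<tau>)))"
    using time_integral_source(1)[OF t, of "-1" x] unfolding mone by simp
  have wt_eq: "wt s x = ((P1 (x + s) + (LBINT \<tau>:{0..s}. h \<tau> (x + (s - \<tau>)))) + (P2 (x - s) + (LBINT \<tau>:{0..s}. h \<tau> (x - (s - \<tau>))))) * (1 / 2)" for s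
    unfolding wt_def mover_def mone by simp
  have ia: "set_integrable lborel {0..t} (\<lambda>s. (P1 (x + s) + (LBINT \<tau>:{0..s}. h \<tau> (x + (s - \<tau>)))) + (P2 (x - s) + (LBINT \<tau>:{0..s}. h \<tau> (x - (s - \<tau>)))))"
    by (intro set_integral_add p1 p2 i1 i2)
  show "set_integrable lborel {0..t} (\<lambda>s. wt s x)"
    unfolding wt_eq by (intro set_integrable_mult_left impI ia)
  have "(LBINT s:{0..t}. wt s x) = (((LBINT s:{0..t}. P1 (x + s)) + (LBINT s:{0..t}. LBINT \<tau>:{0..s}. h \<tau> (x + (s - \<tau>))))
     + ((LBINT s:{0..t}. P2 (x - s)) + (LBINT s:{0..t}. LBINT \<tau>:{0..s}. h \<tau> (x - (s - \<tau>))))) * (1 / 2)"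
    unfolding wt_eq by (simp add: set_integral_add p1(2) p2(2) i1 i2)
  also have "\<dots> = ((LBINT y:{..x + t}. P1 y) - (LBINT y:{..x - t}. P2 y) + (H 1 - H (-1))) / 2
     - ((LBINT y:{..x}. P1 y) - (LBINT y:{..x}. P2 y)) / 2"
    unfolding p1(1) p2(1) s1 s2 by (simp add: field_simps)
  also have "\<dots> = w t x - w 0 x"
  proof -
    have "(LBINT \<tau>:{0..0::real}. f \<tau>) = (0::real)" for f
      unfolding set_lebesgue_integral_def
      by (rule integral_eq_zero_AE) (use AE_lborel_singleton[of "0::real"] in eventually_elim, auto simp: indicator_def)
    moreover have "H 1 - H (-1) = (LBINT \<tau>:{0..t}. (LBINT y:{..x + (t - \<tau>)}. h \<tau> y) - (LBINT y:{..x - (t - \<tau>)}. h \<tau> y))"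
      unfolding H_def using h_primitive_diff_integral[OF t, of x 1 x "-1"] unfolding mone by simp
    ultimately show ?thesis unfolding w_def by simp
  qed
  finally show "w t x - w 0 x = (LBINT s:{0..t}. wt s x)" by simp
qed

lemma w_time_integral:
  assumes "0 \<le> s" "s \<le> t"
  shows "set_integrable lborel {s..t} (\<lambda>\<tau>. wt \<tau> x) \<and> w t x - w s x = (LBINT \<tau>:{s..t}. wt \<tau> x)"
proof
  have i: "set_integrable lborel {0..t} (\<lambda>\<tau>. wt \<tau> x)" using assms by (intro w_time_integral_0) auto
  then show "set_integrable lborel {s..t} (\<lambda>\<tau>. wt \<tau> x)"
    by (rule set_integrable_subset) (use assms in auto)
  have "w t x - w s x = (w t x - w 0 x) - (w s x - w 0 x)" by simp
  also have "\<dots> = (LBINT \<tau>:{0..t}. wt \<tau> x) - (LBINT \<tau>:{0..s}. wt \<tau> x)"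
    using w_time_integral_0(2)[of t x] w_time_integral_0(2)[of s x] assms by simp
  also have "\<dots> = (LBINT \<tau>:{s..t}. wt \<tau> x)" using i assms by (intro LBINT_Icc_split)
  finally show "w t x - w s x = (LBINT \<tau>:{s..t}. wt \<tau> x)" .
qed

lemma w_space_integral:
  assumes t: "0 \<le> t" and x: "x1 \<le> x2"
  shows "w t x2 - w t x1 = (LBINT x:{x1..x2}. wx t x)"
proof -
  have mone: "z + (-1) * (a - b) = z - (a - b)" for z a b :: real by simp
  define H where "H x \<sigma> = (LBINT \<tau>:{0..t}. (LBINT y:{..x + \<sigma> * (t - \<tau>)}. h \<tau> y))" for x \<sigma>
  have p1: "(LBINT x:{x1..x2}. P1 (x + t)) = (LBINT y:{..x2 + t}. P1 y) - (LBINT y:{..x1 + t}. P1 y)"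
    "set_integrable lborel {x1..x2} (\<lambda>x. P1 (x + t))"
    using LBINT_translate[OF P1 x, of t] by (simp_all add: add.commute)
  have p2: "(LBINT x:{x1..x2}. P2 (x - t)) = (LBINT y:{..x2 - t}. P2 y) - (LBINT y:{..x1 - t}. P2 y)"
    "set_integrable lborel {x1..x2} (\<lambda>x. P2 (x - t))"
    using LBINT_translate[OF P2 x, of "- t"] by simp_all
  have s: "(LBINT x:{x1..x2}. LBINT \<tau>:{0..t}. h \<tau> (x + \<sigma> * (t - \<tau>))) = H x2 \<sigma> - H x1 \<sigma>" for \<sigma>
  proof -
    have "(LBINT x:{x1..x2}. LBINT \<tau>:{0..t}. h \<tau> (x + \<sigma> * (t - \<tau>))) = (LBINT \<tau>:{0..t}. LBINT x:{x1..x2}. h \<tau> (x + \<sigma> * (t - \<tau>)))"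
      by (rule space_integral_source(2)[OF t])
    also have "\<dots> = (LBINT \<tau>:{0..t}. (LBINT y:{..x2 + \<sigma> * (t - \<tau>)}. h \<tau> y) - (LBINT y:{..x1 + \<sigma> * (t - \<tau>)}. h \<tau> y))"
    proof (rule set_lebesgue_integral_cong; clarsimp)
      fix \<tau> assume "0 \<le> \<tau>" "\<tau> \<le> t"
      then show "(LBINT x:{x1..x2}. h \<tau> (x + \<sigma> * (t - \<tau>))) = (LBINT y:{..x2 + \<sigma> * (t - \<tau>)}. h \<tau> y) - (LBINT y:{..x1 + \<sigma> * (t - \<tau>)}. h \<tau> y)"
        using LBINT_translate(1)[OF h_integrable x, of \<tau> "\<sigma> * (t - \<tau>)"] by (simp add: add.commute)
    qed
    also have "\<dots> = H x2 \<sigma> - H x1 \<sigma>" unfolding H_def by (rule h_primitive_diff_integral[OF t])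
    finally show ?thesis .
  qed
  note i = space_integral_source(1)[OF t, of x1 x2]
  have "(LBINT x:{x1..x2}. wx t x) = (((LBINT x:{x1..x2}. P1 (x + t)) + (H x2 1 - H x1 1)) - ((LBINT x:{x1..x2}. P2 (x - t)) + (H x2 (-1) - H x1 (-1)))) * (1 / 2)"
  proof -
    have wx_eq: "wx t x = ((P1 (x + t) + (LBINT \<tau>:{0..t}. h \<tau> (x + 1 * (t - \<tau>)))) - (P2 (x - t) + (LBINT \<tau>:{0..t}. h \<tau> (x + (-1) * (t - \<tau>))))) * (1 / 2)" for x
      unfolding wx_def mover_def by simp
    show ?thesis
      unfolding wx_eq set_integral_mult_left
      by (subst set_integral_diff(2), intro set_integral_add p1 i, intro set_integral_add p2 i,
          subst set_integral_add(2)[OF p1(2) i], subst set_integral_add(2)[OF p2(2) i]) (simp only: s)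
  qed
  also have "\<dots> = w t x2 - w t x1"
  proof -
    have "H x 1 - H x (-1) = (LBINT \<tau>:{0..t}. (LBINT y:{..x + (t - \<tau>)}. h \<tau> y) - (LBINT y:{..x - (t - \<tau>)}. h \<tau> y))" for x
      unfolding H_def using h_primitive_diff_integral[OF t, of x 1 x "-1"] unfolding mone by simp
    then show ?thesis unfolding w_def p1(1) p2(1) by (simp add: field_simps flip: \<open>\<And>x. H x 1 - H x (-1) = _\<close>)
  qed
  finally show ?thesis by simp
qed

end

section \<open>Continuity in time of the derivatives\<close>

context wave
begin

text \<open>The source integral in the moving frame \<open>b = x + \<sigma> * t\<close>. There the
  integrand no longer depends on \<open>t\<close>, so an increment in time is an integral over a
  short interval.\<close>

definition source_part :: "real \<Rightarrow> real \<Rightarrow> real \<Rightarrow> real" where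
  "source_part \<sigma> t b = (LBINT \<tau>:{0..t}. h \<tau> (b - \<sigma> * \<tau>))"

lemma mover_eq: "mover \<sigma> P t x = P (x + \<sigma> * t) + source_part \<sigma> t (x + \<sigma> * t)"
  unfolding mover_def source_part_def by (simp add: algebra_simps)

lemma source_part_measurable [measurable]: "source_part \<sigma> t \<in> borel_measurable borel"
proof -
  have "(\<lambda>b. LINT \<tau>|lborel. indicator {0..t} \<tau> * h \<tau> (b - \<sigma> * \<tau>)) \<in> borel_measurable borel" by measurable
  then show ?thesis unfolding source_part_def[abs_def] set_lebesgue_integral_def by simp
qed

text \<open>On \<open>{s..t}\<close> the increment is at most \<open>B * T\<close> pointwise and at
  most \<open>C * (t - s)\<close> in \<open>L^1\<close>, the latter by Tonelli and translation
  invariance; interpolation gives a Lipschitz bound for \<open>Lpow q\<close>.\<close>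

lemma source_part_increment:
  assumes q: "q \<ge> 1" and T: "0 \<le> T"
  obtains D where "D \<ge> 0" "\<And>s t. 0 \<le> s \<Longrightarrow> s \<le> t \<Longrightarrow> t \<le> T \<Longrightarrow>
    Lpow q (\<lambda>b. source_part \<sigma> t b - source_part \<sigma> s b) \<le> ennreal (D * (t - s))"
proof -
  obtain B where B: "B \<ge> 0" "\<And>\<tau> x. 0 \<le> \<tau> \<Longrightarrow> \<tau> \<le> T \<Longrightarrow> h \<tau> x \<le> B" using h_bound[of T] by blast
  obtain C where C: "C \<ge> 0" "\<And>\<tau>. 0 \<le> \<tau> \<Longrightarrow> \<tau> \<le> T \<Longrightarrow> Lpow 1 (h \<tau>) \<le> ennreal C" using h_L1[of T] by blast
  define D where "D = (B * T) powr (q - 1) * C"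
  have D: "D \<ge> 0" unfolding D_def using C by simp
  have "Lpow q (\<lambda>b. source_part \<sigma> t b - source_part \<sigma> s b) \<le> ennreal (D * (t - s))"
    if st: "0 \<le> s" "s \<le> t" "t \<le> T" for s t
  proof -
    define R where "R b = (LBINT \<tau>:{s..t}. h \<tau> (b + (- \<sigma>) * \<tau>))" for b
    have Bt: "\<And>\<tau> x. 0 \<le> \<tau> \<Longrightarrow> \<tau> \<le> t \<Longrightarrow> h \<tau> x \<le> B" using B st by auto
    have diff: "source_part \<sigma> t b - source_part \<sigma> s b = R b" for b
    proof -
      have "set_integrable lborel {0..t} (\<lambda>\<tau>. h \<tau> (b + (- \<sigma>) * \<tau>))"
        using st Bt by (intro source_integral_bounds(1)[where B=B]) auto
      from LBINT_Icc_split[OF this st(1,2)] show ?thesis unfolding source_part_def R_def by simp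
    qed
    have R0: "0 \<le> R b" for b unfolding R_def using st Bt by (intro source_integral_bounds(2)[where B=B]) auto
    have "R b \<le> B * (t - s)" for b unfolding R_def using st Bt by (intro source_integral_bounds(3)) auto
    moreover have "B * (t - s) \<le> B * T" using st B by (intro mult_left_mono) auto
    ultimately have R1: "R b \<le> B * T" for b using order_trans by blast
    have [measurable]: "R \<in> borel_measurable borel"
    proof -
      have "(\<lambda>b. LINT \<tau>|lborel. indicator {s..t} \<tau> * h \<tau> (b + (- \<sigma>) * \<tau>)) \<in> borel_measurable borel" by measurable
      then show ?thesis unfolding R_def[abs_def] set_lebesgue_integral_def by simp
    qed
    have "Lpow 1 R = (\<integral>\<^sup>+b. \<integral>\<^sup>+\<tau>. ennreal (indicator {s..t} \<tau> * h \<tau> (b + (- \<sigma>) * \<tau>)) \<partial>lborel \<partial>lborel)"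
      unfolding Lpow_1
    proof (intro nn_integral_cong)
      fix b
      have "ennreal \<bar>R b\<bar> = ennreal (LINT \<tau>|lborel. indicator {s..t} \<tau> * h \<tau> (b + (- \<sigma>) * \<tau>))"
        using R0[of b] unfolding R_def set_lebesgue_integral_def by simp
      also have "\<dots> = (\<integral>\<^sup>+\<tau>. ennreal (indicator {s..t} \<tau> * h \<tau> (b + (- \<sigma>) * \<tau>)) \<partial>lborel)"
      proof (rule nn_integral_eq_integral[symmetric])
        show "integrable lborel (\<lambda>\<tau>. indicator {s..t} \<tau> * h \<tau> (b + (- \<sigma>) * \<tau>))"
          using source_integral_bounds(1)[OF st(1,2) Bt, of b "- \<sigma>"] by (simp add: set_integrable_def)
      qed (use h_nonneg in auto)
      finally show "ennreal \<bar>R b\<bar> = (\<integral>\<^sup>+\<tau>. ennreal (indicator {s..t} \<tau> * h \<tau> (b + (- \<sigma>) * \<tau>)) \<partial>lborel)" .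
    qed
    also have "\<dots> = (\<integral>\<^sup>+\<tau>. \<integral>\<^sup>+b. ennreal (indicator {s..t} \<tau> * h \<tau> (b + (- \<sigma>) * \<tau>)) \<partial>lborel \<partial>lborel)"
      by (rule lborel_pair.Fubini') measurable
    also have "\<dots> \<le> (\<integral>\<^sup>+\<tau>. ennreal C * indicator {s..t} \<tau> \<partial>lborel)"
    proof (intro nn_integral_mono)
      fix \<tau>
      show "(\<integral>\<^sup>+b. ennreal (indicator {s..t} \<tau> * h \<tau> (b + (- \<sigma>) * \<tau>)) \<partial>lborel) \<le> ennreal C * indicator {s..t} \<tau>"
      proof (cases "\<tau> \<in> {s..t}")
        case True
        then have "(\<integral>\<^sup>+b. ennreal (indicator {s..t} \<tau> * h \<tau> (b + (- \<sigma>) * \<tau>)) \<partial>lborel) = Lpow 1 (\<lambda>b. h \<tau> (b + (- \<sigma>) * \<tau>))"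
          unfolding Lpow_1 using h_nonneg by simp
        also have "\<dots> = Lpow 1 (h \<tau>)" by (rule Lpow_translate) measurable
        also have "\<dots> \<le> ennreal C" using C True st by auto
        finally show ?thesis using True by simp
      qed simp
    qed
    also have "\<dots> = ennreal (C * (t - s))" using C st by (simp add: nn_integral_cmult ennreal_mult)
    finally have L1: "Lpow 1 R \<le> ennreal (C * (t - s))" .
    have "Lpow q (\<lambda>b. source_part \<sigma> t b - source_part \<sigma> s b) = Lpow q R" unfolding diff ..
    also have "\<dots> \<le> ennreal ((B * T) powr (q - 1)) * Lpow 1 R"
      using q R0 R1 by (intro Lpow_bounded_le) auto
    also have "\<dots> \<le> ennreal ((B * T) powr (q - 1)) * ennreal (C * (t - s))" by (intro mult_left_mono L1) simp
    also have "\<dots> = ennreal (D * (t - s))" unfolding D_def using C st by (simp add: ennreal_mult[symmetric])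
    finally show ?thesis .
  qed
  then show ?thesis using D that by blast
qed

lemma source_part_0: "source_part \<sigma> 0 b = 0"
  unfolding source_part_def set_lebesgue_integral_def
  by (rule integral_eq_zero_AE) (use AE_lborel_singleton[of "0::real"] in eventually_elim, auto simp: indicator_def)

lemma source_part_finite:
  assumes "q \<ge> 1" "0 \<le> t"
  shows "Lpow q (source_part \<sigma> t) < \<infinity>"
proof -
  obtain D where "D \<ge> 0" and D: "\<And>s t'. 0 \<le> s \<Longrightarrow> s \<le> t' \<Longrightarrow> t' \<le> t \<Longrightarrow>
    Lpow q (\<lambda>b. source_part \<sigma> t' b - source_part \<sigma> s b) \<le> ennreal (D * (t' - s))"
    using source_part_increment[OF assms] by blast
  have "Lpow q (source_part \<sigma> t) \<le> ennreal (D * t)"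
    using D[of 0 t] assms by (simp add: source_part_0)
  then show ?thesis using le_less_trans[OF _ ennreal_less_top] by auto
qed

lemma source_part_continuous:
  assumes q: "q \<ge> 1" and s: "0 \<le> s"
  shows "((\<lambda>t. Lpow q (\<lambda>b. source_part \<sigma> t b - source_part \<sigma> s b)) \<longlongrightarrow> 0) (at s within {0..})"
proof -
  obtain D where "D \<ge> 0" and D: "\<And>s' t'. 0 \<le> s' \<Longrightarrow> s' \<le> t' \<Longrightarrow> t' \<le> s + 1 \<Longrightarrow>
    Lpow q (\<lambda>b. source_part \<sigma> t' b - source_part \<sigma> s' b) \<le> ennreal (D * (t' - s'))"
    using source_part_increment[OF q, of "s + 1"] s by auto
  show ?thesis
  proof (rule tendsto_ennreal_0_squeeze)
    have "((\<lambda>t. D * \<bar>t - s\<bar>) \<longlongrightarrow> D * \<bar>s - s\<bar>) (at s within {0..})" by (intro tendsto_intros)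
    then show "((\<lambda>t. ennreal (D * \<bar>t - s\<bar>)) \<longlongrightarrow> 0) (at s within {0..})"
      using tendsto_ennrealI by fastforce
    show "eventually (\<lambda>t. Lpow q (\<lambda>b. source_part \<sigma> t b - source_part \<sigma> s b) \<le> ennreal (D * \<bar>t - s\<bar>)) (at s within {0..})"
      unfolding eventually_at
    proof (intro exI[of _ 1] conjI ballI impI)
      fix t assume t: "t \<in> {0..}" "t \<noteq> s \<and> dist t s < 1"
      then have "t \<le> s + 1" by (auto simp: dist_real_def)
      then show "Lpow q (\<lambda>b. source_part \<sigma> t b - source_part \<sigma> s b) \<le> ennreal (D * \<bar>t - s\<bar>)"
        using D[of s t] D[of t s] t s Lpow_minus_commute[of q "source_part \<sigma> t" "source_part \<sigma> s"]
        by (cases "s \<le> t") auto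
    qed simp
  qed
qed

lemma mover_finite:
  assumes q: "q \<ge> 1" and P: "P \<in> borel_measurable borel" "Lpow q P < \<infinity>" and t: "0 \<le> t"
  shows "Lpow q (mover \<sigma> P t) < \<infinity>"
proof -
  note P(1) [measurable]
  have "Lpow q (mover \<sigma> P t) = Lpow q (\<lambda>x. P x + source_part \<sigma> t x)"
    unfolding mover_eq[abs_def] using Lpow_translate[of "\<lambda>x. P x + source_part \<sigma> t x" q "\<sigma> * t"] by simp
  also have "\<dots> \<le> ennreal (2 powr q) * (Lpow q P + Lpow q (source_part \<sigma> t))"
    using q by (intro Lpow_add_le) auto
  also have "\<dots> < \<infinity>" using P(2) source_part_finite[OF q t, of \<sigma>] by (auto simp: ennreal_mult_less_top)
  finally show ?thesis .
qed

text \<open>A mover is a continuously varying profile \<open>Q t\<close> shifted by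
  \<open>\<sigma> * t\<close>.\<close>

lemma mover_continuous:
  assumes q: "q \<ge> 1" and P: "P \<in> borel_measurable borel" "Lpow q P < \<infinity>" and s: "0 \<le> s"
  shows "((\<lambda>t. Lpow q (\<lambda>x. mover \<sigma> P t x - mover \<sigma> P s x)) \<longlongrightarrow> 0) (at s within {0..})"
proof -
  note P(1) [measurable]
  define Q where "Q t x = P x + source_part \<sigma> t x" for t x
  have [measurable]: "Q t \<in> borel_measurable borel" for t unfolding Q_def by measurable
  have "((\<lambda>t. Lpow q (\<lambda>x. Q t (x + \<sigma> * t) - Q s (x + \<sigma> * s))) \<longlongrightarrow> 0) (at s within {0..})"
  proof (rule Lpow_moving_translation_tendsto_0)
    show "((\<lambda>t. Lpow q (\<lambda>x. Q t x - Q s x)) \<longlongrightarrow> 0) (at s within {0..})"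
      unfolding Q_def using source_part_continuous[OF q s] by simp
    have "Lpow q (Q s) \<le> ennreal (2 powr q) * (Lpow q P + Lpow q (source_part \<sigma> s))"
      unfolding Q_def using q by (intro Lpow_add_le) auto
    also have "\<dots> < \<infinity>" using P(2) source_part_finite[OF q s, of \<sigma>] by (auto simp: ennreal_mult_less_top)
    finally show "Lpow q (Q s) < \<infinity>" .
    show "((\<lambda>t. \<sigma> * t) \<longlongrightarrow> \<sigma> * s) (at s within {0..})" by (intro tendsto_intros)
  qed (use q in auto)
  then show ?thesis unfolding mover_eq Q_def .
qed

context
  fixes q :: real
  assumes q: "q \<ge> 1" and P1q: "Lpow q P1 < \<infinity>" and P2q: "Lpow q P2 < \<infinity>"
begin

lemma wt_continuous:
  assumes s: "0 \<le> s"
  shows "((\<lambda>t. Lpow q (\<lambda>x. wt t x - wt s x)) \<longlongrightarrow> 0) (at s within {0..})"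
proof -
  have "((\<lambda>t. Lpow q (\<lambda>x. (mover 1 P1 t x - mover 1 P1 s x) + (mover (-1) P2 t x - mover (-1) P2 s x))) \<longlongrightarrow> 0) (at s within {0..})"
    using q P1q P2q s by (intro Lpow_add_tendsto_0 mover_continuous) auto
  then have "((\<lambda>t. Lpow q (\<lambda>x. (1 / 2) * ((mover 1 P1 t x - mover 1 P1 s x) + (mover (-1) P2 t x - mover (-1) P2 s x)))) \<longlongrightarrow> 0) (at s within {0..})"
    using q by (intro Lpow_bounded_cmult_tendsto_0[OF _ _ _ tendsto_const]) auto
  moreover have "wt t x - wt s x = (1 / 2) * ((mover 1 P1 t x - mover 1 P1 s x) + (mover (-1) P2 t x - mover (-1) P2 s x))" for t x
    unfolding wt_def by (simp add: field_simps)
  ultimately show ?thesis by (simp only:)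
qed

lemma wx_continuous:
  assumes s: "0 \<le> s"
  shows "((\<lambda>t. Lpow q (\<lambda>x. wx t x - wx s x)) \<longlongrightarrow> 0) (at s within {0..})"
proof -
  have "((\<lambda>t. Lpow q (\<lambda>x. (mover 1 P1 t x - mover 1 P1 s x) + (mover (-1) P2 s x - mover (-1) P2 t x))) \<longlongrightarrow> 0) (at s within {0..})"
    using q P1q P2q s Lpow_minus_commute[of q "mover (-1) P2 s"]
    by (intro Lpow_add_tendsto_0 mover_continuous) (auto intro!: mover_continuous)
  then have "((\<lambda>t. Lpow q (\<lambda>x. (1 / 2) * ((mover 1 P1 t x - mover 1 P1 s x) + (mover (-1) P2 s x - mover (-1) P2 t x)))) \<longlongrightarrow> 0) (at s within {0..})"
    using q by (intro Lpow_bounded_cmult_tendsto_0[OF _ _ _ tendsto_const]) auto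
  moreover have "wx t x - wx s x = (1 / 2) * ((mover 1 P1 t x - mover 1 P1 s x) + (mover (-1) P2 s x - mover (-1) P2 t x))" for t x
    unfolding wx_def by (simp add: field_simps)
  ultimately show ?thesis by (simp only:)
qed

lemma wt_finite: "0 \<le> t \<Longrightarrow> Lpow q (wt t) < \<infinity>"
  and wx_finite: "0 \<le> t \<Longrightarrow> Lpow q (wx t) < \<infinity>"
proof -
  assume t: "0 \<le> t"
  have f1: "Lpow q (mover 1 P1 t) < \<infinity>" and f2: "Lpow q (mover (-1) P2 t) < \<infinity>"
    using mover_finite[OF q P_measurable(1) P1q t] mover_finite[OF q P_measurable(2) P2q t] by auto
  have "Lpow q (wt t) = Lpow q (\<lambda>x. (1 / 2) * (mover 1 P1 t x + mover (-1) P2 t x))"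
    unfolding wt_def by simp
  also have "\<dots> = ennreal (\<bar>1 / 2\<bar> powr q) * Lpow q (\<lambda>x. mover 1 P1 t x + mover (-1) P2 t x)"
    by (rule Lpow_cmult) measurable
  also have "\<dots> \<le> ennreal (\<bar>1 / 2\<bar> powr q) * (ennreal (2 powr q) * (Lpow q (mover 1 P1 t) + Lpow q (mover (-1) P2 t)))"
    using q by (intro mult_left_mono Lpow_add_le) auto
  also have "\<dots> < \<infinity>" using f1 f2 by (auto simp: ennreal_mult_less_top)
  finally show "Lpow q (wt t) < \<infinity>" .
  have "Lpow q (wx t) = Lpow q (\<lambda>x. (1 / 2) * (mover 1 P1 t x + - mover (-1) P2 t x))"
    unfolding wx_def by simp
  also have "\<dots> = ennreal (\<bar>1 / 2\<bar> powr q) * Lpow q (\<lambda>x. mover 1 P1 t x + - mover (-1) P2 t x)"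
    by (rule Lpow_cmult) measurable
  also have "\<dots> \<le> ennreal (\<bar>1 / 2\<bar> powr q) * (ennreal (2 powr q) * (Lpow q (mover 1 P1 t) + Lpow q (\<lambda>x. - mover (-1) P2 t x)))"
    using q by (intro mult_left_mono Lpow_add_le) auto
  also have "\<dots> < \<infinity>" using f1 f2 by (auto simp: ennreal_mult_less_top Lpow_uminus)
  finally show "Lpow q (wx t) < \<infinity>" .
qed

lemma w_differentiable:
  assumes s: "0 \<le> s"
  shows "((\<lambda>t. Lpow q (\<lambda>x. (w t x - w s x) / (t - s) - wt s x)) \<longlongrightarrow> 0) (at s within {0..})"
proof (rule Lpow_difference_quotient_tendsto_0)
  show "case_prod wt \<in> borel_measurable (lborel \<Otimes>\<^sub>M lborel)" by measurable
  show "AE x in lborel. set_integrable lborel {a..b} (\<lambda>\<tau>. wt \<tau> x) \<and> w b x - w a x = (LBINT \<tau>:{a..b}. wt \<tau> x)"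
    if "0 \<le> a" "a \<le> b" for a b
    using w_time_integral[OF that] by simp
qed (use q s wt_continuous in auto)

end

end

section \<open>The solution in the original variables\<close>

text \<open>The linear change of variables is done by two one-dimensional affine substitutions with
  Tonelli in between; the second one contributes the Jacobian 1/2.\<close>

lemma nn_integral_characteristic:
  fixes G :: "real \<Rightarrow> real \<Rightarrow> ennreal"
  assumes [measurable]: "case_prod G \<in> borel_measurable (borel \<Otimes>\<^sub>M borel)"
  shows "(\<integral>\<^sup>+\<tau>. \<integral>\<^sup>+y. G \<tau> y \<partial>lborel \<partial>lborel)
    = ennreal (1 / 2) * (\<integral>\<^sup>+\<alpha>. \<integral>\<^sup>+\<beta>. G ((\<beta> - \<alpha>) / 2) ((\<alpha> + \<beta>) / 2) \<partial>lborel \<partial>lborel)"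
proof -
  have m: "(\<lambda>x. G (f1 x) (f2 x)) \<in> borel_measurable N"
    if [measurable]: "f1 \<in> borel_measurable N" "f2 \<in> borel_measurable N" for f1 f2 and N :: "'z measure"
  proof -
    have "(\<lambda>x. case_prod G (f1 x, f2 x)) \<in> borel_measurable N" by measurable
    then show ?thesis by simp
  qed
  note [measurable] = m
  have "(\<integral>\<^sup>+\<tau>. \<integral>\<^sup>+y. G \<tau> y \<partial>lborel \<partial>lborel) = (\<integral>\<^sup>+\<tau>. \<integral>\<^sup>+\<alpha>. G \<tau> (\<alpha> + \<tau>) \<partial>lborel \<partial>lborel)"
  proof (rule nn_integral_cong)
    fix \<tau>
    show "(\<integral>\<^sup>+y. G \<tau> y \<partial>lborel) = (\<integral>\<^sup>+\<alpha>. G \<tau> (\<alpha> + \<tau>) \<partial>lborel)"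
      using nn_integral_real_affine[of "G \<tau>" 1 \<tau>] by (simp add: add.commute)
  qed
  also have "\<dots> = (\<integral>\<^sup>+\<alpha>. \<integral>\<^sup>+\<tau>. G \<tau> (\<alpha> + \<tau>) \<partial>lborel \<partial>lborel)"
    by (rule lborel_pair.Fubini') measurable
  also have "\<dots> = (\<integral>\<^sup>+\<alpha>. ennreal (1 / 2) * (\<integral>\<^sup>+\<beta>. G ((\<beta> - \<alpha>) / 2) ((\<alpha> + \<beta>) / 2) \<partial>lborel) \<partial>lborel)"
  proof (intro nn_integral_cong)
    fix \<alpha>
    have "(\<integral>\<^sup>+\<tau>. G \<tau> (\<alpha> + \<tau>) \<partial>lborel) = ennreal \<bar>1 / 2\<bar> * (\<integral>\<^sup>+\<beta>. G (- \<alpha> / 2 + 1 / 2 * \<beta>) (\<alpha> + (- \<alpha> / 2 + 1 / 2 * \<beta>)) \<partial>lborel)"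
      by (rule nn_integral_real_affine) auto
    also have "(\<lambda>\<beta>. G (- \<alpha> / 2 + 1 / 2 * \<beta>) (\<alpha> + (- \<alpha> / 2 + 1 / 2 * \<beta>))) = (\<lambda>\<beta>. G ((\<beta> - \<alpha>) / 2) ((\<alpha> + \<beta>) / 2))"
    proof
      fix \<beta>
      have "- \<alpha> / 2 + 1 / 2 * \<beta> = (\<beta> - \<alpha>) / 2" "\<alpha> + (- \<alpha> / 2 + 1 / 2 * \<beta>) = (\<alpha> + \<beta>) / 2" by (auto simp: field_simps)
      then show "G (- \<alpha> / 2 + 1 / 2 * \<beta>) (\<alpha> + (- \<alpha> / 2 + 1 / 2 * \<beta>)) = G ((\<beta> - \<alpha>) / 2) ((\<alpha> + \<beta>) / 2)" by (simp only:)
    qed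
    finally show "(\<integral>\<^sup>+\<tau>. G \<tau> (\<alpha> + \<tau>) \<partial>lborel) = ennreal (1 / 2) * (\<integral>\<^sup>+\<beta>. G ((\<beta> - \<alpha>) / 2) ((\<alpha> + \<beta>) / 2) \<partial>lborel)" by simp
  qed
  also have "\<dots> = ennreal (1 / 2) * (\<integral>\<^sup>+\<alpha>. \<integral>\<^sup>+\<beta>. G ((\<beta> - \<alpha>) / 2) ((\<alpha> + \<beta>) / 2) \<partial>lborel \<partial>lborel)"
    by (rule nn_integral_cmult) measurable
  finally show ?thesis .
qed

text \<open>The factor 1/4 of \<open>Kop\<close> is the 1/2 of d'Alembert's formula times the
  Jacobian 1/2 of the characteristic coordinates.\<close>

lemma Kop_time_space:
  assumes [measurable]: "k \<in> borel_measurable borel" "case_prod g \<in> borel_measurable (borel \<Otimes>\<^sub>M borel)"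
  shows "Kop k g (x - t) (x + t) = ennreal (1 / 2) * (\<integral>\<^sup>+\<tau>. indicator {0..t} \<tau> *
    (\<integral>\<^sup>+y. inside (x - (t - \<tau>)) (x + (t - \<tau>)) y * (ennreal (k ((t - \<tau>)\<^sup>2 - (x - y)\<^sup>2)) * g (y - \<tau>) (y + \<tau>)) \<partial>lborel) \<partial>lborel)"
proof -
  have m: "(\<lambda>x. g (f1 x) (f2 x)) \<in> borel_measurable N"
    if [measurable]: "f1 \<in> borel_measurable N" "f2 \<in> borel_measurable N" for f1 f2 and N :: "'z measure"
  proof -
    have "(\<lambda>x. case_prod g (f1 x, f2 x)) \<in> borel_measurable N" by measurable
    then show ?thesis by simp
  qed
  note [measurable] = m
  define G where "G \<tau> y = lcone (x - t) (x + t) (y - \<tau>) (y + \<tau>) * ennreal (k ((t - \<tau>)\<^sup>2 - (x - y)\<^sup>2)) * g (y - \<tau>) (y + \<tau>)" for \<tau> y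
  have "Kop k g (x - t) (x + t) = ennreal (1 / 4) * (\<integral>\<^sup>+\<alpha>. \<integral>\<^sup>+\<beta>. G ((\<beta> - \<alpha>) / 2) ((\<alpha> + \<beta>) / 2) \<partial>lborel \<partial>lborel)"
    unfolding Kop_def
  proof (intro arg_cong[where f="\<lambda>x. _ * x"] nn_integral_cong)
    fix \<alpha> \<beta> :: real
    have 1: "(\<alpha> + \<beta>) / 2 - (\<beta> - \<alpha>) / 2 = \<alpha>" "(\<alpha> + \<beta>) / 2 + (\<beta> - \<alpha>) / 2 = \<beta>" by (simp_all add: field_simps)
    have 2: "(t - (\<beta> - \<alpha>) / 2)\<^sup>2 - (x - (\<alpha> + \<beta>) / 2)\<^sup>2 = (\<alpha> - (x - t)) * (x + t - \<beta>)"
      by (simp add: power2_eq_square field_simps)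
    show "lcone (x - t) (x + t) \<alpha> \<beta> * ennreal (k ((\<alpha> - (x - t)) * (x + t - \<beta>))) * g \<alpha> \<beta> = G ((\<beta> - \<alpha>) / 2) ((\<alpha> + \<beta>) / 2)"
      unfolding G_def 1 2 ..
  qed
  also have "ennreal (1 / 4) = ennreal (1 / 2) * ennreal (1 / 2)" by (subst ennreal_mult[symmetric]) auto
  also have "ennreal (1 / 2) * ennreal (1 / 2) * (\<integral>\<^sup>+\<alpha>. \<integral>\<^sup>+\<beta>. G ((\<beta> - \<alpha>) / 2) ((\<alpha> + \<beta>) / 2) \<partial>lborel \<partial>lborel)
    = ennreal (1 / 2) * (\<integral>\<^sup>+\<tau>. \<integral>\<^sup>+y. G \<tau> y \<partial>lborel \<partial>lborel)"
  proof -
    have "case_prod G \<in> borel_measurable (borel \<Otimes>\<^sub>M borel)" unfolding G_def by measurable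
    from nn_integral_characteristic[OF this] show ?thesis by (simp only: mult.assoc)
  qed
  also have "(\<integral>\<^sup>+\<tau>. \<integral>\<^sup>+y. G \<tau> y \<partial>lborel \<partial>lborel) = (\<integral>\<^sup>+\<tau>. \<integral>\<^sup>+y. indicator {0..t} \<tau> *
     (inside (x - (t - \<tau>)) (x + (t - \<tau>)) y * (ennreal (k ((t - \<tau>)\<^sup>2 - (x - y)\<^sup>2)) * g (y - \<tau>) (y + \<tau>))) \<partial>lborel \<partial>lborel)"
  proof (intro nn_integral_cong)
    fix \<tau> y
    have "lcone (x - t) (x + t) (y - \<tau>) (y + \<tau>) = indicator {0..t} \<tau> * inside (x - (t - \<tau>)) (x + (t - \<tau>)) y"
      by (auto simp: lcone_def inside_def indicator_def)
    then show "G \<tau> y = indicator {0..t} \<tau> *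
       (inside (x - (t - \<tau>)) (x + (t - \<tau>)) y * (ennreal (k ((t - \<tau>)\<^sup>2 - (x - y)\<^sup>2)) * g (y - \<tau>) (y + \<tau>)))"
      unfolding G_def by (simp only: mult.assoc)
  qed
  also have "\<dots> = (\<integral>\<^sup>+\<tau>. indicator {0..t} \<tau> * (\<integral>\<^sup>+y.
     inside (x - (t - \<tau>)) (x + (t - \<tau>)) y * (ennreal (k ((t - \<tau>)\<^sup>2 - (x - y)\<^sup>2)) * g (y - \<tau>) (y + \<tau>)) \<partial>lborel) \<partial>lborel)"
    by (intro nn_integral_cong nn_integral_cmult) measurable
  finally show ?thesis .
qed

text \<open>Here \<open>\<phi>\<close> is fixed as the continuous representative, a primitive of its
  derivative, so that the identities between \<open>\<phi>\<close> and \<open>d\<phi>\<close> hold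
  at every point rather than almost everywhere.\<close>

locale small_Sobolev_data = small_data +
  fixes d\<phi> :: "real \<Rightarrow> real"
  assumes dphi_int: "integrable lborel d\<phi>" and phi_eq: "\<And>x. \<phi> x = (LBINT y:{..x}. d\<phi> y)"
    and dphi_p: "Lpow p d\<phi> < \<infinity>" and psi_p: "Lpow p \<psi> < \<infinity>"
begin

definition W :: "real \<Rightarrow> real \<Rightarrow> real" where
  "W t x = enn2real (sol (x - t) (x + t))"

definition source :: "real \<Rightarrow> real \<Rightarrow> real" where
  "source t x = (if 0 \<le> t then rhs t (W t x) else 0)"

lemma W_measurable [measurable]: "case_prod W \<in> borel_measurable (borel \<Otimes>\<^sub>M borel)"
  unfolding W_def by measurable

lemma W_measurable1 [measurable]: "W t \<in> borel_measurable borel"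
  unfolding W_def by measurable

lemma source_measurable [measurable]: "case_prod source \<in> borel_measurable (borel \<Otimes>\<^sub>M borel)"
  unfolding source_def by measurable

lemma W_nonneg: "0 \<le> W t x"
  unfolding W_def by simp

lemma W_le: "W t x \<le> m * exp (\<bar>t\<bar> / 2)"
proof -
  have "sol (x - t) (x + t) \<le> ennreal (m * exp (\<bar>(x + t) - (x - t)\<bar> / 4))"
    using sol_le_lin lin_le order_trans by blast
  then have "W t x \<le> m * exp (\<bar>(x + t) - (x - t)\<bar> / 4)"
    unfolding W_def using m by (intro enn2real_leI) auto
  moreover have "\<bar>(x + t) - (x - t)\<bar> / 4 = \<bar>t\<bar> / 2" by simp
  ultimately show ?thesis by simp
qed

lemma source_nonneg: "0 \<le> source t x"
  unfolding source_def using rhs_nonneg W_nonneg by simp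

lemma source_le: "source t x \<le> W t x"
proof -
  have "rhs t (W t x) \<le> W t x / 4" by (rule rhs_le)
  also have "\<dots> \<le> W t x" using W_nonneg[of t x] by simp
  finally show ?thesis unfolding source_def using W_nonneg by auto
qed

lemma nn_integral_inside_translate:
  assumes [measurable]: "f \<in> borel_measurable borel" and t: "0 \<le> t"
  shows "(\<integral>\<^sup>+x. \<integral>\<^sup>+y. inside (x - t) (x + t) y * f y \<partial>lborel \<partial>lborel) = ennreal (2 * t) * (\<integral>\<^sup>+y. f y \<partial>lborel)"
proof -
  have "(\<integral>\<^sup>+x. \<integral>\<^sup>+y. inside (x - t) (x + t) y * f y \<partial>lborel \<partial>lborel) = (\<integral>\<^sup>+y. \<integral>\<^sup>+x. inside (x - t) (x + t) y * f y \<partial>lborel \<partial>lborel)"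
    by (rule lborel_pair.Fubini') measurable
  also have "\<dots> = (\<integral>\<^sup>+y. ennreal (2 * t) * f y \<partial>lborel)"
  proof (intro nn_integral_cong)
    fix y
    have "(\<integral>\<^sup>+x. inside (x - t) (x + t) y * f y \<partial>lborel) = (\<integral>\<^sup>+x. f y * indicator {y - t..y + t} x \<partial>lborel)"
      by (intro nn_integral_cong) (auto simp: inside_def indicator_def)
    also have "\<dots> = f y * ennreal (2 * t)" using t by (simp add: nn_integral_cmult_indicator)
    finally show "(\<integral>\<^sup>+x. inside (x - t) (x + t) y * f y \<partial>lborel) = ennreal (2 * t) * f y" by (simp add: mult.commute)
  qed
  finally show ?thesis by (simp add: nn_integral_cmult)
qed

text \<open>\<open>linear_solution_le\<close> is integrated in \<open>x\<close>: the boundary terms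
  keep their mass, and each integral over the base of the cone multiplies the mass by
  \<open>2 * t\<close>.\<close>

lemma W_L1_bound: "\<exists>C\<ge>0. \<forall>t. 0 \<le> t \<longrightarrow> t \<le> T \<longrightarrow> Lpow 1 (W t) \<le> ennreal C"
proof -
  define P Q where "P = (LINT x|lborel. \<phi> x)" and "Q = (LINT x|lborel. \<psi> x)"
  have P: "(\<integral>\<^sup>+x. ennreal (\<phi> x) \<partial>lborel) = ennreal P" "P \<ge> 0"
    unfolding P_def using nn_integral_eq_integral[OF phi_int] phi_nonneg by auto
  have Q: "(\<integral>\<^sup>+x. ennreal (\<psi> x) \<partial>lborel) = ennreal Q" "Q \<ge> 0"
    unfolding Q_def using nn_integral_eq_integral[OF psi_int] psi_nonneg by auto
  define C where "C = P + exp (\<bar>T\<bar> / 2) / 4 * (2 * \<bar>T\<bar> * P) + exp (\<bar>T\<bar> / 2) / 2 * (2 * \<bar>T\<bar> * Q)"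
  have "Lpow 1 (W t) \<le> ennreal C" if t: "0 \<le> t" "t \<le> T" for t
  proof -
    have "Lpow 1 (W t) \<le> (\<integral>\<^sup>+x. lin (x - t) (x + t) \<partial>lborel)"
      unfolding Lpow_1
    proof (intro nn_integral_mono)
      fix x
      have "ennreal \<bar>W t x\<bar> = sol (x - t) (x + t)"
        using sol_finite[of "x - t" "x + t"] unfolding W_def by simp
      then show "ennreal \<bar>W t x\<bar> \<le> lin (x - t) (x + t)" using sol_le_lin by simp
    qed
    also have "\<dots> \<le> (\<integral>\<^sup>+x. ennreal (1 / 2) * (ennreal (\<phi> (x - t)) + ennreal (\<phi> (x + t)))
      + ennreal (exp (t / 2) / 4) * (\<integral>\<^sup>+y. inside (x - t) (x + t) y * ennreal (\<phi> y) \<partial>lborel)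
      + ennreal (exp (t / 2) / 2) * (\<integral>\<^sup>+y. inside (x - t) (x + t) y * ennreal (\<psi> y) \<partial>lborel) \<partial>lborel)"
    proof (intro nn_integral_mono)
      fix x
      have "((x + t) - (x - t)) / 4 = t / 2" by simp
      then show "lin (x - t) (x + t) \<le> ennreal (1 / 2) * (ennreal (\<phi> (x - t)) + ennreal (\<phi> (x + t)))
        + ennreal (exp (t / 2) / 4) * (\<integral>\<^sup>+y. inside (x - t) (x + t) y * ennreal (\<phi> y) \<partial>lborel)
        + ennreal (exp (t / 2) / 2) * (\<integral>\<^sup>+y. inside (x - t) (x + t) y * ennreal (\<psi> y) \<partial>lborel)"
        using linear_solution_le[OF phi_measurable psi_measurable, of "x - t" "x + t"] t by simp
    qed
    also have "\<dots> = ennreal (1 / 2) * ((\<integral>\<^sup>+x. ennreal (\<phi> (x - t)) \<partial>lborel) + (\<integral>\<^sup>+x. ennreal (\<phi> (x + t)) \<partial>lborel))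
      + ennreal (exp (t / 2) / 4) * (\<integral>\<^sup>+x. \<integral>\<^sup>+y. inside (x - t) (x + t) y * ennreal (\<phi> y) \<partial>lborel \<partial>lborel)
      + ennreal (exp (t / 2) / 2) * (\<integral>\<^sup>+x. \<integral>\<^sup>+y. inside (x - t) (x + t) y * ennreal (\<psi> y) \<partial>lborel \<partial>lborel)"
      by (simp add: nn_integral_add nn_integral_cmult)
    also have "(\<integral>\<^sup>+x. ennreal (\<phi> (x - t)) \<partial>lborel) = ennreal P"
      using nn_integral_real_affine[of "\<lambda>x. ennreal (\<phi> x)" 1 "- t"] P by simp
    also have "(\<integral>\<^sup>+x. ennreal (\<phi> (x + t)) \<partial>lborel) = ennreal P"
      using nn_integral_real_affine[of "\<lambda>x. ennreal (\<phi> x)" 1 t] P by (simp add: add.commute)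
    also have "(\<integral>\<^sup>+x. \<integral>\<^sup>+y. inside (x - t) (x + t) y * ennreal (\<phi> y) \<partial>lborel \<partial>lborel) = ennreal (2 * t * P)"
      using t P by (subst nn_integral_inside_translate) (auto simp: ennreal_mult)
    also have "(\<integral>\<^sup>+x. \<integral>\<^sup>+y. inside (x - t) (x + t) y * ennreal (\<psi> y) \<partial>lborel \<partial>lborel) = ennreal (2 * t * Q)"
      using t Q by (subst nn_integral_inside_translate) (auto simp: ennreal_mult)
    also have "ennreal (1 / 2) * (ennreal P + ennreal P) + ennreal (exp (t / 2) / 4) * ennreal (2 * t * P) + ennreal (exp (t / 2) / 2) * ennreal (2 * t * Q)
      = ennreal (P + exp (t / 2) / 4 * (2 * t * P) + exp (t / 2) / 2 * (2 * t * Q))"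
    proof -
      have "ennreal (1 / 2) * (ennreal P + ennreal P) = ennreal (1 / 2 * (P + P))"
        using P(2) by (simp only: ennreal_plus ennreal_mult)
      moreover have "ennreal (exp (t / 2) / 4) * ennreal (2 * t * P) = ennreal (exp (t / 2) / 4 * (2 * t * P))"
        using t P(2) by (intro ennreal_mult[symmetric]) auto
      moreover have "ennreal (exp (t / 2) / 2) * ennreal (2 * t * Q) = ennreal (exp (t / 2) / 2 * (2 * t * Q))"
        using t Q(2) by (intro ennreal_mult[symmetric]) auto
      ultimately show ?thesis using t P(2) Q(2) by (simp only:) (simp add: ennreal_plus)
    qed
    also have "\<dots> \<le> ennreal C"
      unfolding C_def using t P(2) Q(2) by (intro ennreal_leI add_mono mult_mono divide_right_mono order_refl) auto
    finally show ?thesis .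
  qed
  moreover have "C \<ge> 0" unfolding C_def using P(2) Q(2) by auto
  ultimately show ?thesis by blast
qed

sublocale wave "\<lambda>x. \<psi> x + d\<phi> x" "\<lambda>x. \<psi> x - d\<phi> x" source
proof
  show "integrable lborel (\<lambda>x. \<psi> x + d\<phi> x)" "integrable lborel (\<lambda>x. \<psi> x - d\<phi> x)"
    using psi_int dphi_int by auto
  show "case_prod source \<in> borel_measurable (borel \<Otimes>\<^sub>M borel)" by measurable
  show "0 \<le> source t x" for t x by (rule source_nonneg)
  show "\<exists>B\<ge>0. \<forall>t x. 0 \<le> t \<longrightarrow> t \<le> T \<longrightarrow> source t x \<le> B" for T
  proof (intro exI[of _ "m * exp (\<bar>T\<bar> / 2)"] conjI allI impI)
    fix t x :: real assume "0 \<le> t" "t \<le> T"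
    then have "m * exp (\<bar>t\<bar> / 2) \<le> m * exp (\<bar>T\<bar> / 2)" using m by simp
    then show "source t x \<le> m * exp (\<bar>T\<bar> / 2)" using source_le W_le order_trans by meson
  qed (use m in simp)
  show "\<exists>C\<ge>0. \<forall>t. 0 \<le> t \<longrightarrow> t \<le> T \<longrightarrow> Lpow 1 (source t) \<le> ennreal C" for T
  proof -
    obtain C where "C \<ge> 0" "\<And>t. 0 \<le> t \<Longrightarrow> t \<le> T \<Longrightarrow> Lpow 1 (W t) \<le> ennreal C" using W_L1_bound by blast
    moreover have "Lpow 1 (source t) \<le> Lpow 1 (W t)" for t
      using source_nonneg source_le W_nonneg by (intro Lpow_mono_AE) auto
    ultimately show ?thesis using order_trans by blast
  qed
qed

text \<open>The fixed point equation of \<open>sol\<close>, rewritten in time and space and in real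
  numbers, is d'Alembert's formula. The source was defined from \<open>W\<close>, so this closes the
  loop and transfers the regularity of \<open>w\<close> to \<open>W\<close>.\<close>

lemma w_eq_W:
  assumes t: "0 \<le> t"
  shows "w t x = W t x"
proof -
  have mone: "z + (-1) * (a - b) = z - (a - b)" for z a b :: real by simp
  define R where "R \<tau> = (LBINT y:{..x + (t - \<tau>)}. source \<tau> y) - (LBINT y:{..x - (t - \<tau>)}. source \<tau> y)" for \<tau>
  have iR: "set_integrable lborel {0..t} R"
    using set_integral_diff(1)[OF h_primitive_integrable[OF t, of x 1] h_primitive_integrable[OF t, of x "-1"]]
    unfolding R_def mone by simp
  have R: "ennreal (R \<tau>) = (\<integral>\<^sup>+y. inside (x - (t - \<tau>)) (x + (t - \<tau>)) y * ennreal (source \<tau> y) \<partial>lborel) \<and> 0 \<le> R \<tau>"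
    if \<tau>: "\<tau> \<in> {0..t}" for \<tau>
  proof -
    have i: "integrable lborel (source \<tau>)" using \<tau> by (intro h_integrable) simp
    have eq: "R \<tau> = (LINT y|lborel. indicator {x - (t - \<tau>)..x + (t - \<tau>)} y * source \<tau> y)"
      unfolding R_def using primitive_diff[OF i, of "x - (t - \<tau>)" "x + (t - \<tau>)"] \<tau> by (simp add: set_lebesgue_integral_def)
    have ii: "integrable lborel (\<lambda>y. indicator {x - (t - \<tau>)..x + (t - \<tau>)} y * source \<tau> y)"
      using integrable_mult_indicator[of "{x - (t - \<tau>)..x + (t - \<tau>)}" lborel "source \<tau>"] i by simp
    have "ennreal (R \<tau>) = (\<integral>\<^sup>+y. ennreal (indicator {x - (t - \<tau>)..x + (t - \<tau>)} y * source \<tau> y) \<partial>lborel)"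
      unfolding eq using ii source_nonneg by (subst nn_integral_eq_integral) auto
    also have "\<dots> = (\<integral>\<^sup>+y. inside (x - (t - \<tau>)) (x + (t - \<tau>)) y * ennreal (source \<tau> y) \<partial>lborel)"
      by (intro nn_integral_cong) (auto simp: inside_def indicator_def)
    finally show ?thesis unfolding eq using source_nonneg by (auto intro!: Bochner_Integration.integral_nonneg)
  qed
  have "Eop (rhs' sol) (x - t) (x + t) = ennreal (1 / 2) * (\<integral>\<^sup>+\<tau>. indicator {0..t} \<tau> *
    (\<integral>\<^sup>+y. inside (x - (t - \<tau>)) (x + (t - \<tau>)) y * (ennreal 1 * rhs' sol (y - \<tau>) (y + \<tau>)) \<partial>lborel) \<partial>lborel)"
    by (rule Kop_time_space) measurable
  also have "\<dots> = ennreal (1 / 2) * (\<integral>\<^sup>+\<tau>. ennreal (indicator {0..t} \<tau> * R \<tau>) \<partial>lborel)"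
  proof (intro arg_cong[where f="\<lambda>x. _ * x"] nn_integral_cong)
    fix \<tau>
    have s: "ennreal 1 * rhs' sol (y - \<tau>) (y + \<tau>) = ennreal (source \<tau> y)" if "0 \<le> \<tau>" for y
      using that unfolding rhs'_def source_def W_def by simp
    show "indicator {0..t} \<tau> * (\<integral>\<^sup>+y. inside (x - (t - \<tau>)) (x + (t - \<tau>)) y * (ennreal 1 * rhs' sol (y - \<tau>) (y + \<tau>)) \<partial>lborel)
      = ennreal (indicator {0..t} \<tau> * R \<tau>)"
      using R[of \<tau>] by (cases "\<tau> \<in> {0..t}") (auto simp: s simp del: ennreal_1)
  qed
  also have "(\<integral>\<^sup>+\<tau>. ennreal (indicator {0..t} \<tau> * R \<tau>) \<partial>lborel) = ennreal (LBINT \<tau>:{0..t}. R \<tau>)"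
    unfolding set_lebesgue_integral_def using iR R
    by (subst nn_integral_eq_integral) (auto simp: set_integrable_def indicator_def intro!: AE_I2)
  finally have E: "Eop (rhs' sol) (x - t) (x + t) = ennreal (1 / 2) * ennreal (LBINT \<tau>:{0..t}. R \<tau>)" .
  define S where "S = (LBINT y:{x - t..x + t}. \<psi> y)"
  have S0: "S \<ge> 0" unfolding S_def set_lebesgue_integral_def using psi_nonneg by (intro Bochner_Integration.integral_nonneg) auto
  have S: "(\<integral>\<^sup>+y. inside (x - t) (x + t) y * ennreal (\<psi> y) \<partial>lborel) = ennreal S"
  proof -
    have "(\<integral>\<^sup>+y. inside (x - t) (x + t) y * ennreal (\<psi> y) \<partial>lborel) = (\<integral>\<^sup>+y. ennreal (indicator {x - t..x + t} y * \<psi> y) \<partial>lborel)"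
      by (intro nn_integral_cong) (auto simp: inside_def indicator_def)
    also have "\<dots> = ennreal S"
      unfolding S_def set_lebesgue_integral_def
      using integrable_mult_indicator[of "{x - t..x + t}" lborel \<psi>] psi_int psi_nonneg
      by (subst nn_integral_eq_integral) auto
    finally show ?thesis .
  qed
  have R0: "0 \<le> (LBINT \<tau>:{0..t}. R \<tau>)"
    unfolding set_lebesgue_integral_def using R by (intro Bochner_Integration.integral_nonneg) (auto simp: indicator_def)
  have "sol (x - t) (x + t) = ennreal (1 / 2 * (\<phi> (x - t) + \<phi> (x + t)) + 1 / 2 * S + 1 / 2 * (LBINT \<tau>:{0..t}. R \<tau>))"
  proof -
    have 1: "ennreal (1 / 2) * (ennreal (\<phi> (x - t)) + ennreal (\<phi> (x + t))) = ennreal (1 / 2 * (\<phi> (x - t) + \<phi> (x + t)))"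
      using phi_nonneg by (simp only: ennreal_plus ennreal_mult add_nonneg_nonneg)
    have 2: "ennreal (1 / 2) * ennreal S = ennreal (1 / 2 * S)" using S0 by (intro ennreal_mult[symmetric]) auto
    have 3: "ennreal (1 / 2) * ennreal (LBINT \<tau>:{0..t}. R \<tau>) = ennreal (1 / 2 * (LBINT \<tau>:{0..t}. R \<tau>))"
      using R0 by (intro ennreal_mult[symmetric]) auto
    show ?thesis
      unfolding sol_fixed_point[of "x - t" "x + t"] free_def E S 1 2 3
      using phi_nonneg S0 R0 by (simp only: ennreal_plus mult_nonneg_nonneg add_nonneg_nonneg zero_le_divide_1_iff zero_le_numeral)
  qed
  then have "W t x = 1 / 2 * (\<phi> (x - t) + \<phi> (x + t)) + 1 / 2 * S + 1 / 2 * (LBINT \<tau>:{0..t}. R \<tau>)"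
    unfolding W_def using phi_nonneg[of "x - t"] phi_nonneg[of "x + t"] S0 R0 by (simp only:) (rule enn2real_ennreal, simp)
  moreover have "(LBINT y:{..x + t}. \<psi> y + d\<phi> y) = (LBINT y:{..x + t}. \<psi> y) + \<phi> (x + t)"
    "(LBINT y:{..x - t}. \<psi> y - d\<phi> y) = (LBINT y:{..x - t}. \<psi> y) - \<phi> (x - t)"
  proof -
    have a: "set_integrable lborel {..z} \<psi>" "set_integrable lborel {..z} d\<phi>" for z
      unfolding set_integrable_def using psi_int dphi_int by (auto intro!: integrable_mult_indicator simp del: real_scaleR_def)
    show "(LBINT y:{..x + t}. \<psi> y + d\<phi> y) = (LBINT y:{..x + t}. \<psi> y) + \<phi> (x + t)"
      unfolding phi_eq by (rule set_integral_add(2)[OF a])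
    show "(LBINT y:{..x - t}. \<psi> y - d\<phi> y) = (LBINT y:{..x - t}. \<psi> y) - \<phi> (x - t)"
      unfolding phi_eq by (rule set_integral_diff(2)[OF a])
  qed
  moreover have "S = (LBINT y:{..x + t}. \<psi> y) - (LBINT y:{..x - t}. \<psi> y)"
    unfolding S_def using primitive_diff[OF psi_int, of "x - t" "x + t"] t by simp
  ultimately show ?thesis unfolding w_def R_def[symmetric] by (simp add: field_simps)
qed

end

section \<open>The mild formulation\<close>

lemma bessel_I_measurable [measurable]: "bessel_I l \<in> borel_measurable borel"
  unfolding bessel_I_def[abs_def] by measurable

text \<open>The common form of the integrals in both propagators: for \<open>a = x - t\<close> and
  \<open>b = x + t\<close> the argument of \<open>k\<close> is
  \<open>t\<^sup>2 - (x - y)\<^sup>2\<close>.\<close>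

definition kernel_integral :: "(real \<Rightarrow> real) \<Rightarrow> (real \<Rightarrow> real) \<Rightarrow> real \<Rightarrow> real \<Rightarrow> real" where
  "kernel_integral k f a b = (LINT y|lborel. indicator {a..b} y * (k ((y - a) * (b - y)) * f y))"

lemma propagator_eq:
  "propagator t f x = exp (- t / 2) / 2 * kernel_integral I0 f (x - t) (x + t)"
proof -
  have "kernel_integral I0 f (x - t) (x + t) = (LINT y|lborel. indicator {x - t..x + t} (x + (-1) * y) *
      (I0 ((x + (-1) * y - (x - t)) * (x + t - (x + (-1) * y))) * f (x + (-1) * y)))"
    unfolding kernel_integral_def by (subst lborel_integral_real_affine[where c="-1" and t=x]) auto
  also have "\<dots> = (LINT y|lborel. indicator {-t..t} y * (bessel_I 0 (sqrt (t\<^sup>2 - y\<^sup>2) / 2) * f (x - y)))"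
  proof (intro Bochner_Integration.integral_cong refl)
    fix y
    have s: "(x + (-1) * y - (x - t)) * (x + t - (x + (-1) * y)) = t\<^sup>2 - y\<^sup>2"
      by (simp add: power2_eq_square algebra_simps)
    show "indicator {x - t..x + t} (x + (-1) * y) * (I0 ((x + (-1) * y - (x - t)) * (x + t - (x + (-1) * y))) * f (x + (-1) * y))
      = indicator {-t..t} y * (bessel_I 0 (sqrt (t\<^sup>2 - y\<^sup>2) / 2) * f (x - y))"
    proof (cases "y \<in> {-t..t}")
      case True
      then have "y\<^sup>2 \<le> t\<^sup>2" by (intro abs_le_square_iff[THEN iffD1]) auto
      then have "bessel_I 0 (sqrt (t\<^sup>2 - y\<^sup>2) / 2) = I0 (t\<^sup>2 - y\<^sup>2)" by (intro bessel_I_0_eq) simp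
      then show ?thesis using True unfolding s by (auto simp: indicator_def)
    qed (auto simp: indicator_def)
  qed
  finally have "kernel_integral I0 f (x - t) (x + t) = (LINT y|lborel. indicator {-t..t} y * (bessel_I 0 (sqrt (t\<^sup>2 - y\<^sup>2) / 2) * f (x - y)))" .
  moreover have "(LINT y|lborel. indicator {-t..t} y * (exp (- t / 2) * bessel_I 0 (sqrt (t\<^sup>2 - y\<^sup>2) / 2) * f (x - y)))
    = exp (- t / 2) * (LINT y|lborel. indicator {-t..t} y * (bessel_I 0 (sqrt (t\<^sup>2 - y\<^sup>2) / 2) * f (x - y)))"
    by (subst integral_mult_right_zero[symmetric]) (simp add: mult_ac)
  ultimately show ?thesis
    unfolding propagator_def set_lebesgue_integral_def by simp
qed

lemma kernel_integrable:
  assumes f: "locally_integrable f" and [measurable]: "k \<in> borel_measurable borel"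
    and k: "\<And>s. 0 \<le> s \<Longrightarrow> 0 \<le> k s" "\<And>s s'. 0 \<le> s \<Longrightarrow> s \<le> s' \<Longrightarrow> k s \<le> k s'"
  shows "integrable lborel (\<lambda>y. indicator {a..b} y * (k ((y - a) * (b - y)) * f y))"
proof -
  have "integrable lborel (\<lambda>y. f y * (indicator {a..b} y * k ((y - a) * (b - y))))"
  proof (rule integrable_mult_compact_support[OF f])
    fix y
    show "\<bar>indicator {a..b} y * k ((y - a) * (b - y))\<bar> \<le> k (((b - a) / 2)\<^sup>2) * indicator {a..b} y"
      using k(1)[of "(y - a) * (b - y)"] k(2)[OF _ mult_le_half_sum_square, of y a b] by (auto simp: indicator_def)
  qed measurable
  then show ?thesis by (simp add: mult_ac)
qed

lemma I0_kernel_integrable: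
  "locally_integrable f \<Longrightarrow> integrable lborel (\<lambda>y. indicator {a..b} y * (I0 ((y - a) * (b - y)) * f y))"
  by (intro kernel_integrable I0_nonneg I0_mono) auto

lemma I1_kernel_integrable:
  "locally_integrable f \<Longrightarrow> integrable lborel (\<lambda>y. indicator {a..b} y * (I1 ((y - a) * (b - y)) * f y))"
  by (intro kernel_integrable I1_nonneg I1_mono) auto

lemma dt_propagator_eq:
  assumes f: "locally_integrable f" and [measurable]: "f \<in> borel_measurable borel"
  shows "dt_propagator t f x = exp (- t / 2) * ((f (x + t) + f (x - t)) / 2) +
    exp (- t / 2) * (t * kernel_integral I1 f (x - t) (x + t) - kernel_integral I0 f (x - t) (x + t) / 4)"
proof -
  define F where "F y = indicator {x - t..x + t} y * ((t * I1 ((y - (x - t)) * (x + t - y)) - I0 ((y - (x - t)) * (x + t - y)) / 4) * f y)" for y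
  have "(LINT y|lborel. F y) = (LINT y|lborel. t * (indicator {x - t..x + t} y * (I1 ((y - (x - t)) * (x + t - y)) * f y))
     - (indicator {x - t..x + t} y * (I0 ((y - (x - t)) * (x + t - y)) * f y)) / 4)"
    unfolding F_def by (intro Bochner_Integration.integral_cong) (auto simp: field_simps)
  also have "\<dots> = t * kernel_integral I1 f (x - t) (x + t) - kernel_integral I0 f (x - t) (x + t) / 4"
    unfolding kernel_integral_def
    by (subst Bochner_Integration.integral_diff) (intro integrable_mult_right I1_kernel_integrable integrable_divide_zero impI I0_kernel_integrable f | simp)+
  finally have F: "(LINT y|lborel. F y) = t * kernel_integral I1 f (x - t) (x + t) - kernel_integral I0 f (x - t) (x + t) / 4" .
  have "(LINT y|lborel. F y) = (LINT y|lborel. F (x + (-1) * y))"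
    by (subst lborel_integral_real_affine[where c="-1" and t=x]) auto
  then have "exp (- t / 2) * (LINT y|lborel. F y) = (LINT y|lborel. exp (- t / 2) * F (x + (-1) * y))" by simp
  also have "\<dots> = (LBINT y:{-t..t}. (let \<omega> = sqrt (t\<^sup>2 - y\<^sup>2) in
          exp (- t / 2) / 4 * (t / \<omega> * bessel_I 1 (\<omega> / 2) - bessel_I 0 (\<omega> / 2)) * f (x - y)))"
    unfolding set_lebesgue_integral_def Let_def
  proof (rule integral_cong_AE)
    \<comment> \<open>The points \<open>y = t\<close> and \<open>y = - t\<close> are discarded:
      there \<open>\<omega> = 0\<close>, and the quotient \<open>t / \<omega>\<close> takes the
      conventional value 0 instead of the continuous extension. Elsewhere the factor
      \<open>4\<close> from \<open>bessel_I_1_eq\<close> cancels the prefactor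
      \<open>1/4\<close>.\<close>
    show "AE y in lborel. exp (- t / 2) * F (x + (-1) * y) = indicator {-t..t} y *\<^sub>R
      (exp (- t / 2) / 4 * (t / sqrt (t\<^sup>2 - y\<^sup>2) * bessel_I 1 (sqrt (t\<^sup>2 - y\<^sup>2) / 2) - bessel_I 0 (sqrt (t\<^sup>2 - y\<^sup>2) / 2)) * f (x - y))"
      using AE_lborel_singleton[of t] AE_lborel_singleton[of "- t"]
    proof eventually_elim
      case (elim y)
      show ?case
      proof (cases "y \<in> {-t..t}")
        case True
        have s: "(x + (-1) * y - (x - t)) * (x + t - (x + (-1) * y)) = t\<^sup>2 - y\<^sup>2"
          by (simp add: power2_eq_square algebra_simps)
        have "0 < (t - y) * (t + y)" using True elim by (intro mult_pos_pos) auto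
        then have pos: "t\<^sup>2 - y\<^sup>2 > 0" by (simp add: power2_eq_square algebra_simps)
        define r where "r = sqrt (t\<^sup>2 - y\<^sup>2)"
        have r: "r > 0" unfolding r_def using pos by simp
        have "t / r * bessel_I 1 (r / 2) = 4 * t * I1 (t\<^sup>2 - y\<^sup>2)"
          unfolding r_def bessel_I_1_eq[OF less_imp_le[OF pos]] using r by (simp add: r_def)
        moreover have "bessel_I 0 (r / 2) = I0 (t\<^sup>2 - y\<^sup>2)" unfolding r_def using pos by (intro bessel_I_0_eq) simp
        ultimately show ?thesis unfolding F_def s r_def[symmetric] using True by (auto simp: indicator_def field_simps)
      qed (auto simp: F_def indicator_def)
    qed
  qed (auto simp: F_def)
  finally show ?thesis unfolding dt_propagator_def F by simp
qed

lemma kernel_integral_cong_AE: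
  assumes [measurable]: "k \<in> borel_measurable borel" "f \<in> borel_measurable borel" "g \<in> borel_measurable borel"
    and "AE y in lborel. f y = g y"
  shows "kernel_integral k f a b = kernel_integral k g a b"
  unfolding kernel_integral_def
proof (rule integral_cong_AE)
  show "AE y in lborel. indicator {a..b} y * (k ((y - a) * (b - y)) * f y) = indicator {a..b} y * (k ((y - a) * (b - y)) * g y)"
    using assms(4) by eventually_elim simp
qed measurable

lemma kernel_integral_cmult: "kernel_integral k (\<lambda>y. c * f y) a b = c * kernel_integral k f a b"
  unfolding kernel_integral_def by (subst integral_mult_right_zero[symmetric]) (simp add: mult_ac)

lemma kernel_integral_nn:
  assumes [measurable]: "k \<in> borel_measurable borel" "f \<in> borel_measurable borel"
    and "\<And>s. 0 \<le> s \<Longrightarrow> 0 \<le> k s" "\<And>y. 0 \<le> f y"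
  shows "kernel_integral k f a b = enn2real (\<integral>\<^sup>+y. inside a b y * (ennreal (k ((y - a) * (b - y))) * ennreal (f y)) \<partial>lborel)"
proof -
  have "kernel_integral k f a b = enn2real (\<integral>\<^sup>+y. ennreal (indicator {a..b} y * (k ((y - a) * (b - y)) * f y)) \<partial>lborel)"
    unfolding kernel_integral_def using assms by (intro integral_eq_nn_integral) (auto simp: indicator_def)
  also have "(\<integral>\<^sup>+y. ennreal (indicator {a..b} y * (k ((y - a) * (b - y)) * f y)) \<partial>lborel)
    = (\<integral>\<^sup>+y. inside a b y * (ennreal (k ((y - a) * (b - y))) * ennreal (f y)) \<partial>lborel)"
    using assms by (intro nn_integral_cong) (auto simp: inside_def indicator_def ennreal_mult)
  finally show ?thesis .
qed

lemma enn2real_cmult: "0 \<le> c \<Longrightarrow> enn2real (ennreal c * X) = c * enn2real X"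
  by (simp only: enn2real_mult enn2real_ennreal)

context small_Sobolev_data
begin

lemma lin_real:
  assumes t: "0 \<le> t"
  shows "enn2real (lin (x - t) (x + t)) = (\<phi> (x - t) + \<phi> (x + t)) / 2
    + t * kernel_integral I1 \<phi> (x - t) (x + t) + kernel_integral I0 \<psi> (x - t) (x + t) / 2"
proof -
  define N1 where "N1 = (\<integral>\<^sup>+y. inside (x - t) (x + t) y * (ennreal (t * I1 ((y - (x - t)) * (x + t - y))) * ennreal (\<phi> y)) \<partial>lborel)"
  define N0 where "N0 = (\<integral>\<^sup>+y. inside (x - t) (x + t) y * (ennreal (I0 ((y - (x - t)) * (x + t - y))) * ennreal (\<psi> y)) \<partial>lborel)"
  have t2: "(x + t - (x - t)) / 2 = t" by simp
  have lin: "lin (x - t) (x + t) = ennreal (1 / 2) * (ennreal (\<phi> (x - t)) + ennreal (\<phi> (x + t))) + N1 + ennreal (1 / 2) * N0"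
    unfolding N1_def N0_def by (subst linear_solution_eq) (simp_all only: phi_measurable psi_measurable t2)
  then have fin: "N1 < \<infinity>" "ennreal (1 / 2) * N0 < \<infinity>" using lin_finite[of "x - t" "x + t"] by auto
  have half: "ennreal (1 / 2) * (ennreal (\<phi> (x - t)) + ennreal (\<phi> (x + t))) = ennreal ((\<phi> (x - t) + \<phi> (x + t)) / 2)"
  proof -
    have "ennreal (1 / 2) * (ennreal (\<phi> (x - t)) + ennreal (\<phi> (x + t))) = ennreal (1 / 2 * (\<phi> (x - t) + \<phi> (x + t)))"
      using phi_nonneg by (simp only: ennreal_plus ennreal_mult add_nonneg_nonneg)
    then show ?thesis by simp
  qed
  have e1: "enn2real N1 = t * kernel_integral I1 \<phi> (x - t) (x + t)"
  proof -
    have "enn2real N1 = kernel_integral (\<lambda>s. t * I1 s) \<phi> (x - t) (x + t)"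
      unfolding N1_def by (rule kernel_integral_nn[symmetric]) (use t I1_nonneg phi_nonneg in auto)
    also have "\<dots> = t * kernel_integral I1 \<phi> (x - t) (x + t)"
      unfolding kernel_integral_def by (subst integral_mult_right_zero[symmetric]) (simp add: mult_ac)
    finally show ?thesis .
  qed
  have e0: "enn2real N0 = kernel_integral I0 \<psi> (x - t) (x + t)"
    unfolding N0_def by (rule kernel_integral_nn[symmetric]) (use I0_nonneg psi_nonneg in auto)
  have "enn2real (lin (x - t) (x + t)) = (\<phi> (x - t) + \<phi> (x + t)) / 2 + enn2real N1 + enn2real (ennreal (1 / 2) * N0)"
    unfolding lin half using fin phi_nonneg[of "x - t"] phi_nonneg[of "x + t"]
    by (simp add: enn2real_plus less_top)
  then show ?thesis using enn2real_cmult[of "1 / 2" N0] unfolding e1 e0 by simp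
qed

text \<open>Since \<open>u0 + u1 = - (\<phi> / 2 + \<psi>)\<close>, the \<open>\<phi> / 2\<close>
  inside \<open>propagator\<close> contributes a quarter of the \<open>I0\<close> integral of
  \<open>\<phi>\<close>, and this cancels the \<open>I0\<close> term of
  \<open>dt_propagator\<close>. What remains is the formula for \<open>lin\<close>; this explains
  why the half of \<open>u0\<close> belongs to \<open>\<psi>\<close>.\<close>

lemma linear_part:
  assumes t: "0 \<le> t"
    and [measurable]: "u0 \<in> borel_measurable borel" "u1 \<in> borel_measurable borel"
    and u0: "AE x in lborel. u0 x = - \<phi> x" and u1: "AE x in lborel. u1 x + 1 / 2 * u0 x = - \<psi> x"
    and li: "locally_integrable u0"
  shows "AE x in lborel. propagator t (\<lambda>z. u0 z + u1 z) x + dt_propagator t u0 x = - exp (- t / 2) * enn2real (lin (x - t) (x + t))"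
proof -
  \<comment> \<open>The point values of \<open>u0\<close> at \<open>x + t\<close> and
    \<open>x - t\<close> are known only for almost every \<open>x\<close>, because translates of a
    null set are null; the integrals cause no exception.\<close>
  have "AE x in lborel. u0 (t + 1 * x) = - \<phi> (t + 1 * x)" "AE x in lborel. u0 (- t + 1 * x) = - \<phi> (- t + 1 * x)"
    using u0 by (intro AE_borel_affine; simp)+
  then have "AE x in lborel. u0 (x + t) = - \<phi> (x + t) \<and> u0 (x - t) = - \<phi> (x - t)"
    by eventually_elim (simp add: add.commute)
  then show ?thesis
  proof eventually_elim
    case (elim x)
    have lphi: "locally_integrable \<phi>" "locally_integrable \<psi>"
      using phi_int psi_int by (auto intro: integrable_imp_locally_integrable)
    have "AE y in lborel. u0 y + u1 y = (-1) * ((1 / 2) * \<phi> y + \<psi> y)"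
      using u0 u1 by eventually_elim simp
    then have "kernel_integral I0 (\<lambda>z. u0 z + u1 z) (x - t) (x + t) = kernel_integral I0 (\<lambda>y. (-1) * ((1 / 2) * \<phi> y + \<psi> y)) (x - t) (x + t)"
      by (intro kernel_integral_cong_AE) auto
    also have "\<dots> = - kernel_integral I0 (\<lambda>y. (1 / 2) * \<phi> y + \<psi> y) (x - t) (x + t)"
      by (subst kernel_integral_cmult) simp
    also have "kernel_integral I0 (\<lambda>y. (1 / 2) * \<phi> y + \<psi> y) (x - t) (x + t) =
      (LINT y|lborel. (1 / 2) * (indicator {x - t..x + t} y * (I0 ((y - (x - t)) * (x + t - y)) * \<phi> y))
        + indicator {x - t..x + t} y * (I0 ((y - (x - t)) * (x + t - y)) * \<psi> y))"
      unfolding kernel_integral_def by (intro Bochner_Integration.integral_cong) (auto simp: algebra_simps)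
    also have "\<dots> = (1 / 2) * kernel_integral I0 \<phi> (x - t) (x + t) + kernel_integral I0 \<psi> (x - t) (x + t)"
      unfolding kernel_integral_def
      using I0_kernel_integrable[OF lphi(1), of "x - t" "x + t"] I0_kernel_integrable[OF lphi(2), of "x - t" "x + t"]
      by (subst Bochner_Integration.integral_add) auto
    finally have k: "kernel_integral I0 (\<lambda>z. u0 z + u1 z) (x - t) (x + t)
      = - ((1 / 2) * kernel_integral I0 \<phi> (x - t) (x + t) + kernel_integral I0 \<psi> (x - t) (x + t))" .
    have k': "kernel_integral k u0 (x - t) (x + t) = - kernel_integral k \<phi> (x - t) (x + t)"
      if [measurable]: "k \<in> borel_measurable borel" for k
    proof -
      have "kernel_integral k u0 (x - t) (x + t) = kernel_integral k (\<lambda>y. (-1) * \<phi> y) (x - t) (x + t)"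
        using u0 by (intro kernel_integral_cong_AE) auto
      also have "\<dots> = - kernel_integral k \<phi> (x - t) (x + t)" by (subst kernel_integral_cmult) simp
      finally show ?thesis .
    qed
    show ?case
      unfolding propagator_eq dt_propagator_eq[OF li assms(2)] lin_real[OF t] k k'[OF I0_measurable] k'[OF I1_measurable]
      using elim by (simp add: algebra_simps)
  qed
qed

definition u :: "real \<Rightarrow> real \<Rightarrow> real" where
  "u t x = - exp (- t / 2) * W t x"

text \<open>By \<open>W_le\<close> the weighted solution never exceeds \<open>m\<close>, so the
  truncation inside \<open>absorption\<close> is inactive for nonnegative times.\<close>

lemma absorbed_eq:
  assumes "0 \<le> \<tau>"
  shows "absorbed (y - \<tau>) (y + \<tau>) = ennreal (exp (\<tau> / 2) * \<bar>u \<tau> y\<bar> powr p)"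
proof -
  have "exp (- \<tau> / 2) * W \<tau> y \<le> exp (- \<tau> / 2) * (m * exp (\<bar>\<tau>\<bar> / 2))"
    by (intro mult_left_mono W_le) auto
  also have "\<dots> = m" using assms by (simp add: mult.left_commute flip: exp_add)
  finally have "min (exp (- \<tau> / 2) * W \<tau> y) m = \<bar>u \<tau> y\<bar>"
    unfolding u_def using W_nonneg[of \<tau> y] by (simp add: abs_mult)
  moreover have "(y + \<tau> - (y - \<tau>)) / 2 = \<tau>" by simp
  ultimately show ?thesis unfolding absorbed_def absorption_def W_def[symmetric] by (simp only:)
qed

text \<open>The weight \<open>exp (\<tau> / 2)\<close> contained in \<open>absorbed\<close> and the
  factor \<open>exp (- (t - \<tau>) / 2)\<close> of the propagator combine to
  \<open>exp (- t / 2)\<close>, which leaves the time integral.\<close>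

lemma duhamel_part:
  assumes t: "0 \<le> t"
  shows "(LBINT \<tau>:{0..t}. propagator (t - \<tau>) (\<lambda>z. \<bar>u \<tau> z\<bar> powr p) x)
    = exp (- t / 2) * enn2real (Kop I0 absorbed (x - t) (x + t))"
proof -
  have absorbed_compose: "(\<lambda>x. absorbed (f1 x) (f2 x)) \<in> borel_measurable N"
    if [measurable]: "f1 \<in> borel_measurable N" "f2 \<in> borel_measurable N" for f1 f2 and N :: "'z measure"
  proof -
    have "(\<lambda>x. case_prod absorbed (f1 x, f2 x)) \<in> borel_measurable N" by measurable
    then show ?thesis by simp
  qed
  note [measurable] = absorbed_compose
  have [measurable]: "u \<tau> \<in> borel_measurable borel" for \<tau> unfolding u_def by measurable
  define N where "N \<tau> = (\<integral>\<^sup>+y. inside (x - (t - \<tau>)) (x + (t - \<tau>)) y * (ennreal (I0 ((t - \<tau>)\<^sup>2 - (x - y)\<^sup>2)) * absorbed (y - \<tau>) (y + \<tau>)) \<partial>lborel)" for \<tau>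
  have [measurable]: "N \<in> borel_measurable borel" unfolding N_def by measurable
  have K: "Kop I0 absorbed (x - t) (x + t) = ennreal (1 / 2) * (\<integral>\<^sup>+\<tau>. indicator {0..t} \<tau> * N \<tau> \<partial>lborel)"
    unfolding N_def by (rule Kop_time_space) measurable
  have propagator_N: "propagator (t - \<tau>) (\<lambda>z. \<bar>u \<tau> z\<bar> powr p) x = exp (- t / 2) / 2 * enn2real (N \<tau>)" if \<tau>: "\<tau> \<in> {0..t}" for \<tau>
  proof -
    have "exp (\<tau> / 2) * kernel_integral I0 (\<lambda>z. \<bar>u \<tau> z\<bar> powr p) (x - (t - \<tau>)) (x + (t - \<tau>))
      = kernel_integral I0 (\<lambda>z. exp (\<tau> / 2) * \<bar>u \<tau> z\<bar> powr p) (x - (t - \<tau>)) (x + (t - \<tau>))"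
      by (rule kernel_integral_cmult[symmetric])
    also have "\<dots> = enn2real (\<integral>\<^sup>+y. inside (x - (t - \<tau>)) (x + (t - \<tau>)) y * (ennreal (I0 ((y - (x - (t - \<tau>))) * (x + (t - \<tau>) - y)))
        * ennreal (exp (\<tau> / 2) * \<bar>u \<tau> y\<bar> powr p)) \<partial>lborel)"
      by (rule kernel_integral_nn) (use I0_nonneg in auto)
    also have "\<dots> = enn2real (N \<tau>)"
      unfolding N_def
    proof (intro arg_cong[where f=enn2real] nn_integral_cong)
      fix y
      have s: "(y - (x - (t - \<tau>))) * (x + (t - \<tau>) - y) = (t - \<tau>)\<^sup>2 - (x - y)\<^sup>2"
        by (simp add: power2_eq_square algebra_simps)
      have a: "absorbed (y - \<tau>) (y + \<tau>) = ennreal (exp (\<tau> / 2) * \<bar>u \<tau> y\<bar> powr p)" using \<tau> by (intro absorbed_eq) simp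
      show "inside (x - (t - \<tau>)) (x + (t - \<tau>)) y * (ennreal (I0 ((y - (x - (t - \<tau>))) * (x + (t - \<tau>) - y)))
        * ennreal (exp (\<tau> / 2) * \<bar>u \<tau> y\<bar> powr p))
        = inside (x - (t - \<tau>)) (x + (t - \<tau>)) y * (ennreal (I0 ((t - \<tau>)\<^sup>2 - (x - y)\<^sup>2)) * absorbed (y - \<tau>) (y + \<tau>))"
        unfolding s a ..
    qed
    finally have e: "exp (\<tau> / 2) * kernel_integral I0 (\<lambda>z. \<bar>u \<tau> z\<bar> powr p) (x - (t - \<tau>)) (x + (t - \<tau>)) = enn2real (N \<tau>)" .
    have ex: "exp (- (t - \<tau>) / 2) = exp (- t / 2) * exp (\<tau> / 2)" by (simp add: field_simps flip: exp_add)
    show ?thesis unfolding propagator_eq ex e[symmetric] by simp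
  qed
  have fin: "(\<integral>\<^sup>+\<tau>. indicator {0..t} \<tau> * N \<tau> \<partial>lborel) \<noteq> \<infinity>"
  proof
    assume "(\<integral>\<^sup>+\<tau>. indicator {0..t} \<tau> * N \<tau> \<partial>lborel) = \<infinity>"
    then have "Kop I0 absorbed (x - t) (x + t) = \<infinity>" unfolding K by (simp add: ennreal_mult_top)
    then show False using sol_plus_duhamel[of "x - t" "x + t"] lin_finite[of "x - t" "x + t"] by simp
  qed
  have "(LBINT \<tau>:{0..t}. propagator (t - \<tau>) (\<lambda>z. \<bar>u \<tau> z\<bar> powr p) x)
    = (LINT \<tau>|lborel. exp (- t / 2) / 2 * enn2real (indicator {0..t} \<tau> * N \<tau>))"
    unfolding set_lebesgue_integral_def
    by (intro Bochner_Integration.integral_cong) (auto simp: propagator_N indicator_def)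
  also have "\<dots> = exp (- t / 2) / 2 * (LINT \<tau>|lborel. enn2real (indicator {0..t} \<tau> * N \<tau>))" by simp
  also have "(LINT \<tau>|lborel. enn2real (indicator {0..t} \<tau> * N \<tau>)) = enn2real (\<integral>\<^sup>+\<tau>. ennreal (enn2real (indicator {0..t} \<tau> * N \<tau>)) \<partial>lborel)"
    by (rule integral_eq_nn_integral) auto
  also have "(\<integral>\<^sup>+\<tau>. ennreal (enn2real (indicator {0..t} \<tau> * N \<tau>)) \<partial>lborel) = (\<integral>\<^sup>+\<tau>. indicator {0..t} \<tau> * N \<tau> \<partial>lborel)"
  proof (rule nn_integral_cong_AE)
    \<comment> \<open>The total integral is finite, so for almost every \<open>\<tau>\<close> the
      inner integral is finite and \<open>enn2real\<close> loses nothing.\<close>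
    have "AE \<tau> in lborel. indicator {0..t} \<tau> * N \<tau> \<noteq> \<infinity>" using fin by (intro nn_integral_noteq_infinite) auto
    then show "AE \<tau> in lborel. ennreal (enn2real (indicator {0..t} \<tau> * N \<tau>)) = indicator {0..t} \<tau> * N \<tau>"
      by eventually_elim (simp add: less_top)
  qed
  finally have "(LBINT \<tau>:{0..t}. propagator (t - \<tau>) (\<lambda>z. \<bar>u \<tau> z\<bar> powr p) x)
    = exp (- t / 2) / 2 * enn2real (\<integral>\<^sup>+\<tau>. indicator {0..t} \<tau> * N \<tau> \<partial>lborel)" .
  moreover have "(0::real) \<le> 1 / 2" by simp
  ultimately show ?thesis unfolding K by (simp only: enn2real_cmult)
qed

text \<open>This is \<open>sol_plus_duhamel\<close> multiplied by \<open>- exp (- t / 2)\<close>,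
  with \<open>linear_part\<close> and \<open>duhamel_part\<close> identifying the two Bessel
  terms.\<close>

lemma mild_identity:
  assumes t: "0 \<le> t"
    and "u0 \<in> borel_measurable borel" "u1 \<in> borel_measurable borel"
    and "AE x in lborel. u0 x = - \<phi> x" "AE x in lborel. u1 x + 1 / 2 * u0 x = - \<psi> x"
    and "locally_integrable u0"
  shows "AE x in lborel. u t x = propagator t (\<lambda>z. u0 z + u1 z) x + dt_propagator t u0 x +
    (LBINT \<tau>:{0..t}. propagator (t - \<tau>) (\<lambda>z. \<bar>u \<tau> z\<bar> powr p) x)"
  using linear_part[OF assms]
proof eventually_elim
  case (elim x)
  have "Kop I0 absorbed (x - t) (x + t) \<le> lin (x - t) (x + t)"
    unfolding sol_plus_duhamel[symmetric] by simp
  then have "Kop I0 absorbed (x - t) (x + t) < \<infinity>" using lin_finite le_less_trans by blast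
  then have "enn2real (lin (x - t) (x + t)) = W t x + enn2real (Kop I0 absorbed (x - t) (x + t))"
    unfolding sol_plus_duhamel[symmetric] W_def using sol_finite[of "x - t" "x + t"] by (simp add: enn2real_plus)
  then show ?case unfolding elim duhamel_part[OF t] u_def[of t x] by (simp only:) (simp add: algebra_simps)
qed

end

section \<open>Small non-positive data\<close>

lemma Lpow_scaled_tendsto_0:
  assumes "\<And>t. f t \<in> borel_measurable borel" "g \<in> borel_measurable borel" "q > 0" "Lpow q g < \<infinity>"
    and "((\<lambda>t. Lpow q (\<lambda>x. f t x - g x)) \<longlongrightarrow> 0) F" "(c \<longlongrightarrow> (d::real)) F"
  shows "((\<lambda>t. Lpow q (\<lambda>x. c t * f t x - d * g x)) \<longlongrightarrow> 0) F"
proof -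
  note assms(1,2) [measurable]
  have "((\<lambda>t. c t - d) \<longlongrightarrow> 0) F" using assms(6) by (simp add: LIM_zero_iff)
  then have "((\<lambda>t. Lpow q (\<lambda>x. c t * (f t x - g x) + (c t - d) * g x)) \<longlongrightarrow> 0) F"
    using assms by (intro Lpow_add_tendsto_0 Lpow_bounded_cmult_tendsto_0[where d=d] Lpow_cmult_null_tendsto_0) auto
  moreover have "c t * (f t x - g x) + (c t - d) * g x = c t * f t x - d * g x" for t x
    by (simp add: algebra_simps)
  ultimately show ?thesis by simp
qed

lemma locally_integrable_measurable:
  assumes "locally_integrable f"
  shows "f \<in> borel_measurable borel"
proof (rule borel_measurable_LIMSEQ_real)
  show "(\<lambda>x. indicator {- real n..real n} x * f x) \<in> borel_measurable borel" for n
  proof -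
    have "integrable lborel (\<lambda>x. indicator {- real n..real n} x *\<^sub>R f x)"
      using assms unfolding locally_integrable_def set_integrable_def by blast
    then show ?thesis by auto
  qed
  fix x
  obtain N :: nat where N: "\<bar>x\<bar> \<le> real N" using real_arch_simple by blast
  have "eventually (\<lambda>n. indicator {- real n..real n} x * f x = f x) sequentially"
    by (rule eventually_sequentiallyI[of N]) (use N in \<open>auto simp: indicator_def\<close>)
  then show "(\<lambda>n. indicator {- real n..real n} x * f x) \<longlonglongrightarrow> f x" by (rule tendsto_eventually)
qed

text \<open>The chosen representative is itself a weak derivative, hence measurable and almost
  everywhere equal to \<open>h\<close>; so any convenient derivative may be used in the Sobolev
  norm.\<close>

lemma L_norm_weak_deriv:
  assumes "has_weak_deriv g h"
  shows "L_norm q (weak_deriv g) = L_norm q h"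
proof -
  have "has_weak_deriv g (weak_deriv g)" unfolding weak_deriv_def by (rule someI[of _ h]) (rule assms)
  then have "locally_integrable (weak_deriv g)" "locally_integrable h"
    using assms unfolding has_weak_deriv_def by auto
  then have [measurable]: "weak_deriv g \<in> borel_measurable borel" "h \<in> borel_measurable borel"
    by (auto intro: locally_integrable_measurable)
  show ?thesis
    using Lpow_cong_AE[OF weak_deriv_AE[OF assms]] by (simp add: L_norm_eq)
qed

lemma L_norm_1_eq:
  assumes "g \<in> borel_measurable borel"
  shows "L_norm 1 g = (LINT x|lborel. \<bar>g x\<bar>)"
  unfolding L_norm_def by simp

lemma nonneg_if_AE_nonneg:
  fixes f :: "real \<Rightarrow> real"
  assumes f: "continuous_on UNIV f" and AE: "AE x in lborel. 0 \<le> f x"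
  shows "0 \<le> f x"
proof (rule ccontr)
  assume "\<not> 0 \<le> f x"
  then have x: "x \<in> {y. f y < 0}" by simp
  have op: "open {y. f y < 0}" using f by (intro open_Collect_less continuous_intros)
  then obtain e where e: "e > 0" "ball x e \<subseteq> {y. f y < 0}" using x open_contains_ball by blast
  have "AE y in lborel. y \<notin> {y. f y < 0}" using AE by eventually_elim simp
  then have "emeasure lborel {y. f y < 0} = 0"
    using op by (subst (asm) AE_iff_null_sets[symmetric]) (auto simp: null_sets_def)
  moreover have "emeasure lborel (ball x e) \<le> emeasure lborel {y. f y < 0}"
    using e op by (intro emeasure_mono) auto
  moreover have "ball x e = {x - e<..<x + e}" by (auto simp: dist_real_def)
  ultimately show False using e(1) by simp
qed

section \<open>Regularity of the solution in space and time\<close>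

context small_Sobolev_data
begin

definition ut :: "real \<Rightarrow> real \<Rightarrow> real" where
  "ut t x = - exp (- t / 2) * (wt t x + (- 1 / 2) * W t x)"

definition ux :: "real \<Rightarrow> real \<Rightarrow> real" where
  "ux t x = - exp (- t / 2) * wx t x"

lemma u_measurable1 [measurable]: "u t \<in> borel_measurable borel"
  unfolding u_def by measurable

lemma ut_measurable1 [measurable]: "ut t \<in> borel_measurable borel"
  unfolding ut_def by measurable

lemma ux_measurable1 [measurable]: "ux t \<in> borel_measurable borel"
  unfolding ux_def by measurable

lemma u_nonpos: "u t x \<le> 0"
  unfolding u_def using W_nonneg[of t x] by simp

lemma W_finite:
  assumes "q \<ge> 1" "0 \<le> t"
  shows "Lpow q (W t) < \<infinity>"
proof -
  obtain C where C: "Lpow 1 (W t) \<le> ennreal C" using W_L1_bound[of t] assms by auto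
  have "Lpow q (W t) \<le> ennreal ((m * exp (\<bar>t\<bar> / 2)) powr (q - 1)) * Lpow 1 (W t)"
    by (rule Lpow_bounded_le[OF assms(1) W_nonneg W_le W_measurable1])
  also have "\<dots> \<le> ennreal ((m * exp (\<bar>t\<bar> / 2)) powr (q - 1)) * ennreal C"
    by (intro mult_left_mono C) simp
  also have "\<dots> < \<infinity>" by (simp add: ennreal_mult_less_top)
  finally show ?thesis .
qed

lemma P_finite:
  assumes q: "q = 1 \<or> q = p"
  shows "Lpow q (\<lambda>x. \<psi> x + d\<phi> x) < \<infinity>" "Lpow q (\<lambda>x. \<psi> x - d\<phi> x) < \<infinity>"
proof -
  have [measurable]: "d\<phi> \<in> borel_measurable borel" using dphi_int by auto
  have q1: "q \<ge> 0" using q p by auto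
  have fin: "Lpow q \<psi> < \<infinity>" "Lpow q d\<phi> < \<infinity>"
    using q dphi_p psi_p Lpow_1_less_top_iff[of \<psi>] Lpow_1_less_top_iff[of d\<phi>] psi_int dphi_int by auto
  have "Lpow q (\<lambda>x. \<psi> x + d\<phi> x) \<le> ennreal (2 powr q) * (Lpow q \<psi> + Lpow q d\<phi>)"
    using q1 by (intro Lpow_add_le) auto
  also have "\<dots> < \<infinity>" using fin by (auto simp: ennreal_mult_less_top)
  finally show "Lpow q (\<lambda>x. \<psi> x + d\<phi> x) < \<infinity>" .
  have "Lpow q (\<lambda>x. \<psi> x + - d\<phi> x) \<le> ennreal (2 powr q) * (Lpow q \<psi> + Lpow q (\<lambda>x. - d\<phi> x))"
    using q1 by (intro Lpow_add_le) auto
  also have "\<dots> < \<infinity>" using fin by (auto simp: ennreal_mult_less_top Lpow_uminus)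
  finally show "Lpow q (\<lambda>x. \<psi> x - d\<phi> x) < \<infinity>" by simp
qed

lemma exp_half_tendsto: "((\<lambda>t. - exp (- t / 2)) \<longlongrightarrow> - exp (- s / 2)) (at s within T)" for s :: real
  by (intro tendsto_intros) auto

context
  fixes q s :: real
  assumes q: "q = 1 \<or> q = p" and s: "0 \<le> s"
begin

lemma q1: "q \<ge> 1" using q p by auto

lemma W_differentiable:
  "((\<lambda>t. Lpow q (\<lambda>x. (W t x - W s x) / (t - s) - wt s x)) \<longlongrightarrow> 0) (at s within {0..})"
proof (rule Lim_transform_eventually[OF w_differentiable[OF q1 P_finite[OF q] s]])
  show "\<forall>\<^sub>F t in at s within {0..}. Lpow q (\<lambda>x. (w t x - w s x) / (t - s) - wt s x) = Lpow q (\<lambda>x. (W t x - W s x) / (t - s) - wt s x)"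
    unfolding eventually_at_filter by (rule always_eventually) (simp add: w_eq_W s)
qed

text \<open>Differentiability implies continuity: the increment is \<open>t - s\<close> times a
  convergent difference quotient.\<close>

lemma W_continuous: "((\<lambda>t. Lpow q (\<lambda>x. W t x - W s x)) \<longlongrightarrow> 0) (at s within {0..})"
proof -
  have "((\<lambda>t. t - s) \<longlongrightarrow> s - s) (at s within {0..})" by (intro tendsto_intros)
  then have z: "((\<lambda>t. t - s) \<longlongrightarrow> 0) (at s within {0..})" by simp
  have "((\<lambda>t. Lpow q (\<lambda>x. (t - s) * ((W t x - W s x) / (t - s)) - 0 * wt s x)) \<longlongrightarrow> 0) (at s within {0..})"
    using q1 wt_finite[OF q1 P_finite[OF q] s] W_differentiable z by (intro Lpow_scaled_tendsto_0) auto
  then show ?thesis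
  proof (rule Lim_transform_eventually)
    show "\<forall>\<^sub>F t in at s within {0..}. Lpow q (\<lambda>x. (t - s) * ((W t x - W s x) / (t - s)) - 0 * wt s x) = Lpow q (\<lambda>x. W t x - W s x)"
      unfolding eventually_at_filter by (rule always_eventually) simp
  qed
qed

lemma u_finite: "Lpow q (u s) < \<infinity>"
  using W_finite[OF q1 s] unfolding u_def[abs_def] by (simp only: Lpow_cmult[OF W_measurable1]) (simp add: ennreal_mult_less_top)

lemma ux_finite: "Lpow q (ux s) < \<infinity>"
  using wx_finite[OF q1 P_finite[OF q] s] unfolding ux_def[abs_def] by (simp only: Lpow_cmult[OF wx_measurable1]) (simp add: ennreal_mult_less_top)

lemma wt_W_finite: "Lpow q (\<lambda>x. wt s x + (- 1 / 2) * W s x) < \<infinity>"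
proof -
  have "Lpow q (\<lambda>x. wt s x + (- 1 / 2) * W s x) \<le> ennreal (2 powr q) * (Lpow q (wt s) + Lpow q (\<lambda>x. (- 1 / 2) * W s x))"
    using q1 by (intro Lpow_add_le) auto
  also have "\<dots> < \<infinity>" using wt_finite[OF q1 P_finite[OF q] s] W_finite[OF q1 s]
    by (simp only: Lpow_cmult[OF W_measurable1]) (auto simp: ennreal_mult_less_top)
  finally show ?thesis .
qed

lemma ut_finite: "Lpow q (ut s) < \<infinity>"
proof -
  have m: "(\<lambda>x. wt s x + (- 1 / 2) * W s x) \<in> borel_measurable borel" by measurable
  show ?thesis using wt_W_finite unfolding ut_def[abs_def] Lpow_cmult[OF m] by (simp add: ennreal_mult_less_top)
qed

lemma u_continuous: "((\<lambda>t. Lpow q (\<lambda>x. u t x - u s x)) \<longlongrightarrow> 0) (at s within {0..})"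
  unfolding u_def using q1 W_continuous W_finite[OF q1 s] exp_half_tendsto
  by (intro Lpow_scaled_tendsto_0) auto

lemma ux_continuous: "((\<lambda>t. Lpow q (\<lambda>x. ux t x - ux s x)) \<longlongrightarrow> 0) (at s within {0..})"
  unfolding ux_def using q1 wx_continuous[OF q1 P_finite[OF q] s] wx_finite[OF q1 P_finite[OF q] s] exp_half_tendsto
  by (intro Lpow_scaled_tendsto_0) auto

lemma ut_continuous: "((\<lambda>t. Lpow q (\<lambda>x. ut t x - ut s x)) \<longlongrightarrow> 0) (at s within {0..})"
proof -
  have "((\<lambda>t. Lpow q (\<lambda>x. (wt t x - wt s x) + (- 1 / 2) * (W t x - W s x))) \<longlongrightarrow> 0) (at s within {0..})"
    using q1 wt_continuous[OF q1 P_finite[OF q] s] W_continuous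
    by (intro Lpow_add_tendsto_0 Lpow_bounded_cmult_tendsto_0[OF _ _ _ tendsto_const]) auto
  moreover have "(wt t x - wt s x) + (- 1 / 2) * (W t x - W s x) = (wt t x + (- 1 / 2) * W t x) - (wt s x + (- 1 / 2) * W s x)" for t x
    by (simp add: algebra_simps)
  ultimately have "((\<lambda>t. Lpow q (\<lambda>x. (wt t x + (- 1 / 2) * W t x) - (wt s x + (- 1 / 2) * W s x))) \<longlongrightarrow> 0) (at s within {0..})"
    by (simp only:)
  then show ?thesis
    unfolding ut_def using q1 wt_W_finite exp_half_tendsto
    by (intro Lpow_scaled_tendsto_0) auto
qed

lemma u_differentiable:
  "((\<lambda>t. Lpow q (\<lambda>x. (u t x - u s x) / (t - s) - ut s x)) \<longlongrightarrow> 0) (at s within {0..})"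
proof -
  \<comment> \<open>The difference quotient of the product \<open>u\<close> is the factor at time
    \<open>t\<close> times the quotient of \<open>W\<close>, plus the quotient of the factor times
    \<open>W s\<close>; \<open>c\<close> is the deviation of that last quotient from the derivative
    of the factor.\<close>
  define c where "c t = (- exp (- t / 2) - - exp (- s / 2)) / (t - s) - exp (- s / 2) / 2" for t
  have "((\<lambda>t. - exp (- t / 2)) has_real_derivative exp (- s / 2) / 2) (at s within {0..})"
    by (auto intro!: derivative_eq_intros)
  then have "((\<lambda>t. (- exp (- t / 2) - - exp (- s / 2)) / (t - s)) \<longlongrightarrow> exp (- s / 2) / 2) (at s within {0..})"
    by (simp only: has_field_derivative_iff)
  then have c: "(c \<longlongrightarrow> 0) (at s within {0..})" unfolding c_def by (simp add: LIM_zero_iff)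
  have "((\<lambda>t. Lpow q (\<lambda>x. (- exp (- t / 2) * ((W t x - W s x) / (t - s)) - - exp (- s / 2) * wt s x) + c t * W s x)) \<longlongrightarrow> 0) (at s within {0..})"
    using q1 W_differentiable wt_finite[OF q1 P_finite[OF q] s] W_finite[OF q1 s] c exp_half_tendsto
    by (intro Lpow_add_tendsto_0 Lpow_scaled_tendsto_0 Lpow_cmult_null_tendsto_0) auto
  then show ?thesis
  proof (rule Lim_transform_eventually)
    have eq: "(- exp (- t / 2) * ((W t x - W s x) / (t - s)) - - exp (- s / 2) * wt s x) + c t * W s x = (u t x - u s x) / (t - s) - ut s x"
      if "t \<noteq> s" for t x
    proof -
      have "- A * ((a - b) / d) - - B * e + ((- A - - B) / d - B / 2) * b = (- A * a - - B * b) / d - - B * (e + (- 1 / 2) * b)"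
        if "d \<noteq> 0" for A B a b d e :: real
        using that by (simp add: field_simps)
      from this[of "t - s"] show ?thesis unfolding c_def u_def ut_def using that by simp
    qed
    show "\<forall>\<^sub>F t in at s within {0..}. Lpow q (\<lambda>x. (- exp (- t / 2) * ((W t x - W s x) / (t - s)) - - exp (- s / 2) * wt s x) + c t * W s x)
      = Lpow q (\<lambda>x. (u t x - u s x) / (t - s) - ut s x)"
      unfolding eventually_at_filter
    proof (intro always_eventually allI impI arg_cong[where f="Lpow q"] ext)
      fix t x :: real assume "t \<noteq> s"
      then show "(- exp (- t / 2) * ((W t x - W s x) / (t - s)) - - exp (- s / 2) * wt s x) + c t * W s x = (u t x - u s x) / (t - s) - ut s x"
        by (rule eq)
    qed
  qed
qed

end

lemma integrable_u: "0 \<le> t \<Longrightarrow> integrable lborel (u t)"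
  using u_finite[of 1 t] Lpow_1_less_top_iff[of "u t"] by auto

lemma integrable_ux: "0 \<le> t \<Longrightarrow> integrable lborel (ux t)"
  using ux_finite[of 1 t] Lpow_1_less_top_iff[of "ux t"] by auto

lemma u_space_integral:
  assumes "0 \<le> t" "x \<le> y"
  shows "u t y - u t x = (LBINT z:{x..y}. ux t z)"
proof -
  have "u t y - u t x = - exp (- t / 2) * (w t y - w t x)"
    unfolding u_def w_eq_W[OF assms(1)] by (simp add: algebra_simps)
  also have "\<dots> = (LBINT z:{x..y}. ux t z)"
    unfolding w_space_integral[OF assms] ux_def by (rule set_integral_mult_right[symmetric])
  finally show ?thesis .
qed

lemma weak_deriv_u:
  assumes "0 \<le> t"
  shows "has_weak_deriv (u t) (ux t)"
  using assms integrable_u integrable_ux u_space_integral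
  by (intro has_weak_deriv_AC integrable_imp_locally_integrable) auto

text \<open>The Sobolev norm of an increment involves the chosen weak derivative of the difference.
  The choice is not additive, so a derivative of the difference itself has to be exhibited.\<close>

lemma weak_deriv_u_diff:
  assumes "0 \<le> t" "0 \<le> s"
  shows "has_weak_deriv (\<lambda>x. u t x - u s x) (\<lambda>x. ux t x - ux s x)"
proof (rule has_weak_deriv_AC)
  show "integrable lborel (\<lambda>x. ux t x - ux s x)" using assms integrable_ux by auto
  show "locally_integrable (\<lambda>x. u t x - u s x)"
    using assms integrable_u by (intro integrable_imp_locally_integrable) auto
  fix x y :: real assume "x \<le> y"
  have "set_integrable lborel {x..y} (ux t)" "set_integrable lborel {x..y} (ux s)"
    unfolding set_integrable_def using integrable_ux assms by (auto intro!: integrable_mult_indicator simp del: real_scaleR_def)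
  then have "(LBINT z:{x..y}. ux t z - ux s z) = (LBINT z:{x..y}. ux t z) - (LBINT z:{x..y}. ux s z)"
    by (rule set_integral_diff(2))
  then show "u t y - u s y - (u t x - u s x) = (LBINT z:{x..y}. ux t z - ux s z)"
    using u_space_integral[OF assms(1) \<open>x \<le> y\<close>] u_space_integral[OF assms(2) \<open>x \<le> y\<close>] by simp
qed

lemma u_in_L_space: "0 \<le> t \<Longrightarrow> u t \<in> L_space 1 \<inter> L_space p"
  using u_finite by (auto simp: L_space_iff)

lemma u_C0_L1Lp: "u \<in> C0_into {0..} (L1Lp_space p) (L1Lp_norm p)"
  unfolding C0_into_def
proof (intro CollectI conjI ballI)
  show "u t \<in> L1Lp_space p" if "t \<in> {0..}" for t
    using u_in_L_space that unfolding L1Lp_space_def by auto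
  fix s :: real assume s: "s \<in> {0..}"
  have "((\<lambda>t. L_norm 1 (\<lambda>x. u t x - u s x) + L_norm p (\<lambda>x. u t x - u s x)) \<longlongrightarrow> 0 + 0) (at s within {0..})"
    using s p u_continuous by (intro tendsto_add L_norm_tendsto_0) auto
  then show "((\<lambda>t. L1Lp_norm p (\<lambda>x. u t x - u s x)) \<longlongrightarrow> 0) (at s within {0..})"
    unfolding L1Lp_norm_def by simp
qed

lemma u_C0_W11W1p: "u \<in> C0_into {0..} (W11W1p_space p) (W11W1p_norm p)"
  unfolding C0_into_def
proof (intro CollectI conjI ballI)
  show "u t \<in> W11W1p_space p" if "t \<in> {0..}" for t
    unfolding W11W1p_space_def W1_space_def
    using that u_in_L_space[of t] weak_deriv_u[of t] ux_finite[of _ t] by (auto simp: L_space_iff)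
  fix s :: real assume s: "s \<in> {0..}"
  have "((\<lambda>t. (L_norm 1 (\<lambda>x. u t x - u s x) + L_norm 1 (\<lambda>x. ux t x - ux s x))
      + (L_norm p (\<lambda>x. u t x - u s x) + L_norm p (\<lambda>x. ux t x - ux s x))) \<longlongrightarrow> (0 + 0) + (0 + 0)) (at s within {0..})"
    using s p u_continuous ux_continuous by (intro tendsto_add L_norm_tendsto_0) auto
  then have "((\<lambda>t. (L_norm 1 (\<lambda>x. u t x - u s x) + L_norm 1 (\<lambda>x. ux t x - ux s x))
      + (L_norm p (\<lambda>x. u t x - u s x) + L_norm p (\<lambda>x. ux t x - ux s x))) \<longlongrightarrow> 0) (at s within {0..})" by simp
  then show "((\<lambda>t. W11W1p_norm p (\<lambda>x. u t x - u s x)) \<longlongrightarrow> 0) (at s within {0..})"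
  proof (rule Lim_transform_eventually)
    show "\<forall>\<^sub>F t in at s within {0..}. (L_norm 1 (\<lambda>x. u t x - u s x) + L_norm 1 (\<lambda>x. ux t x - ux s x))
      + (L_norm p (\<lambda>x. u t x - u s x) + L_norm p (\<lambda>x. ux t x - ux s x)) = W11W1p_norm p (\<lambda>x. u t x - u s x)"
      unfolding eventually_at_filter W11W1p_norm_def W1_norm_def
      using s by (intro always_eventually) (simp add: L_norm_weak_deriv[OF weak_deriv_u_diff])
  qed
qed

lemma u_C1: "u \<in> C1_into {0<..} (L1Lp_space p) (L1Lp_norm p)"
  unfolding C1_into_def
proof (intro CollectI conjI ballI bexI)
  show "u t \<in> L1Lp_space p" if "t \<in> {0<..}" for t
    using u_in_L_space that unfolding L1Lp_space_def by auto
  show "ut \<in> C0_into {0<..} (L1Lp_space p) (L1Lp_norm p)"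
    unfolding C0_into_def
  proof (intro CollectI conjI ballI)
    show "ut t \<in> L1Lp_space p" if "t \<in> {0<..}" for t
      using ut_finite[of _ t] that unfolding L1Lp_space_def by (auto simp: L_space_iff)
    fix s :: real assume s: "s \<in> {0<..}"
    have "((\<lambda>t. L_norm 1 (\<lambda>x. ut t x - ut s x) + L_norm p (\<lambda>x. ut t x - ut s x)) \<longlongrightarrow> 0 + 0) (at s within {0..})"
      using s p ut_continuous by (intro tendsto_add L_norm_tendsto_0) auto
    then show "((\<lambda>t. L1Lp_norm p (\<lambda>x. ut t x - ut s x)) \<longlongrightarrow> 0) (at s within {0<..})"
      unfolding L1Lp_norm_def by (intro tendsto_within_subset[where S="{0..}" and T="{0<..}"]) auto
  qed
  fix s :: real assume s: "s \<in> {0<..}"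
  have "((\<lambda>t. L_norm 1 (\<lambda>x. (u t x - u s x) / (t - s) - ut s x) + L_norm p (\<lambda>x. (u t x - u s x) / (t - s) - ut s x)) \<longlongrightarrow> 0 + 0) (at s within {0..})"
    using s p u_differentiable by (intro tendsto_add L_norm_tendsto_0) auto
  then show "((\<lambda>t. L1Lp_norm p (\<lambda>x. (u t x - u s x) / (t - s) - ut s x)) \<longlongrightarrow> 0) (at s within {0<..})"
    unfolding L1Lp_norm_def by (intro tendsto_within_subset[where S="{0..}" and T="{0<..}"]) auto
qed

end

theorem theorem1p2:
  fixes p :: real
  assumes "p > 1"
  shows "\<exists>\<epsilon>\<^sub>1>0. \<forall>u0 u1 :: real \<Rightarrow> real.
    u0 \<in> W11W1p_space p \<longrightarrow>
    u1 \<in> L1Lp_space p \<longrightarrow>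
    W11W1p_norm p u0 + L1Lp_norm p u1 \<le> \<epsilon>\<^sub>1 \<longrightarrow>
    (AE x in lborel. u0 x \<le> 0) \<longrightarrow>
    (AE x in lborel. u1 x + 1 / 2 * u0 x \<le> 0) \<longrightarrow>
    (\<exists>u :: real \<Rightarrow> real \<Rightarrow> real.
      mild_solution p u0 u1 u \<and>
      u \<in> C0_into {0..} (W11W1p_space p) (W11W1p_norm p) \<and>
      u \<in> C1_into {0<..} (L1Lp_space p) (L1Lp_norm p) \<and>
      (\<forall>t\<ge>0. AE x in lborel. u t x \<le> 0))"
proof -
  \<comment> \<open>The solution of \<open>p * m powr (p - 1) = 1/4\<close>, the largest level up to
    which the slope of \<open>s powr p\<close> is at most 1/4; it also serves as the bound on the
    data.\<close>
  define m where "m = (1 / (4 * p)) powr (1 / (p - 1))"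
  have m: "m > 0" unfolding m_def using assms by simp
  have "m powr (p - 1) = 1 / (4 * p)" unfolding m_def using assms by (simp add: powr_powr)
  then have pm: "p * m powr (p - 1) \<le> 1 / 4" using assms by simp
  show ?thesis
  proof (intro exI[of _ m] conjI allI impI m)
    fix u0 u1 :: "real \<Rightarrow> real"
    assume u0: "u0 \<in> W11W1p_space p" and u1: "u1 \<in> L1Lp_space p"
      and small: "W11W1p_norm p u0 + L1Lp_norm p u1 \<le> m"
      and u0_neg: "AE x in lborel. u0 x \<le> 0" and u1_neg: "AE x in lborel. u1 x + 1 / 2 * u0 x \<le> 0"
    obtain h hp where h: "h \<in> L_space 1" "has_weak_deriv u0 h" and hp: "hp \<in> L_space p" "has_weak_deriv u0 hp"
      using u0 unfolding W11W1p_space_def W1_space_def by auto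
    have [measurable]: "u0 \<in> borel_measurable borel" "u1 \<in> borel_measurable borel" "h \<in> borel_measurable borel"
      using u0 u1 h(1) unfolding W11W1p_space_def W1_space_def L1Lp_space_def by (auto simp: L_space_iff)
    have iu0: "integrable lborel u0" and iu1: "integrable lborel u1" and ih: "integrable lborel h"
      using u0 u1 h(1) Lpow_1_less_top_iff unfolding W11W1p_space_def W1_space_def L1Lp_space_def
      by (auto simp: L_space_iff)
    have u0p: "Lpow p u0 < \<infinity>" and u1p: "Lpow p u1 < \<infinity>"
      using u0 u1 unfolding W11W1p_space_def W1_space_def L1Lp_space_def by (auto simp: L_space_iff)
    \<comment> \<open>The weak derivatives in \<open>L^1\<close> and in \<open>L^p\<close> are given
      as separate functions; uniqueness identifies them.\<close>
    have hp': "Lpow p h < \<infinity>"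
      using Lpow_cong_AE[OF has_weak_deriv_unique[OF h(2) hp(2)], of p] hp(1) by (simp add: L_space_iff)
    define d\<phi> where "d\<phi> x = - h x" for x
    define \<phi> where "\<phi> x = (LBINT y:{..x}. d\<phi> y)" for x
    \<comment> \<open>The maximum changes the function only on a null set and makes it nonnegative
      at every point.\<close>
    define \<psi> where "\<psi> x = max 0 (- (u1 x + 1 / 2 * u0 x))" for x
    \<comment> \<open>The embedding of \<open>W^{1,1}\<close> into bounded functions: a primitive is
      at most the \<open>L^1\<close> norm of its derivative.\<close>
    define M where "M = (LINT x|lborel. \<bar>h x\<bar>)"
    have idphi: "integrable lborel d\<phi>" unfolding d\<phi>_def using ih by simp
    have u0_phi: "AE x in lborel. u0 x = - \<phi> x"
      using W11_representative[OF iu0 ih h(2)] by eventually_elim (simp add: \<phi>_def d\<phi>_def set_lebesgue_integral_def)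
    have u1_psi: "AE x in lborel. u1 x + 1 / 2 * u0 x = - \<psi> x"
      using u1_neg by eventually_elim (simp add: \<psi>_def)
    have cont: "continuous_on UNIV \<phi>" unfolding \<phi>_def by (rule primitive_continuous[OF idphi])
    have phi_nonneg: "0 \<le> \<phi> x" for x
    proof (rule nonneg_if_AE_nonneg[OF cont])
      show "AE x in lborel. 0 \<le> \<phi> x" using u0_neg u0_phi by eventually_elim simp
    qed
    have [measurable]: "\<phi> \<in> borel_measurable borel" using cont by (rule borel_measurable_continuous_onI)
    have iphi: "integrable lborel \<phi>"
    proof -
      have "AE x in lborel. - u0 x = \<phi> x" using u0_phi by eventually_elim simp
      then show ?thesis using iu0 integrable_cong_AE[of "\<lambda>x. - u0 x" lborel \<phi>] by simp
    qed
    have phi_le: "\<phi> x \<le> M" for x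
      using primitive_bound[OF idphi, of x] unfolding \<phi>_def M_def d\<phi>_def by simp
    have ipsi: "integrable lborel \<psi>" unfolding \<psi>_def using iu0 iu1 by (intro integrable_max) auto
    have dphi_p: "Lpow p d\<phi> < \<infinity>" unfolding d\<phi>_def[abs_def] using hp' by (simp add: Lpow_uminus)
    have psi_p: "Lpow p \<psi> < \<infinity>"
    proof -
      have "Lpow p \<psi> \<le> Lpow p (\<lambda>x. u1 x + (1 / 2) * u0 x)"
        using assms by (intro Lpow_mono_AE) (auto simp: \<psi>_def)
      also have "\<dots> \<le> ennreal (2 powr p) * (Lpow p u1 + Lpow p (\<lambda>x. (1 / 2) * u0 x))"
        using assms by (intro Lpow_add_le) auto
      also have "Lpow p (\<lambda>x. (1 / 2) * u0 x) = ennreal (\<bar>1 / 2\<bar> powr p) * Lpow p u0"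
        by (rule Lpow_cmult) simp
      also have "ennreal (2 powr p) * (Lpow p u1 + ennreal (\<bar>1 / 2\<bar> powr p) * Lpow p u0) < \<infinity>"
        using u0p u1p by (auto simp: ennreal_mult_less_top)
      finally show ?thesis .
    qed
    have int_phi: "(LINT x|lborel. \<phi> x) = L_norm 1 u0"
      unfolding L_norm_1_eq[OF \<open>u0 \<in> borel_measurable borel\<close>]
    proof (rule integral_cong_AE)
      show "AE x in lborel. \<phi> x = \<bar>u0 x\<bar>" using u0_phi by eventually_elim (simp add: phi_nonneg)
    qed auto
    define Q where "Q = (LINT x|lborel. \<psi> x)"
    have int_psi: "Q \<le> L_norm 1 u1 + L_norm 1 u0 / 2"
    proof -
      have "(LINT x|lborel. \<psi> x) \<le> (LINT x|lborel. \<bar>u1 x\<bar> + \<bar>u0 x\<bar> / 2)"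
        using ipsi iu0 iu1 by (intro integral_mono) (auto simp: \<psi>_def)
      also have "\<dots> = L_norm 1 u1 + L_norm 1 u0 / 2"
        using iu0 iu1 by (simp add: L_norm_1_eq)
      finally show ?thesis unfolding Q_def .
    qed
    have "M = L_norm 1 (weak_deriv u0)"
      unfolding L_norm_weak_deriv[OF h(2)] M_def by (simp add: L_norm_1_eq)
    moreover have "0 \<le> L_norm q g" for q g unfolding L_norm_def by simp
    \<comment> \<open>The \<open>L^1\<close> norm of \<open>u0\<close> occurs twice with factor 1/4,
      once directly and once through \<open>\<psi>\<close>; every coefficient stays at most 1, so
      the norms of the data dominate.\<close>
    ultimately have "M + L_norm 1 u0 / 4 + (L_norm 1 u1 + L_norm 1 u0 / 2) / 2 \<le> W11W1p_norm p u0 + L1Lp_norm p u1"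
      unfolding W11W1p_norm_def W1_norm_def L1Lp_norm_def by (simp add: add_increasing2 field_simps)
    note small_sum = this
    have "Q / 2 \<le> (L_norm 1 u1 + L_norm 1 u0 / 2) / 2" using int_psi by (rule divide_right_mono) simp
    from order_trans[OF add_left_mono[OF this] order_trans[OF small_sum small]]
    have small': "M + (LINT x|lborel. \<phi> x) / 4 + (LINT x|lborel. \<psi> x) / 2 \<le> m"
      unfolding int_phi Q_def .
    interpret small_Sobolev_data p m \<phi> \<psi> M d\<phi>
      by unfold_locales
        (use assms m pm phi_nonneg phi_le iphi ipsi small' idphi dphi_p psi_p in \<open>auto simp: \<psi>_def \<phi>_def\<close>)
    show "\<exists>u :: real \<Rightarrow> real \<Rightarrow> real.
      mild_solution p u0 u1 u \<and>
      u \<in> C0_into {0..} (W11W1p_space p) (W11W1p_norm p) \<and>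
      u \<in> C1_into {0<..} (L1Lp_space p) (L1Lp_norm p) \<and>
      (\<forall>t\<ge>0. AE x in lborel. u t x \<le> 0)"
    proof (intro exI[of _ u] conjI allI impI)
      show "mild_solution p u0 u1 u"
        unfolding mild_solution_def
        using u_C0_L1Lp mild_identity[OF _ _ _ u0_phi u1_psi integrable_imp_locally_integrable[OF iu0]] by auto
    qed (use u_C0_W11W1p u_C1 u_nonpos in auto)
  qed
qed

end
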